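(* Let $\mathcal{A}$ be a semi-abelian category with enough (regular) projectives which satisfies the following condition: whenever $B$ is an $\mathrm{Ab}(\mathcal{A})$-perfect object and $f\colon B\to A$ and $g\colon C\to B$ are $\mathrm{Ab}(\mathcal{A})$-central extensions in $\mathcal{A}$, the extension $f\circ g$ is $\mathrm{Ab}(\mathcal{A})$-central. Let $\mathcal{B}$ be a Birkhoff subcategory of $\mathcal{A}$ containing $\mathrm{Ab}(\mathcal{A})$, with reflector $I$. Then a $\mathcal{B}$-central extension $u\colon U\to A$ is a universal $\mathcal{B}$-central extension if and only if $\mathrm{H}_1(U,I)=0$ and $\mathrm{H}_2(U,I)=0$.
   Context: A category is semi-abelian when it is pointed, Barr exact and Bourn protomodular with binary coproducts. A Birkhoff subcategory $\mathcal{B}$ of a semi-abelian category $\mathcal{A}$ is a full reflective subcategory closed under subobjects and regular quotients; $I\colon\mathcal{A}\to\mathcal{B}$ is the left adjoint of the inclusion, with unit $\eta_A\colon A\to I(A)$. $\mathrm{Ab}(\mathcal{A})$ is the Birkhoff subcategory of $\mathcal{A}$ of all objects admitting an internal abelian group structure. An object $P$ is $\mathcal{B}$-perfect when $I(P)=0$. An extension is a regular epimorphism. An extension $f\colon B\to A$ is $\mathcal{B}$-trivial when the naturality square $\eta_A\circ f=I(f)\circ\eta_B$ is a pullback, and $\mathcal{B}$-central when there is an extension $g\colon C\to A$ such that the pullback $g^*(f)$ of $f$ along $g$ is $\mathcal{B}$-trivial. A universal $\mathcal{B}$-central extension of $A$ is an initial object of the full subcategory of the slice category $(\mathcal{A}\downarrow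 A)$ determined by the $\mathcal{B}$-central extensions of $A$. Enough projectives: every object $A$ admits a regular epimorphism $P\to A$ with $P$ (regular) projective, called a projective presentation of $A$. For an object $A$, $\mu_A\colon[A,A]_{\mathcal{B}}\to A$ is the kernel of $\eta_A$; this is functorial in $A$, the induced map being denoted $[f,f]_{\mathcal{B}}$. For an extension $f\colon B\to A$ with kernel $K$ and kernel pair projections $f_0,f_1\colon B\times_AB\to B$, $[K,B]_{\mathcal{B}}$ is the kernel of $[f_0,f_0]_{\mathcal{B}}$, regarded as a normal subobject of $B$ via $\mu_B\circ[f_1,f_1]_{\mathcal{B}}\circ\ker[f_0,f_0]_{\mathcal{B}}$. $\mathrm{H}_1(A,I)=I(A)$, and $\mathrm{H}_2(A,I)=(K\wedge[P,P]_{\mathcal{B}})/[K,P]_{\mathcal{B}}$, where $P\to A$ is any projective presentation of $A$ with kernel $K$; up to isomorphism this is independent of the chosen presentation. *)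

theory Defs
  imports Main
begin

section \<open>Categories\<close>

record ('o, 'a) cat =
  Ob :: "'o set"
  Ar :: "'a set"
  Dom :: "'a \<Rightarrow> 'o"
  Cod :: "'a \<Rightarrow> 'o"
  Ident :: "'o \<Rightarrow> 'a"
  Cmp :: "'a \<Rightarrow> 'a \<Rightarrow> 'a"  (infixl "\<cdot>\<index>" 70)

definition hom :: "('o, 'a) cat \<Rightarrow> 'o \<Rightarrow> 'o \<Rightarrow> 'a set" where
  "hom C A B = {f \<in> Ar C. Dom C f = A \<and> Cod C f = B}"

definition category :: "('o, 'a) cat \<Rightarrow> bool" where
  "category C \<longleftrightarrow>
    (\<forall>f\<in>Ar C. Dom C f \<in> Ob C \<and> Cod C f \<in> Ob C) \<and>
    (\<forall>A\<in>Ob C. Ident C A \<in> hom C A A) \<and>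
    (\<forall>f\<in>Ar C. \<forall>g\<in>Ar C. Cod C f = Dom C g \<longrightarrow> g \<cdot>\<^bsub>C\<^esub> f \<in> hom C (Dom C f) (Cod C g)) \<and>
    (\<forall>f\<in>Ar C. f \<cdot>\<^bsub>C\<^esub> Ident C (Dom C f) = f \<and> Ident C (Cod C f) \<cdot>\<^bsub>C\<^esub> f = f) \<and>
    (\<forall>f\<in>Ar C. \<forall>g\<in>Ar C. \<forall>h\<in>Ar C. Cod C f = Dom C g \<longrightarrow> Cod C g = Dom C h \<longrightarrow>
       h \<cdot>\<^bsub>C\<^esub> (g \<cdot>\<^bsub>C\<^esub> f) = (h \<cdot>\<^bsub>C\<^esub> g) \<cdot>\<^bsub>C\<^esub> f)"

definition monic :: "('o, 'a) cat \<Rightarrow> 'a \<Rightarrow> bool" where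
  "monic C m \<longleftrightarrow> m \<in> Ar C \<and>
    (\<forall>Z. \<forall>x\<in>hom C Z (Dom C m). \<forall>y\<in>hom C Z (Dom C m). m \<cdot>\<^bsub>C\<^esub> x = m \<cdot>\<^bsub>C\<^esub> y \<longrightarrow> x = y)"

definition iso :: "('o, 'a) cat \<Rightarrow> 'a \<Rightarrow> bool" where
  "iso C f \<longleftrightarrow> f \<in> Ar C \<and>
    (\<exists>g\<in>hom C (Cod C f) (Dom C f).
      g \<cdot>\<^bsub>C\<^esub> f = Ident C (Dom C f) \<and> f \<cdot>\<^bsub>C\<^esub> g = Ident C (Cod C f))"


section \<open>Limits and colimits\<close>

definition terminal_obj :: "('o, 'a) cat \<Rightarrow> 'o \<Rightarrow> bool" where
  "terminal_obj C T \<longleftrightarrow> T \<in> Ob C \<and> (\<forall>A\<in>Ob C. \<exists>!f. f \<in> hom C A T)"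

definition initial_obj :: "('o, 'a) cat \<Rightarrow> 'o \<Rightarrow> bool" where
  "initial_obj C S \<longleftrightarrow> S \<in> Ob C \<and> (\<forall>A\<in>Ob C. \<exists>!f. f \<in> hom C S A)"

definition zero_obj :: "('o, 'a) cat \<Rightarrow> 'o \<Rightarrow> bool" where
  "zero_obj C Z \<longleftrightarrow> initial_obj C Z \<and> terminal_obj C Z"

definition zero_arr :: "('o, 'a) cat \<Rightarrow> 'a \<Rightarrow> bool" where
  "zero_arr C f \<longleftrightarrow> f \<in> Ar C \<and>
    (\<exists>Z. zero_obj C Z \<and> (\<exists>t\<in>hom C (Dom C f) Z. \<exists>s\<in>hom C Z (Cod C f). f = s \<cdot>\<^bsub>C\<^esub> t))"

definition is_product :: "('o, 'a) cat \<Rightarrow> 'o \<Rightarrow> 'o \<Rightarrow> 'a \<Rightarrow> 'a \<Rightarrow> bool" where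
  "is_product C A B p q \<longleftrightarrow> Dom C p = Dom C q \<and>
    p \<in> hom C (Dom C p) A \<and> q \<in> hom C (Dom C p) B \<and>
    (\<forall>Z. \<forall>x\<in>hom C Z A. \<forall>y\<in>hom C Z B.
      \<exists>!h. h \<in> hom C Z (Dom C p) \<and> p \<cdot>\<^bsub>C\<^esub> h = x \<and> q \<cdot>\<^bsub>C\<^esub> h = y)"

definition is_coproduct :: "('o, 'a) cat \<Rightarrow> 'o \<Rightarrow> 'o \<Rightarrow> 'a \<Rightarrow> 'a \<Rightarrow> bool" where
  "is_coproduct C A B i j \<longleftrightarrow> Cod C i = Cod C j \<and>
    i \<in> hom C A (Cod C i) \<and> j \<in> hom C B (Cod C i) \<and>
    (\<forall>Z. \<forall>x\<in>hom C A Z. \<forall>y\<in>hom C B Z.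
      \<exists>!h. h \<in> hom C (Cod C i) Z \<and> h \<cdot>\<^bsub>C\<^esub> i = x \<and> h \<cdot>\<^bsub>C\<^esub> j = y)"

text \<open>\<open>is_pullback C f g p q\<close>: the square \<open>f \<cdot> p = g \<cdot> q\<close> is a pullback; so \<open>p\<close> is the
  pullback of \<open>g\<close> along \<open>f\<close>, and \<open>q\<close> is the pullback of \<open>f\<close> along \<open>g\<close>.\<close>

definition is_pullback :: "('o, 'a) cat \<Rightarrow> 'a \<Rightarrow> 'a \<Rightarrow> 'a \<Rightarrow> 'a \<Rightarrow> bool" where
  "is_pullback C f g p q \<longleftrightarrow> f \<in> Ar C \<and> g \<in> Ar C \<and> Cod C f = Cod C g \<and> Dom C p = Dom C q \<and>
    p \<in> hom C (Dom C p) (Dom C f) \<and> q \<in> hom C (Dom C p) (Dom C g) \<and>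
    f \<cdot>\<^bsub>C\<^esub> p = g \<cdot>\<^bsub>C\<^esub> q \<and>
    (\<forall>Z. \<forall>x\<in>hom C Z (Dom C f). \<forall>y\<in>hom C Z (Dom C g). f \<cdot>\<^bsub>C\<^esub> x = g \<cdot>\<^bsub>C\<^esub> y \<longrightarrow>
      (\<exists>!h. h \<in> hom C Z (Dom C p) \<and> p \<cdot>\<^bsub>C\<^esub> h = x \<and> q \<cdot>\<^bsub>C\<^esub> h = y))"

abbreviation kernel_pair :: "('o, 'a) cat \<Rightarrow> 'a \<Rightarrow> 'a \<Rightarrow> 'a \<Rightarrow> bool" where
  "kernel_pair C f f0 f1 \<equiv> is_pullback C f f f0 f1"

definition is_coequalizer :: "('o, 'a) cat \<Rightarrow> 'a \<Rightarrow> 'a \<Rightarrow> 'a \<Rightarrow> bool" where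
  "is_coequalizer C f g q \<longleftrightarrow> f \<in> Ar C \<and> g \<in> hom C (Dom C f) (Cod C f) \<and>
    q \<in> hom C (Cod C f) (Cod C q) \<and> q \<cdot>\<^bsub>C\<^esub> f = q \<cdot>\<^bsub>C\<^esub> g \<and>
    (\<forall>Z. \<forall>x\<in>hom C (Cod C f) Z. x \<cdot>\<^bsub>C\<^esub> f = x \<cdot>\<^bsub>C\<^esub> g \<longrightarrow>
      (\<exists>!h. h \<in> hom C (Cod C q) Z \<and> h \<cdot>\<^bsub>C\<^esub> q = x))"

definition regular_epi :: "('o, 'a) cat \<Rightarrow> 'a \<Rightarrow> bool" where
  "regular_epi C q \<longleftrightarrow> (\<exists>f g. is_coequalizer C f g q)"

definition is_kernel :: "('o, 'a) cat \<Rightarrow> 'a \<Rightarrow> 'a \<Rightarrow> bool" where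
  "is_kernel C k f \<longleftrightarrow> f \<in> Ar C \<and> k \<in> hom C (Dom C k) (Dom C f) \<and> zero_arr C (f \<cdot>\<^bsub>C\<^esub> k) \<and>
    (\<forall>Z. \<forall>x\<in>hom C Z (Dom C f). zero_arr C (f \<cdot>\<^bsub>C\<^esub> x) \<longrightarrow>
      (\<exists>!h. h \<in> hom C Z (Dom C k) \<and> k \<cdot>\<^bsub>C\<^esub> h = x))"

definition is_cokernel :: "('o, 'a) cat \<Rightarrow> 'a \<Rightarrow> 'a \<Rightarrow> bool" where
  "is_cokernel C q f \<longleftrightarrow> f \<in> Ar C \<and> q \<in> hom C (Cod C f) (Cod C q) \<and> zero_arr C (q \<cdot>\<^bsub>C\<^esub> f) \<and>
    (\<forall>Z. \<forall>x\<in>hom C (Cod C f) Z. zero_arr C (x \<cdot>\<^bsub>C\<^esub> f) \<longrightarrow>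
      (\<exists>!h. h \<in> hom C (Cod C q) Z \<and> h \<cdot>\<^bsub>C\<^esub> q = x))"


section \<open>Semi-abelian categories\<close>

definition pointed :: "('o, 'a) cat \<Rightarrow> bool" where
  "pointed C \<longleftrightarrow> (\<exists>Z. zero_obj C Z)"

definition has_binary_coproducts :: "('o, 'a) cat \<Rightarrow> bool" where
  "has_binary_coproducts C \<longleftrightarrow> (\<forall>A\<in>Ob C. \<forall>B\<in>Ob C. \<exists>i j. is_coproduct C A B i j)"

text \<open>All finite limits can be constructed from a terminal object and pullbacks.\<close>

definition finitely_complete :: "('o, 'a) cat \<Rightarrow> bool" where
  "finitely_complete C \<longleftrightarrow> (\<exists>T. terminal_obj C T) \<and>
    (\<forall>f\<in>Ar C. \<forall>g\<in>Ar C. Cod C f = Cod C g \<longrightarrow> (\<exists>p q. is_pullback C f g p q))"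

definition regular_category :: "('o, 'a) cat \<Rightarrow> bool" where
  "regular_category C \<longleftrightarrow> finitely_complete C \<and>
    (\<forall>f f0 f1. kernel_pair C f f0 f1 \<longrightarrow> (\<exists>q. is_coequalizer C f0 f1 q)) \<and>
    (\<forall>f g p q. is_pullback C f g p q \<longrightarrow> regular_epi C g \<longrightarrow> regular_epi C p)"

definition internal_equivalence_relation :: "('o, 'a) cat \<Rightarrow> 'o \<Rightarrow> 'a \<Rightarrow> 'a \<Rightarrow> bool" where
  "internal_equivalence_relation C X r0 r1 \<longleftrightarrow> Dom C r0 = Dom C r1 \<and>
    r0 \<in> hom C (Dom C r0) X \<and> r1 \<in> hom C (Dom C r0) X \<and>
    (\<forall>Z. \<forall>x\<in>hom C Z (Dom C r0). \<forall>y\<in>hom C Z (Dom C r0).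
      r0 \<cdot>\<^bsub>C\<^esub> x = r0 \<cdot>\<^bsub>C\<^esub> y \<longrightarrow> r1 \<cdot>\<^bsub>C\<^esub> x = r1 \<cdot>\<^bsub>C\<^esub> y \<longrightarrow> x = y) \<and>
    (\<exists>e\<in>hom C X (Dom C r0). r0 \<cdot>\<^bsub>C\<^esub> e = Ident C X \<and> r1 \<cdot>\<^bsub>C\<^esub> e = Ident C X) \<and>
    (\<exists>s\<in>hom C (Dom C r0) (Dom C r0). r0 \<cdot>\<^bsub>C\<^esub> s = r1 \<and> r1 \<cdot>\<^bsub>C\<^esub> s = r0) \<and>
    (\<forall>p q. is_pullback C r1 r0 p q \<longrightarrow>
      (\<exists>t\<in>hom C (Dom C p) (Dom C r0). r0 \<cdot>\<^bsub>C\<^esub> t = r0 \<cdot>\<^bsub>C\<^esub> p \<and> r1 \<cdot>\<^bsub>C\<^esub> t = r1 \<cdot>\<^bsub>C\<^esub> q))"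

definition barr_exact :: "('o, 'a) cat \<Rightarrow> bool" where
  "barr_exact C \<longleftrightarrow> regular_category C \<and>
    (\<forall>X r0 r1. internal_equivalence_relation C X r0 r1 \<longrightarrow> (\<exists>f. kernel_pair C f r0 r1))"

definition point :: "('o, 'a) cat \<Rightarrow> 'o \<Rightarrow> 'a \<Rightarrow> 'a \<Rightarrow> bool" where
  "point C B p s \<longleftrightarrow> p \<in> hom C (Dom C p) B \<and> s \<in> hom C B (Dom C p) \<and> p \<cdot>\<^bsub>C\<^esub> s = Ident C B"

text \<open>Bourn's definition: for every \<open>v : E \<rightarrow> B\<close> the change-of-base functor
  \<open>v\<^sup>* : Pt(B) \<rightarrow> Pt(E)\<close> between the categories of points reflects isomorphisms. Below, \<open>h\<close> is
  a morphism of points over \<open>B\<close> and \<open>h'\<close> is its image under \<open>v\<^sup>*\<close>; a morphism of points is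
  invertible iff its underlying arrow is.\<close>

definition protomodular :: "('o, 'a) cat \<Rightarrow> bool" where
  "protomodular C \<longleftrightarrow>
    (\<forall>v p s p' s' h y0 y1 y0' y1' h'.
      v \<in> Ar C \<longrightarrow> point C (Cod C v) p s \<longrightarrow> point C (Cod C v) p' s' \<longrightarrow>
      h \<in> hom C (Dom C p) (Dom C p') \<longrightarrow> p' \<cdot>\<^bsub>C\<^esub> h = p \<longrightarrow> h \<cdot>\<^bsub>C\<^esub> s = s' \<longrightarrow>
      is_pullback C v p y0 y1 \<longrightarrow> is_pullback C v p' y0' y1' \<longrightarrow>
      h' \<in> hom C (Dom C y0) (Dom C y0') \<longrightarrow> y0' \<cdot>\<^bsub>C\<^esub> h' = y0 \<longrightarrow> y1' \<cdot>\<^bsub>C\<^esub> h' = h \<cdot>\<^bsub>C\<^esub> y1 \<longrightarrow>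
      iso C h' \<longrightarrow> iso C h)"

definition semi_abelian :: "('o, 'a) cat \<Rightarrow> bool" where
  "semi_abelian C \<longleftrightarrow> category C \<and> pointed C \<and> barr_exact C \<and> protomodular C \<and>
    has_binary_coproducts C"

definition projective :: "('o, 'a) cat \<Rightarrow> 'o \<Rightarrow> bool" where
  "projective C P \<longleftrightarrow> P \<in> Ob C \<and>
    (\<forall>q g. regular_epi C q \<longrightarrow> g \<in> hom C P (Cod C q) \<longrightarrow>
      (\<exists>h\<in>hom C P (Dom C q). q \<cdot>\<^bsub>C\<^esub> h = g))"

definition projective_presentation :: "('o, 'a) cat \<Rightarrow> 'o \<Rightarrow> 'a \<Rightarrow> bool" where
  "projective_presentation C A p \<longleftrightarrow> regular_epi C p \<and> Cod C p = A \<and> projective C (Dom C p)"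

definition enough_projectives :: "('o, 'a) cat \<Rightarrow> bool" where
  "enough_projectives C \<longleftrightarrow> (\<forall>A\<in>Ob C. \<exists>p. projective_presentation C A p)"


section \<open>Internal abelian groups\<close>

text \<open>The arrow into the product with projections \<open>p\<close>, \<open>q\<close> that has components \<open>x\<close>, \<open>y\<close>.\<close>

definition pairing :: "('o, 'a) cat \<Rightarrow> 'a \<Rightarrow> 'a \<Rightarrow> 'a \<Rightarrow> 'a \<Rightarrow> 'a" where
  "pairing C p q x y =
    (THE h. h \<in> hom C (Dom C x) (Dom C p) \<and> p \<cdot>\<^bsub>C\<^esub> h = x \<and> q \<cdot>\<^bsub>C\<^esub> h = y)"

text \<open>\<open>p\<close>, \<open>q\<close> are the projections of \<open>A \<times> A\<close>; \<open>r\<close>, \<open>z\<close> are those of \<open>(A \<times> A) \<times> A\<close>, so that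
  \<open>p \<cdot> r\<close>, \<open>q \<cdot> r\<close> and \<open>z\<close> are the three projections onto \<open>A\<close>; \<open>t\<close> is the arrow \<open>A \<rightarrow> T\<close>.\<close>

definition internal_abelian_group ::
    "('o, 'a) cat \<Rightarrow> 'o \<Rightarrow> 'a \<Rightarrow> 'a \<Rightarrow> 'a \<Rightarrow> 'a \<Rightarrow> 'a \<Rightarrow> 'a \<Rightarrow> 'o \<Rightarrow> 'a \<Rightarrow> 'a \<Rightarrow> bool" where
  "internal_abelian_group C A p q r z m e T t i \<longleftrightarrow>
    is_product C A A p q \<and> is_product C (Dom C p) A r z \<and>
    terminal_obj C T \<and> t \<in> hom C A T \<and>
    m \<in> hom C (Dom C p) A \<and> e \<in> hom C T A \<and> i \<in> hom C A A \<and>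
    m \<cdot>\<^bsub>C\<^esub> pairing C p q (m \<cdot>\<^bsub>C\<^esub> r) z =
      m \<cdot>\<^bsub>C\<^esub> pairing C p q (p \<cdot>\<^bsub>C\<^esub> r) (m \<cdot>\<^bsub>C\<^esub> pairing C p q (q \<cdot>\<^bsub>C\<^esub> r) z) \<and>
    m \<cdot>\<^bsub>C\<^esub> pairing C p q (e \<cdot>\<^bsub>C\<^esub> t) (Ident C A) = Ident C A \<and>
    m \<cdot>\<^bsub>C\<^esub> pairing C p q (Ident C A) (e \<cdot>\<^bsub>C\<^esub> t) = Ident C A \<and>
    m \<cdot>\<^bsub>C\<^esub> pairing C p q i (Ident C A) = e \<cdot>\<^bsub>C\<^esub> t \<and>
    m \<cdot>\<^bsub>C\<^esub> pairing C p q (Ident C A) i = e \<cdot>\<^bsub>C\<^esub> t \<and>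
    m \<cdot>\<^bsub>C\<^esub> pairing C p q q p = m"

text \<open>A full subcategory is represented by its set of objects.\<close>

definition Ab :: "('o, 'a) cat \<Rightarrow> 'o set" where
  "Ab C = {A \<in> Ob C. \<exists>p q r z m e T t i. internal_abelian_group C A p q r z m e T t i}"


section \<open>Birkhoff subcategories\<close>

text \<open>\<open>is_reflection C X A e\<close>: \<open>e\<close> is a universal arrow from \<open>A\<close> to the full subcategory \<open>X\<close>.\<close>

definition is_reflection :: "('o, 'a) cat \<Rightarrow> 'o set \<Rightarrow> 'o \<Rightarrow> 'a \<Rightarrow> bool" where
  "is_reflection C X A e \<longleftrightarrow> e \<in> hom C A (Cod C e) \<and> Cod C e \<in> X \<and>
    (\<forall>Y\<in>X. \<forall>g\<in>hom C A Y. \<exists>!h. h \<in> hom C (Cod C e) Y \<and> h \<cdot>\<^bsub>C\<^esub> e = g)"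

definition birkhoff_subcategory :: "('o, 'a) cat \<Rightarrow> 'o set \<Rightarrow> bool" where
  "birkhoff_subcategory C X \<longleftrightarrow> X \<subseteq> Ob C \<and>
    (\<forall>A\<in>Ob C. \<exists>e. is_reflection C X A e) \<and>
    (\<forall>m. monic C m \<longrightarrow> Cod C m \<in> X \<longrightarrow> Dom C m \<in> X) \<and>
    (\<forall>q. regular_epi C q \<longrightarrow> Dom C q \<in> X \<longrightarrow> Cod C q \<in> X)"

text \<open>A choice of left adjoint of the inclusion: the functor on objects and on arrows, and the
  unit of the adjunction.\<close>

record ('o, 'a) reflector =
  Rob :: "'o \<Rightarrow> 'o"
  Rar :: "'a \<Rightarrow> 'a"
  Runit :: "'o \<Rightarrow> 'a"

definition is_reflector :: "('o, 'a) cat \<Rightarrow> 'o set \<Rightarrow> ('o, 'a) reflector \<Rightarrow> bool" where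
  "is_reflector C X I \<longleftrightarrow>
    (\<forall>A\<in>Ob C. Rob I A \<in> X) \<and>
    (\<forall>f\<in>Ar C. Rar I f \<in> hom C (Rob I (Dom C f)) (Rob I (Cod C f))) \<and>
    (\<forall>A\<in>Ob C. Rar I (Ident C A) = Ident C (Rob I A)) \<and>
    (\<forall>f\<in>Ar C. \<forall>g\<in>Ar C. Cod C f = Dom C g \<longrightarrow> Rar I (g \<cdot>\<^bsub>C\<^esub> f) = Rar I g \<cdot>\<^bsub>C\<^esub> Rar I f) \<and>
    (\<forall>f\<in>Ar C. Rar I f \<cdot>\<^bsub>C\<^esub> Runit I (Dom C f) = Runit I (Cod C f) \<cdot>\<^bsub>C\<^esub> f) \<and>
    (\<forall>A\<in>Ob C. Runit I A \<in> hom C A (Rob I A) \<and> is_reflection C X A (Runit I A))"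


section \<open>Central extensions\<close>

abbreviation extension :: "('o, 'a) cat \<Rightarrow> 'a \<Rightarrow> bool" where
  "extension C f \<equiv> regular_epi C f"

text \<open>Perfect objects and trivial extensions refer to the full subcategory \<open>X\<close> only and are
  phrased with arbitrary reflection arrows, which are unique up to a unique isomorphism. For a
  given reflector this amounts to using its unit; see \<open>perfect_iff\<close> and \<open>trivial_extension_iff\<close>
  below.\<close>

definition perfect :: "('o, 'a) cat \<Rightarrow> 'o set \<Rightarrow> 'o \<Rightarrow> bool" where
  "perfect C X P \<longleftrightarrow> P \<in> Ob C \<and> (\<exists>e. is_reflection C X P e \<and> zero_obj C (Cod C e))"

definition trivial_extension :: "('o, 'a) cat \<Rightarrow> 'o set \<Rightarrow> 'a \<Rightarrow> bool" where
  "trivial_extension C X f \<longleftrightarrow> extension C f \<and>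
    (\<exists>eB eA h. is_reflection C X (Dom C f) eB \<and> is_reflection C X (Cod C f) eA \<and>
      h \<in> hom C (Cod C eB) (Cod C eA) \<and> is_pullback C h eA eB f)"

lemma comp_hom:
  assumes "category C" "f \<in> hom C A B" "g \<in> hom C B D"
  shows "g \<cdot>\<^bsub>C\<^esub> f \<in> hom C A D"
  using assms unfolding category_def hom_def by auto

lemma comp_assoc:
  assumes "category C" "f \<in> hom C A B" "g \<in> hom C B D" "h \<in> hom C D E"
  shows "h \<cdot>\<^bsub>C\<^esub> (g \<cdot>\<^bsub>C\<^esub> f) = (h \<cdot>\<^bsub>C\<^esub> g) \<cdot>\<^bsub>C\<^esub> f"
  using assms unfolding category_def hom_def by auto

lemma ident_left:
  assumes "category C" "f \<in> hom C A B"
  shows "Ident C B \<cdot>\<^bsub>C\<^esub> f = f"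
  using assms unfolding category_def hom_def by auto

lemma ident_hom:
  assumes "category C" "f \<in> hom C A B"
  shows "Ident C A \<in> hom C A A" "Ident C B \<in> hom C B B"
  using assms unfolding category_def hom_def by auto

lemma reflection_comparison:
  assumes C: "category C" and e: "is_reflection C X A e" and e': "is_reflection C X A e'"
  obtains i j where "i \<in> hom C (Cod C e) (Cod C e')" "j \<in> hom C (Cod C e') (Cod C e)"
    "i \<cdot>\<^bsub>C\<^esub> e = e'" "j \<cdot>\<^bsub>C\<^esub> e' = e" "j \<cdot>\<^bsub>C\<^esub> i = Ident C (Cod C e)"
proof -
  have eh: "e \<in> hom C A (Cod C e)" and eX: "Cod C e \<in> X"
    and e'h: "e' \<in> hom C A (Cod C e')" and e'X: "Cod C e' \<in> X"
    using e e' unfolding is_reflection_def by auto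
  obtain i where i: "i \<in> hom C (Cod C e) (Cod C e')" "i \<cdot>\<^bsub>C\<^esub> e = e'"
    using e e'X e'h unfolding is_reflection_def by blast
  obtain j where j: "j \<in> hom C (Cod C e') (Cod C e)" "j \<cdot>\<^bsub>C\<^esub> e' = e"
    using e' eX eh unfolding is_reflection_def by blast
  have "(j \<cdot>\<^bsub>C\<^esub> i) \<cdot>\<^bsub>C\<^esub> e = e"
    using comp_assoc[OF C eh i(1) j(1)] i(2) j(2) by simp
  moreover have "j \<cdot>\<^bsub>C\<^esub> i \<in> hom C (Cod C e) (Cod C e)"
    using comp_hom[OF C i(1) j(1)] .
  moreover have "\<exists>!h. h \<in> hom C (Cod C e) (Cod C e) \<and> h \<cdot>\<^bsub>C\<^esub> e = e"
    using e eX eh unfolding is_reflection_def by blast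
  ultimately have "j \<cdot>\<^bsub>C\<^esub> i = Ident C (Cod C e)"
    using ident_hom(2)[OF C eh] ident_left[OF C eh] by blast
  then show thesis using that i j by blast
qed

lemma zero_obj_transfer:
  assumes C: "category C" and i: "i \<in> hom C Z W" and j: "j \<in> hom C W Z"
    and ji: "j \<cdot>\<^bsub>C\<^esub> i = Ident C Z" and ij: "i \<cdot>\<^bsub>C\<^esub> j = Ident C W" and Z: "zero_obj C Z"
  shows "zero_obj C W"
proof -
  have W: "W \<in> Ob C" using C i unfolding category_def hom_def by auto
  have init: "\<exists>!f. f \<in> hom C W A" if A: "A \<in> Ob C" for A
  proof -
    obtain g where g: "g \<in> hom C Z A" and uniq: "\<And>g'. g' \<in> hom C Z A \<Longrightarrow> g' = g"
      using Z A unfolding zero_obj_def initial_obj_def by metis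
    have "f = g \<cdot>\<^bsub>C\<^esub> j" if f: "f \<in> hom C W A" for f
    proof -
      have "f = f \<cdot>\<^bsub>C\<^esub> (i \<cdot>\<^bsub>C\<^esub> j)" using C f ij unfolding category_def hom_def by auto
      also have "\<dots> = (f \<cdot>\<^bsub>C\<^esub> i) \<cdot>\<^bsub>C\<^esub> j" using comp_assoc[OF C j i f] .
      also have "f \<cdot>\<^bsub>C\<^esub> i = g" using uniq comp_hom[OF C i f] .
      finally show ?thesis .
    qed
    then show ?thesis using comp_hom[OF C j g] by blast
  qed
  have fin: "\<exists>!f. f \<in> hom C A W" if A: "A \<in> Ob C" for A
  proof -
    obtain g where g: "g \<in> hom C A Z" and uniq: "\<And>g'. g' \<in> hom C A Z \<Longrightarrow> g' = g"
      using Z A unfolding zero_obj_def terminal_obj_def by metis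
    have "f = i \<cdot>\<^bsub>C\<^esub> g" if f: "f \<in> hom C A W" for f
    proof -
      have "f = (i \<cdot>\<^bsub>C\<^esub> j) \<cdot>\<^bsub>C\<^esub> f" using ident_left[OF C f] ij by simp
      also have "\<dots> = i \<cdot>\<^bsub>C\<^esub> (j \<cdot>\<^bsub>C\<^esub> f)" using comp_assoc[OF C f j i] by simp
      also have "j \<cdot>\<^bsub>C\<^esub> f = g" using uniq comp_hom[OF C f j] .
      finally show ?thesis .
    qed
    then show ?thesis using comp_hom[OF C g i] by blast
  qed
  show ?thesis
    unfolding zero_obj_def initial_obj_def terminal_obj_def using W init fin by blast
qed

lemma perfect_iff:
  assumes C: "category C" and I: "is_reflector C X I" and P: "P \<in> Ob C"
  shows "perfect C X P \<longleftrightarrow> zero_obj C (Rob I P)"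
proof
  have \<eta>: "is_reflection C X P (Runit I P)" "Cod C (Runit I P) = Rob I P"
    using I P unfolding is_reflector_def hom_def by auto
  show "perfect C X P" if "zero_obj C (Rob I P)"
    using that \<eta> P unfolding perfect_def by auto
  assume "perfect C X P"
  then obtain e where e: "is_reflection C X P e" and Z: "zero_obj C (Cod C e)"
    unfolding perfect_def by auto
  obtain i j where ij: "i \<in> hom C (Cod C (Runit I P)) (Cod C e)"
    "j \<in> hom C (Cod C e) (Cod C (Runit I P))" "j \<cdot>\<^bsub>C\<^esub> i = Ident C (Cod C (Runit I P))"
    using reflection_comparison[OF C \<eta>(1) e] by metis
  have "i \<cdot>\<^bsub>C\<^esub> j \<in> hom C (Cod C e) (Cod C e)" using comp_hom[OF C ij(2,1)] .
  moreover have "Ident C (Cod C e) \<in> hom C (Cod C e) (Cod C e)" using ident_hom(2)[OF C ij(1)] .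
  ultimately have "i \<cdot>\<^bsub>C\<^esub> j = Ident C (Cod C e)"
    using Z unfolding zero_obj_def initial_obj_def by metis
  then show "zero_obj C (Rob I P)"
    using zero_obj_transfer[OF C ij(2,1) _ ij(3) Z] \<eta>(2) by simp
qed

lemma trivial_extension_iff:
  assumes C: "category C" and I: "is_reflector C X I"
  shows "trivial_extension C X f \<longleftrightarrow> extension C f \<and>
    is_pullback C (Rar I f) (Runit I (Cod C f)) (Runit I (Dom C f)) f"
proof (cases "extension C f")
  case False
  then show ?thesis unfolding trivial_extension_def by simp
next
  case ext: True
  let ?A = "Cod C f" and ?B = "Dom C f"
  let ?\<eta>A = "Runit I ?A" and ?\<eta>B = "Runit I ?B"
  have f: "f \<in> Ar C" "f \<in> hom C ?B ?A"
    using ext unfolding regular_epi_def is_coequalizer_def hom_def by auto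
  have Ob: "?A \<in> Ob C" "?B \<in> Ob C" using C f unfolding category_def by auto
  have \<eta>: "?\<eta>A \<in> hom C ?A (Rob I ?A)" "?\<eta>B \<in> hom C ?B (Rob I ?B)"
    and rA: "is_reflection C X ?A ?\<eta>A" and rB: "is_reflection C X ?B ?\<eta>B"
    and If: "Rar I f \<in> hom C (Rob I ?B) (Rob I ?A)"
    and nat: "Rar I f \<cdot>\<^bsub>C\<^esub> ?\<eta>B = ?\<eta>A \<cdot>\<^bsub>C\<^esub> f"
    using I Ob f unfolding is_reflector_def by auto
  have cods: "Cod C ?\<eta>A = Rob I ?A" "Cod C ?\<eta>B = Rob I ?B" using \<eta> unfolding hom_def by auto
  show ?thesis
  proof
    assume "extension C f \<and> is_pullback C (Rar I f) ?\<eta>A ?\<eta>B f"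
    then show "trivial_extension C X f"
      unfolding trivial_extension_def using rA rB If cods by metis
  next
    assume "trivial_extension C X f"
    then obtain eB eA h where eB: "is_reflection C X ?B eB" and eA: "is_reflection C X ?A eA"
      and h: "h \<in> hom C (Cod C eB) (Cod C eA)" and pb: "is_pullback C h eA eB f"
      unfolding trivial_extension_def by auto
    obtain i j where i: "i \<in> hom C (Rob I ?B) (Cod C eB)" and j: "j \<in> hom C (Cod C eB) (Rob I ?B)"
      and ie: "i \<cdot>\<^bsub>C\<^esub> ?\<eta>B = eB" and ji: "j \<cdot>\<^bsub>C\<^esub> i = Ident C (Rob I ?B)"
      using reflection_comparison[OF C rB eB] cods by metis
    obtain i' where i': "i' \<in> hom C (Rob I ?A) (Cod C eA)" and ie': "i' \<cdot>\<^bsub>C\<^esub> ?\<eta>A = eA"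
      using reflection_comparison[OF C rA eA] cods by metis
    have eBh: "eB \<in> hom C ?B (Cod C eB)" and eAh: "eA \<in> hom C ?A (Cod C eA)"
      and eAX: "Cod C eA \<in> X"
      using eA eB unfolding is_reflection_def by auto
    have sq: "h \<cdot>\<^bsub>C\<^esub> eB = eA \<cdot>\<^bsub>C\<^esub> f" using pb unfolding is_pullback_def by auto
    have univ: "\<exists>!k. k \<in> hom C Z ?B \<and> eB \<cdot>\<^bsub>C\<^esub> k = x \<and> f \<cdot>\<^bsub>C\<^esub> k = y"
      if "x \<in> hom C Z (Cod C eB)" "y \<in> hom C Z ?A" "h \<cdot>\<^bsub>C\<^esub> x = eA \<cdot>\<^bsub>C\<^esub> y" for Z x y
    proof -
      have "Dom C h = Cod C eB" "Dom C eA = ?A" "Dom C eB = ?B"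
        using h eAh eBh unfolding hom_def by auto
      with pb that show ?thesis unfolding is_pullback_def by simp
    qed
    have "(h \<cdot>\<^bsub>C\<^esub> i) \<cdot>\<^bsub>C\<^esub> ?\<eta>B = eA \<cdot>\<^bsub>C\<^esub> f"
      using comp_assoc[OF C \<eta>(2) i h] ie sq by simp
    moreover have "(i' \<cdot>\<^bsub>C\<^esub> Rar I f) \<cdot>\<^bsub>C\<^esub> ?\<eta>B = eA \<cdot>\<^bsub>C\<^esub> f"
      using comp_assoc[OF C \<eta>(2) If i'] comp_assoc[OF C f(2) \<eta>(1) i'] ie' nat by simp
    moreover have "\<exists>!k. k \<in> hom C (Rob I ?B) (Cod C eA) \<and> k \<cdot>\<^bsub>C\<^esub> ?\<eta>B = eA \<cdot>\<^bsub>C\<^esub> f"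
      using rB eAX comp_hom[OF C f(2) eAh] cods unfolding is_reflection_def by auto
    ultimately have hi: "h \<cdot>\<^bsub>C\<^esub> i = i' \<cdot>\<^bsub>C\<^esub> Rar I f"
      using comp_hom[OF C i h] comp_hom[OF C If i'] by blast
    have "\<exists>!k. k \<in> hom C Z ?B \<and> ?\<eta>B \<cdot>\<^bsub>C\<^esub> k = x \<and> f \<cdot>\<^bsub>C\<^esub> k = y"
      if x: "x \<in> hom C Z (Rob I ?B)" and y: "y \<in> hom C Z ?A"
        and xy: "Rar I f \<cdot>\<^bsub>C\<^esub> x = ?\<eta>A \<cdot>\<^bsub>C\<^esub> y" for Z x y
    proof -
      have iff: "?\<eta>B \<cdot>\<^bsub>C\<^esub> k = x \<longleftrightarrow> eB \<cdot>\<^bsub>C\<^esub> k = i \<cdot>\<^bsub>C\<^esub> x" if k: "k \<in> hom C Z ?B" for k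
      proof -
        have 1: "eB \<cdot>\<^bsub>C\<^esub> k = i \<cdot>\<^bsub>C\<^esub> (?\<eta>B \<cdot>\<^bsub>C\<^esub> k)"
          using comp_assoc[OF C k \<eta>(2) i] ie by simp
        have 2: "j \<cdot>\<^bsub>C\<^esub> (i \<cdot>\<^bsub>C\<^esub> z) = z" if "z \<in> hom C Z (Rob I ?B)" for z
          using comp_assoc[OF C that i j] ji ident_left[OF C that] by simp
        show ?thesis using 1 2[OF x] 2[OF comp_hom[OF C k \<eta>(2)]] by metis
      qed
      have "h \<cdot>\<^bsub>C\<^esub> (i \<cdot>\<^bsub>C\<^esub> x) = eA \<cdot>\<^bsub>C\<^esub> y"
        using comp_assoc[OF C x i h] comp_assoc[OF C x If i'] comp_assoc[OF C y \<eta>(1) i']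
          hi xy ie' by simp
      from univ[OF comp_hom[OF C x i] y this] show ?thesis using iff by metis
    qed
    moreover have "Dom C (Rar I f) = Rob I ?B" "Cod C (Rar I f) = Rob I ?A" "Rar I f \<in> Ar C"
      "Dom C ?\<eta>A = ?A" "?\<eta>A \<in> Ar C" "Dom C ?\<eta>B = ?B"
      using \<eta> If unfolding hom_def by auto
    ultimately have "is_pullback C (Rar I f) ?\<eta>A ?\<eta>B f"
      unfolding is_pullback_def using \<eta> f nat cods by simp
    then show "extension C f \<and> is_pullback C (Rar I f) ?\<eta>A ?\<eta>B f" using ext by simp
  qed
qed

definition central_extension :: "('o, 'a) cat \<Rightarrow> 'o set \<Rightarrow> 'a \<Rightarrow> bool" where
  "central_extension C X f \<longleftrightarrow> extension C f \<and>
    (\<exists>g p q. extension C g \<and> is_pullback C g f p q \<and> trivial_extension C X p)"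

text \<open>The conditions spell out initiality of \<open>u\<close> in the full subcategory of the slice over \<open>A\<close>
  whose objects are the \<open>X\<close>-central extensions of \<open>A\<close>.\<close>

definition universal_central_extension :: "('o, 'a) cat \<Rightarrow> 'o set \<Rightarrow> 'o \<Rightarrow> 'a \<Rightarrow> bool" where
  "universal_central_extension C X A u \<longleftrightarrow> central_extension C X u \<and> Cod C u = A \<and>
    (\<forall>f. central_extension C X f \<longrightarrow> Cod C f = A \<longrightarrow>
      (\<exists>!h. h \<in> hom C (Dom C u) (Dom C f) \<and> f \<cdot>\<^bsub>C\<^esub> h = u))"


section \<open>Homology\<close>

text \<open>\<open>is_relative_commutator C I f c\<close>: the arrow \<open>c\<close> represents the normal subobject \<open>[K, B]\<close>
  of \<open>B\<close>, where \<open>K\<close> is the kernel of the extension \<open>f : B \<rightarrow> A\<close>. Here \<open>\<mu>R\<close> and \<open>\<mu>B\<close> are the kernels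
  of the units at \<open>R = B \<times>\<^sub>A B\<close> and at \<open>B\<close>, and \<open>\<phi>0\<close>, \<open>\<phi>1\<close> are \<open>[f0, f0]\<close> and \<open>[f1, f1]\<close>.\<close>

definition is_relative_commutator ::
    "('o, 'a) cat \<Rightarrow> ('o, 'a) reflector \<Rightarrow> 'a \<Rightarrow> 'a \<Rightarrow> bool" where
  "is_relative_commutator C I f c \<longleftrightarrow>
    (\<exists>f0 f1 \<mu>R \<mu>B \<phi>0 \<phi>1 \<kappa>. kernel_pair C f f0 f1 \<and>
      is_kernel C \<mu>R (Runit I (Dom C f0)) \<and> is_kernel C \<mu>B (Runit I (Dom C f)) \<and>
      \<phi>0 \<in> hom C (Dom C \<mu>R) (Dom C \<mu>B) \<and> \<mu>B \<cdot>\<^bsub>C\<^esub> \<phi>0 = f0 \<cdot>\<^bsub>C\<^esub> \<mu>R \<and>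
      \<phi>1 \<in> hom C (Dom C \<mu>R) (Dom C \<mu>B) \<and> \<mu>B \<cdot>\<^bsub>C\<^esub> \<phi>1 = f1 \<cdot>\<^bsub>C\<^esub> \<mu>R \<and>
      is_kernel C \<kappa> \<phi>0 \<and> c = (\<mu>B \<cdot>\<^bsub>C\<^esub> \<phi>1) \<cdot>\<^bsub>C\<^esub> \<kappa>)"

definition H1 :: "('o, 'a) reflector \<Rightarrow> 'o \<Rightarrow> 'o" where
  "H1 I A = Rob I A"

text \<open>\<open>f\<close> is a projective presentation of \<open>A\<close> with kernel \<open>k\<close>, and \<open>\<mu>\<close> represents \<open>[P, P]\<close>. The
  intersection of the subobjects \<open>k\<close> and \<open>\<mu>\<close> is their pullback, \<open>j\<close> is the inclusion of \<open>[K, P]\<close>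
  into it, and the quotient is the cokernel of \<open>j\<close>.\<close>

definition is_H2 :: "('o, 'a) cat \<Rightarrow> ('o, 'a) reflector \<Rightarrow> 'o \<Rightarrow> 'o \<Rightarrow> bool" where
  "is_H2 C I A H \<longleftrightarrow>
    (\<exists>f k \<mu> c a b j q. projective_presentation C A f \<and> is_kernel C k f \<and>
      is_kernel C \<mu> (Runit I (Dom C f)) \<and> is_relative_commutator C I f c \<and>
      is_pullback C k \<mu> a b \<and>
      j \<in> hom C (Dom C c) (Dom C a) \<and> (k \<cdot>\<^bsub>C\<^esub> a) \<cdot>\<^bsub>C\<^esub> j = c \<and>
      is_cokernel C q j \<and> H = Cod C q)"

text \<open>The object \<open>H\<close> above is determined by \<open>A\<close> up to isomorphism.\<close>

definition H2 :: "('o, 'a) cat \<Rightarrow> ('o, 'a) reflector \<Rightarrow> 'o \<Rightarrow> 'o" where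
  "H2 C I A = (SOME H. is_H2 C I A H)"

end

theory Submission
  imports Defs
begin

text \<open>Generalized elements \<open>x : Z \<rightarrow> A\<close> replace commutators: \<open>x\<close> lies in \<open>[A, A]\<close> iff \<open>\<eta>\<^sub>A x = 0\<close>, and
  an extension \<open>f\<close> is \<open>X\<close>-central iff the projections of its kernel pair \<open>R\<close> agree on \<open>[R, R]\<close>.

  If \<open>u : U \<rightarrow> A\<close> is universal, comparing the maps \<open>(u, \<eta>)\<close> and \<open>(u, 0)\<close> into the central extension
  \<open>A \<times> I(U) \<rightarrow> A\<close> gives \<open>\<eta> = 0\<close>, so \<open>U\<close> is perfect. For a central \<open>V \<rightarrow> U\<close> the object \<open>W = [V, V]\<close> is again
  perfect and covers \<open>U\<close>. A central extension with perfect domain has \<open>R \<cong> B \<times> I(R)\<close> with diagonal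
  \<open>(1, 0)\<close>, which makes \<open>I(R)\<close> abelian and the extension \<open>Ab\<close>-central. By the hypothesis on composites
  \<open>W \<rightarrow> U \<rightarrow> A\<close> is then central, and universality splits \<open>V \<rightarrow> U\<close>. Splitting \<open>P/[K, P] \<rightarrow> U\<close> yields
  \<open>K \<inter> [P, P] = [K, P]\<close>. Conversely, if \<open>U\<close> is perfect then it is the quotient of \<open>[P, P]\<close> by \<open>K \<inter> [P, P]\<close>;
  if this is \<open>[K, P]\<close>, every lift \<open>P \<rightarrow> V\<close> to a central extension \<open>V\<close> of \<open>U\<close> kills it and descends to a
  splitting. Pulling back along \<open>u\<close> gives universality.\<close>

section \<open>Arrows, pullbacks and regular epimorphisms\<close>

text \<open>The composition hypothesis concerns \<open>Ab C\<close>, the claim concerns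
  \<open>X\<close>. Passing from \<open>Ab C\<close>-central to \<open>X\<close>-central is free
  because \<open>Ab C\<close> lies in \<open>X\<close>; the way back is available for a perfect
  domain, whereas the domain \<open>V\<close> of a central extension of \<open>U\<close> is
  arbitrary. This is why \<open>V\<close> is replaced by \<open>[V, V]\<close> before anything is
  composed.

  Both implications turn on a condition that mentions neither \<open>H2\<close> nor
  \<open>A\<close>: \<open>U\<close> is perfect and every central extension of \<open>U\<close>
  splits.

  The obstacle throughout is that objects have no points and arrows no differences. An element of
  the target of a regular epimorphism lifts only after the test object is replaced by a cover, so
  equations are proved on a cover and cancelled. What would be a calculation with
  \<open>b1 - b0\<close> becomes an application of protomodularity: a subobject of the domain of a
  split epimorphism that contains the section and the kernel is everything. Symmetry and
  transitivity of relations, the group laws on \<open>I(R)\<close> and the lifting of elements of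
  \<open>[A, A]\<close> along extensions all rest on this principle.\<close>

locale cat =
  fixes C :: "('o, 'a) cat" (structure)
  assumes category: "category C"
begin

abbreviation in_hom :: "'a \<Rightarrow> 'o \<Rightarrow> 'o \<Rightarrow> bool" ("\<guillemotleft>_ : _ \<rightarrow> _\<guillemotright>")
  where "\<guillemotleft>f : A \<rightarrow> B\<guillemotright> \<equiv> f \<in> hom C A B"

abbreviation idt :: "'o \<Rightarrow> 'a" where "idt \<equiv> Ident C"

lemma comp_arr [simp]:
  assumes "f \<in> Ar C" "g \<in> Ar C" "Cod C f = Dom C g"
  shows "g \<cdot> f \<in> Ar C" "Dom C (g \<cdot> f) = Dom C f" "Cod C (g \<cdot> f) = Cod C g"
  using category assms unfolding category_def hom_def by auto

lemma comp_assoc_arr [simp]: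
  assumes "f \<in> Ar C" "g \<in> Ar C" "h \<in> Ar C" "Cod C f = Dom C g" "Cod C g = Dom C h"
  shows "(h \<cdot> g) \<cdot> f = h \<cdot> (g \<cdot> f)"
  using category assms unfolding category_def by metis

lemma ob_arr [simp]:
  assumes "f \<in> Ar C"
  shows "Dom C f \<in> Ob C" "Cod C f \<in> Ob C"
  using category assms unfolding category_def by auto

lemma ident_arr [simp]:
  assumes "A \<in> Ob C"
  shows "idt A \<in> Ar C" "Dom C (idt A) = A" "Cod C (idt A) = A"
  using category assms unfolding category_def hom_def by auto

lemma comp_ident [simp]:
  assumes "f \<in> Ar C"
  shows "Dom C f = A \<Longrightarrow> f \<cdot> idt A = f" "Cod C f = A \<Longrightarrow> idt A \<cdot> f = f"
  using category assms unfolding category_def by auto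

lemma in_hom_ob: "\<guillemotleft>f : A \<rightarrow> B\<guillemotright> \<Longrightarrow> A \<in> Ob C" "\<guillemotleft>f : A \<rightarrow> B\<guillemotright> \<Longrightarrow> B \<in> Ob C"
  by (auto simp: hom_def)

lemma comp_in_hom [intro]: "\<guillemotleft>f : A \<rightarrow> B\<guillemotright> \<Longrightarrow> \<guillemotleft>g : B \<rightarrow> D\<guillemotright> \<Longrightarrow> \<guillemotleft>g \<cdot> f : A \<rightarrow> D\<guillemotright>"
  by (simp add: hom_def)

lemma ident_in_hom [intro]: "A \<in> Ob C \<Longrightarrow> \<guillemotleft>idt A : A \<rightarrow> A\<guillemotright>"
  by (simp add: hom_def)

text \<open>Lets the simplifier apply an equation between composites in the middle of a
  right-associated composite.\<close>

lemma reassoc: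
  assumes "g \<cdot> f = w" "f \<in> Ar C" "g \<in> Ar C" "Cod C f = Dom C g" "z \<in> Ar C" "Cod C z = Dom C f"
  shows "g \<cdot> (f \<cdot> z) = w \<cdot> z"
  using assms by (metis comp_assoc_arr)

section \<open>Monomorphisms and isomorphisms\<close>

lemma monic_cancel:
  assumes "monic C m" "\<guillemotleft>m : A \<rightarrow> B\<guillemotright>" "\<guillemotleft>x : Z \<rightarrow> A\<guillemotright>" "\<guillemotleft>y : Z \<rightarrow> A\<guillemotright>" "m \<cdot> x = m \<cdot> y"
  shows "x = y"
  using assms unfolding monic_def by (auto simp: hom_def)

lemma monicI:
  assumes "\<guillemotleft>m : A \<rightarrow> B\<guillemotright>"
    and "\<And>Z x y. \<guillemotleft>x : Z \<rightarrow> A\<guillemotright> \<Longrightarrow> \<guillemotleft>y : Z \<rightarrow> A\<guillemotright> \<Longrightarrow> m \<cdot> x = m \<cdot> y \<Longrightarrow> x = y"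
  shows "monic C m"
  using assms unfolding monic_def by (auto simp: hom_def)

lemma monic_comp_cancel:
  assumes "monic C (g \<cdot> f)" "\<guillemotleft>f : A \<rightarrow> B\<guillemotright>" "\<guillemotleft>g : B \<rightarrow> D\<guillemotright>"
  shows "monic C f"
proof (rule monicI[OF assms(2)])
  fix Z x y assume xy: "\<guillemotleft>x : Z \<rightarrow> A\<guillemotright>" "\<guillemotleft>y : Z \<rightarrow> A\<guillemotright>" "f \<cdot> x = f \<cdot> y"
  have "(g \<cdot> f) \<cdot> x = (g \<cdot> f) \<cdot> y" using assms(2,3) xy by (simp add: hom_def)
  then show "x = y" using monic_cancel[OF assms(1)] assms(2,3) xy by blast
qed

lemma split_mono: "\<guillemotleft>m : A \<rightarrow> B\<guillemotright> \<Longrightarrow> \<guillemotleft>r : B \<rightarrow> A\<guillemotright> \<Longrightarrow> r \<cdot> m = idt A \<Longrightarrow> monic C m"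
proof (rule monicI)
  fix Z x y assume a: "\<guillemotleft>m : A \<rightarrow> B\<guillemotright>" "\<guillemotleft>r : B \<rightarrow> A\<guillemotright>" "r \<cdot> m = idt A"
    and xy: "\<guillemotleft>x : Z \<rightarrow> A\<guillemotright>" "\<guillemotleft>y : Z \<rightarrow> A\<guillemotright>" "m \<cdot> x = m \<cdot> y"
  have "r \<cdot> (m \<cdot> x) = r \<cdot> (m \<cdot> y)" using xy by simp
  then show "x = y" using a xy(1,2) by (simp add: hom_def reassoc[OF a(3)])
qed

lemma isoE:
  assumes "iso C f" "\<guillemotleft>f : A \<rightarrow> B\<guillemotright>"
  obtains g where "\<guillemotleft>g : B \<rightarrow> A\<guillemotright>" "g \<cdot> f = idt A" "f \<cdot> g = idt B"
  using assms unfolding iso_def hom_def by auto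

lemma isoI:
  assumes "\<guillemotleft>f : A \<rightarrow> B\<guillemotright>" "\<guillemotleft>g : B \<rightarrow> A\<guillemotright>" "g \<cdot> f = idt A" "f \<cdot> g = idt B"
  shows "iso C f"
  using assms unfolding iso_def hom_def by auto

lemma iso_ident: "A \<in> Ob C \<Longrightarrow> iso C (idt A)"
  by (rule isoI[where g = "idt A"]) (auto simp: hom_def)

lemma monic_split_epi_iso:
  assumes "monic C m" "\<guillemotleft>m : A \<rightarrow> B\<guillemotright>" "\<guillemotleft>s : B \<rightarrow> A\<guillemotright>" "m \<cdot> s = idt B"
  shows "iso C m"
proof (rule isoI[OF assms(2,3) _ assms(4)])
  have "m \<cdot> (s \<cdot> m) = m \<cdot> idt A"
    using assms(2,3) by (simp add: hom_def reassoc[OF assms(4)])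
  then show "s \<cdot> m = idt A"
    using monic_cancel[OF assms(1,2)] assms(2,3) in_hom_ob by blast
qed

section \<open>Pullbacks\<close>

lemma pullbackD:
  assumes "is_pullback C f g p q"
  shows "f \<in> Ar C" "g \<in> Ar C" "Cod C f = Cod C g" "Dom C p = Dom C q" "\<guillemotleft>p : Dom C p \<rightarrow> Dom C f\<guillemotright>"
    "\<guillemotleft>q : Dom C p \<rightarrow> Dom C g\<guillemotright>" "f \<cdot> p = g \<cdot> q"
  using assms unfolding is_pullback_def by blast+

lemma pullbackE:
  assumes "is_pullback C f g p q" "\<guillemotleft>f : A \<rightarrow> D\<guillemotright>"
  obtains B P where "\<guillemotleft>g : B \<rightarrow> D\<guillemotright>" "\<guillemotleft>p : P \<rightarrow> A\<guillemotright>" "\<guillemotleft>q : P \<rightarrow> B\<guillemotright>" "f \<cdot> p = g \<cdot> q"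
  using pullbackD[OF assms(1)] assms(2) by (simp add: hom_def)

lemma pullback_lift:
  assumes "is_pullback C f g p q" "\<guillemotleft>p : P \<rightarrow> A\<guillemotright>" "\<guillemotleft>q : P \<rightarrow> B\<guillemotright>"
    and "\<guillemotleft>x : Z \<rightarrow> A\<guillemotright>" "\<guillemotleft>y : Z \<rightarrow> B\<guillemotright>" "f \<cdot> x = g \<cdot> y"
  obtains h where "\<guillemotleft>h : Z \<rightarrow> P\<guillemotright>" "p \<cdot> h = x" "q \<cdot> h = y"
proof -
  have "Dom C f = A" "Dom C g = B" "Dom C p = P"
    using pullbackD[OF assms(1)] assms(2,3) by (auto simp: hom_def)
  then show thesis using assms that unfolding is_pullback_def by metis
qed

lemma pullback_unique:
  assumes "is_pullback C f g p q" "\<guillemotleft>p : P \<rightarrow> A\<guillemotright>"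
    and "\<guillemotleft>x : Z \<rightarrow> P\<guillemotright>" "\<guillemotleft>y : Z \<rightarrow> P\<guillemotright>" "p \<cdot> x = p \<cdot> y" "q \<cdot> x = q \<cdot> y"
  shows "x = y"
proof -
  have t: "Dom C p = P" "\<guillemotleft>p : P \<rightarrow> Dom C f\<guillemotright>" "\<guillemotleft>q : P \<rightarrow> Dom C g\<guillemotright>" "f \<in> Ar C" "g \<in> Ar C"
    "Cod C f = Cod C g" "f \<cdot> p = g \<cdot> q"
    using pullbackD[OF assms(1)] assms(2) by (auto simp: hom_def)
  have "f \<cdot> (p \<cdot> y) = g \<cdot> (q \<cdot> y)"
    using t(2-6) assms(4) by (simp add: hom_def reassoc[OF t(7)])
  then have "\<exists>!h. h \<in> hom C Z (Dom C p) \<and> p \<cdot> h = p \<cdot> y \<and> q \<cdot> h = q \<cdot> y"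
    using assms(1,4) t unfolding is_pullback_def by blast
  then show ?thesis using assms t(1) by blast
qed

lemma pullbackI:
  assumes "\<guillemotleft>f : A \<rightarrow> D\<guillemotright>" "\<guillemotleft>g : B \<rightarrow> D\<guillemotright>" "\<guillemotleft>p : P \<rightarrow> A\<guillemotright>" "\<guillemotleft>q : P \<rightarrow> B\<guillemotright>" "f \<cdot> p = g \<cdot> q"
    and "\<And>Z x y. \<guillemotleft>x : Z \<rightarrow> A\<guillemotright> \<Longrightarrow> \<guillemotleft>y : Z \<rightarrow> B\<guillemotright> \<Longrightarrow> f \<cdot> x = g \<cdot> y \<Longrightarrow>
      \<exists>h. \<guillemotleft>h : Z \<rightarrow> P\<guillemotright> \<and> p \<cdot> h = x \<and> q \<cdot> h = y"
    and "\<And>Z x y. \<guillemotleft>x : Z \<rightarrow> P\<guillemotright> \<Longrightarrow> \<guillemotleft>y : Z \<rightarrow> P\<guillemotright> \<Longrightarrow> p \<cdot> x = p \<cdot> y \<Longrightarrow> q \<cdot> x = q \<cdot> y \<Longrightarrow> x = y"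
  shows "is_pullback C f g p q"
proof -
  have d: "f \<in> Ar C" "g \<in> Ar C" "Dom C f = A" "Dom C g = B" "Dom C p = P" "Dom C q = P" "Cod C f = D" "Cod C g = D"
    using assms(1-4) by (auto simp: hom_def)
  have "\<exists>!h. \<guillemotleft>h : Z \<rightarrow> P\<guillemotright> \<and> p \<cdot> h = x \<and> q \<cdot> h = y"
    if "\<guillemotleft>x : Z \<rightarrow> A\<guillemotright>" "\<guillemotleft>y : Z \<rightarrow> B\<guillemotright>" "f \<cdot> x = g \<cdot> y" for Z x y
    using assms(6)[OF that] assms(7) by metis
  then show ?thesis unfolding is_pullback_def d using assms(1-5) d by simp
qed

lemma pullback_swap:
  assumes "is_pullback C f g p q" shows "is_pullback C g f q p"
proof -
  have f: "\<guillemotleft>f : Dom C f \<rightarrow> Cod C f\<guillemotright>" using pullbackD[OF assms] by (simp add: hom_def)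
  obtain B P where t: "\<guillemotleft>g : B \<rightarrow> Cod C f\<guillemotright>" "\<guillemotleft>p : P \<rightarrow> Dom C f\<guillemotright>" "\<guillemotleft>q : P \<rightarrow> B\<guillemotright>" "f \<cdot> p = g \<cdot> q"
    using pullbackE[OF assms f] by blast
  show ?thesis
  proof (rule pullbackI[OF t(1) f t(3) t(2) t(4)[symmetric]])
    fix Z x y assume xy: "\<guillemotleft>x : Z \<rightarrow> B\<guillemotright>" "\<guillemotleft>y : Z \<rightarrow> Dom C f\<guillemotright>" "g \<cdot> x = f \<cdot> y"
    show "\<exists>h. \<guillemotleft>h : Z \<rightarrow> P\<guillemotright> \<and> q \<cdot> h = x \<and> p \<cdot> h = y"
      by (rule pullback_lift[OF assms t(2,3) xy(2,1) xy(3)[symmetric]]) blast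
  qed (rule pullback_unique[OF assms t(2)])
qed

lemma pullback_monic:
  assumes pb: "is_pullback C f g p q" and "monic C g"
  shows "monic C p"
proof -
  have f: "\<guillemotleft>f : Dom C f \<rightarrow> Cod C f\<guillemotright>" using pullbackD[OF pb] by (simp add: hom_def)
  obtain B P where t: "\<guillemotleft>g : B \<rightarrow> Cod C f\<guillemotright>" "\<guillemotleft>p : P \<rightarrow> Dom C f\<guillemotright>" "\<guillemotleft>q : P \<rightarrow> B\<guillemotright>" "f \<cdot> p = g \<cdot> q"
    using pullbackE[OF pb f] by blast
  show ?thesis
  proof (rule monicI[OF t(2)])
    fix Z x y assume xy: "\<guillemotleft>x : Z \<rightarrow> P\<guillemotright>" "\<guillemotleft>y : Z \<rightarrow> P\<guillemotright>" "p \<cdot> x = p \<cdot> y"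
    have "g \<cdot> (q \<cdot> x) = f \<cdot> (p \<cdot> x)" "g \<cdot> (q \<cdot> y) = f \<cdot> (p \<cdot> y)"
      using t(1-3) f xy(1,2) by (simp_all add: hom_def reassoc[OF t(4)])
    then have "q \<cdot> x = q \<cdot> y"
      using monic_cancel[OF assms(2) t(1) comp_in_hom[OF xy(1) t(3)] comp_in_hom[OF xy(2) t(3)]] xy(3)
      by simp
    then show "x = y" using pullback_unique[OF pb t(2)] xy by blast
  qed
qed

section \<open>Regular epimorphisms\<close>

lemma regular_epi_cancel:
  assumes "regular_epi C q" "\<guillemotleft>q : A \<rightarrow> B\<guillemotright>" "\<guillemotleft>x : B \<rightarrow> Z\<guillemotright>" "\<guillemotleft>y : B \<rightarrow> Z\<guillemotright>" "x \<cdot> q = y \<cdot> q"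
  shows "x = y"
proof -
  obtain f g where fg: "is_coequalizer C f g q" using assms(1) unfolding regular_epi_def by auto
  have t: "f \<in> Ar C" "Cod C f = A" "g \<in> Ar C" "Cod C g = A" "Dom C g = Dom C f" "Cod C q = B" and e: "q \<cdot> f = q \<cdot> g"
    using fg assms(2) unfolding is_coequalizer_def hom_def by auto
  have "(x \<cdot> q) \<cdot> f = (x \<cdot> q) \<cdot> g" using t e assms(2,3) by (simp add: hom_def)
  then have "\<exists>!h. h \<in> hom C (Cod C q) Z \<and> h \<cdot> q = x \<cdot> q"
    using fg t assms(2,3) unfolding is_coequalizer_def by blast
  then show ?thesis using assms t by auto
qed

lemma coequalizer_lift:
  assumes "is_coequalizer C f g q" "\<guillemotleft>f : E \<rightarrow> A\<guillemotright>" "\<guillemotleft>q : A \<rightarrow> B\<guillemotright>" "\<guillemotleft>x : A \<rightarrow> Z\<guillemotright>" "x \<cdot> f = x \<cdot> g"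
  obtains h where "\<guillemotleft>h : B \<rightarrow> Z\<guillemotright>" "h \<cdot> q = x"
proof -
  have "Cod C f = A" "Cod C q = B" using assms(2,3) by (auto simp: hom_def)
  then show thesis using assms that unfolding is_coequalizer_def by metis
qed

text \<open>The pair to be coequalized is \<open>idt A\<close> and the idempotent
  \<open>s \<cdot> p\<close>.\<close>

lemma split_epi_regular:
  assumes "\<guillemotleft>p : A \<rightarrow> B\<guillemotright>" "\<guillemotleft>s : B \<rightarrow> A\<guillemotright>" "p \<cdot> s = idt B"
  shows "regular_epi C p"
proof -
  have A: "A \<in> Ob C" using assms(1) in_hom_ob by blast
  have "\<exists>!h. h \<in> hom C B Z \<and> h \<cdot> p = x" if x: "\<guillemotleft>x : A \<rightarrow> Z\<guillemotright>" and e: "x \<cdot> idt A = x \<cdot> (s \<cdot> p)" for Z x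
  proof
    show "x \<cdot> s \<in> hom C B Z \<and> (x \<cdot> s) \<cdot> p = x" using assms x e by (simp add: hom_def)
    fix h assume h: "h \<in> hom C B Z \<and> h \<cdot> p = x"
    then have "x \<cdot> s = h \<cdot> (p \<cdot> s)" using assms(1,2) by (auto simp: hom_def)
    then show "h = x \<cdot> s" using h assms by (auto simp: hom_def)
  qed
  moreover have "p \<cdot> idt A = p \<cdot> (s \<cdot> p)"
    using assms(1,2) by (simp add: hom_def reassoc[OF assms(3)])
  ultimately have "is_coequalizer C (idt A) (s \<cdot> p) p"
    unfolding is_coequalizer_def using assms(1,2) A by (auto simp: hom_def)
  then show ?thesis unfolding regular_epi_def by blast
qed

lemma iso_regular_epi: "iso C f \<Longrightarrow> \<guillemotleft>f : A \<rightarrow> B\<guillemotright> \<Longrightarrow> regular_epi C f"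
  using split_epi_regular isoE by metis

lemma regular_epi_arr: "regular_epi C f \<Longrightarrow> f \<in> Ar C"
  unfolding regular_epi_def is_coequalizer_def hom_def by auto

text \<open>Regular epimorphisms are strong: since \<open>m\<close> is monic, \<open>x\<close>
  merges the pair that \<open>e\<close> coequalizes, and the arrow induced on \<open>B\<close> is
  the diagonal.\<close>

lemma regular_epi_diagonal:
  assumes e: "regular_epi C e" "\<guillemotleft>e : A \<rightarrow> B\<guillemotright>" and m: "monic C m" "\<guillemotleft>m : M \<rightarrow> D\<guillemotright>"
    and x: "\<guillemotleft>x : A \<rightarrow> M\<guillemotright>" and y: "\<guillemotleft>y : B \<rightarrow> D\<guillemotright>" and sq: "m \<cdot> x = y \<cdot> e"
  obtains d where "\<guillemotleft>d : B \<rightarrow> M\<guillemotright>" "d \<cdot> e = x" "m \<cdot> d = y"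
proof -
  obtain f g where fg: "is_coequalizer C f g e" using e(1) unfolding regular_epi_def by auto
  have t: "\<guillemotleft>f : Dom C f \<rightarrow> A\<guillemotright>" "\<guillemotleft>g : Dom C f \<rightarrow> A\<guillemotright>" "Cod C e = B" and eq: "e \<cdot> f = e \<cdot> g"
    using fg e(2) unfolding is_coequalizer_def hom_def by auto
  have "m \<cdot> (x \<cdot> f) = m \<cdot> (x \<cdot> g)"
    using t m(2) x y e(2) eq by (simp add: hom_def reassoc[OF sq])
  then have "x \<cdot> f = x \<cdot> g" using monic_cancel[OF m] t x by blast
  then obtain d where d: "\<guillemotleft>d : B \<rightarrow> M\<guillemotright>" "d \<cdot> e = x"
    using coequalizer_lift[OF fg t(1) e(2) x] by blast
  have "(m \<cdot> d) \<cdot> e = y \<cdot> e" using m(2) d(1) e(2) sq d(2) by (simp add: hom_def)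
  then have "m \<cdot> d = y" using regular_epi_cancel[OF e _ y] d m(2) by blast
  then show thesis using that d by blast
qed

lemma regular_epi_monic_iso:
  assumes "regular_epi C f" "monic C f" "\<guillemotleft>f : A \<rightarrow> B\<guillemotright>"
  shows "iso C f"
proof -
  have "f \<cdot> idt A = idt B \<cdot> f" using assms(3) by (simp add: hom_def)
  then obtain d where "\<guillemotleft>d : B \<rightarrow> A\<guillemotright>" "f \<cdot> d = idt B"
    using regular_epi_diagonal[OF assms(1,3,2,3)] assms(3) in_hom_ob ident_in_hom by metis
  then show ?thesis using monic_split_epi_iso[OF assms(2,3)] by blast
qed

text \<open>Regular epimorphisms are extremal: the diagonal of the square against
  \<open>idt B\<close> is a section of \<open>m\<close>.\<close>

lemma regular_epi_factor_iso:
  assumes "regular_epi C f" "\<guillemotleft>f : A \<rightarrow> B\<guillemotright>" "monic C m" "\<guillemotleft>m : M \<rightarrow> B\<guillemotright>" "\<guillemotleft>x : A \<rightarrow> M\<guillemotright>" "m \<cdot> x = f"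
  shows "iso C m"
proof -
  have B: "\<guillemotleft>idt B : B \<rightarrow> B\<guillemotright>" "m \<cdot> x = idt B \<cdot> f"
    using assms(2,6) by (auto simp: hom_def)
  show ?thesis
    by (rule regular_epi_diagonal[OF assms(1-5) B]) (rule monic_split_epi_iso[OF assms(3,4)])
qed

lemma pullback_iso:
  assumes pb: "is_pullback C f g p q" "\<guillemotleft>p : P \<rightarrow> A\<guillemotright>" "\<guillemotleft>q : P \<rightarrow> B\<guillemotright>" and c: "iso C c" "\<guillemotleft>c : R \<rightarrow> P\<guillemotright>"
  shows "is_pullback C f g (p \<cdot> c) (q \<cdot> c)"
proof -
  have fg: "\<guillemotleft>f : A \<rightarrow> Cod C f\<guillemotright>" "\<guillemotleft>g : B \<rightarrow> Cod C f\<guillemotright>" and eq: "f \<cdot> p = g \<cdot> q"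
    using pullbackD[OF pb(1)] pb(2,3) by (simp_all add: hom_def)
  obtain i where i: "\<guillemotleft>i : P \<rightarrow> R\<guillemotright>" "i \<cdot> c = idt R" "c \<cdot> i = idt P" using isoE[OF c] .
  show ?thesis
  proof (rule pullbackI[OF fg comp_in_hom[OF c(2) pb(2)] comp_in_hom[OF c(2) pb(3)]])
    show "f \<cdot> (p \<cdot> c) = g \<cdot> (q \<cdot> c)" using fg pb(2,3) c(2) by (simp add: hom_def reassoc[OF eq])
    fix Z x y assume xy: "\<guillemotleft>x : Z \<rightarrow> A\<guillemotright>" "\<guillemotleft>y : Z \<rightarrow> B\<guillemotright>" "f \<cdot> x = g \<cdot> y"
    obtain h where h: "\<guillemotleft>h : Z \<rightarrow> P\<guillemotright>" "p \<cdot> h = x" "q \<cdot> h = y" using pullback_lift[OF pb xy] .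
    have "\<guillemotleft>i \<cdot> h : Z \<rightarrow> R\<guillemotright>" "(p \<cdot> c) \<cdot> (i \<cdot> h) = x" "(q \<cdot> c) \<cdot> (i \<cdot> h) = y"
      using i(1) h pb(2,3) c(2) by (simp_all add: hom_def reassoc[OF i(3)])
    then show "\<exists>h. \<guillemotleft>h : Z \<rightarrow> R\<guillemotright> \<and> (p \<cdot> c) \<cdot> h = x \<and> (q \<cdot> c) \<cdot> h = y" by blast
  next
    fix Z x y assume xy: "\<guillemotleft>x : Z \<rightarrow> R\<guillemotright>" "\<guillemotleft>y : Z \<rightarrow> R\<guillemotright>" "(p \<cdot> c) \<cdot> x = (p \<cdot> c) \<cdot> y" "(q \<cdot> c) \<cdot> x = (q \<cdot> c) \<cdot> y"
    have "p \<cdot> (c \<cdot> x) = p \<cdot> (c \<cdot> y)" "q \<cdot> (c \<cdot> x) = q \<cdot> (c \<cdot> y)" using xy pb(2,3) c(2) by (simp_all add: hom_def)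
    then have "c \<cdot> x = c \<cdot> y"
      using pullback_unique[OF pb(1,2) comp_in_hom[OF xy(1) c(2)] comp_in_hom[OF xy(2) c(2)]] by simp
    then show "x = y" using monic_cancel[OF split_mono[OF c(2) i(1,2)] c(2) xy(1,2)] by simp
  qed
qed

text \<open>A regular epimorphism is the coequalizer of some unnamed pair; that pair factors through
  the kernel pair, so merging the kernel pair is enough.\<close>

lemma regular_epi_kernel_pair_lift:
  assumes f: "regular_epi C f" "\<guillemotleft>f : A \<rightarrow> B\<guillemotright>" and r: "kernel_pair C f r0 r1" "\<guillemotleft>r0 : R \<rightarrow> A\<guillemotright>" "\<guillemotleft>r1 : R \<rightarrow> A\<guillemotright>"
    and x: "\<guillemotleft>x : A \<rightarrow> D\<guillemotright>" "x \<cdot> r0 = x \<cdot> r1"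
  obtains y where "\<guillemotleft>y : B \<rightarrow> D\<guillemotright>" "y \<cdot> f = x"
proof -
  obtain u v where uv: "is_coequalizer C u v f" using f(1) unfolding regular_epi_def by blast
  have t: "\<guillemotleft>u : Dom C u \<rightarrow> A\<guillemotright>" "\<guillemotleft>v : Dom C u \<rightarrow> A\<guillemotright>" "f \<cdot> u = f \<cdot> v"
    using uv f(2) unfolding is_coequalizer_def by (auto simp: hom_def)
  obtain w where w: "\<guillemotleft>w : Dom C u \<rightarrow> R\<guillemotright>" "r0 \<cdot> w = u" "r1 \<cdot> w = v"
    using pullback_lift[OF r t] .
  have "x \<cdot> (r0 \<cdot> w) = x \<cdot> (r1 \<cdot> w)" using x(1) r(2,3) w(1) by (simp add: hom_def reassoc[OF x(2)])
  then have "x \<cdot> u = x \<cdot> v" using w by simp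
  then show thesis using coequalizer_lift[OF uv t(1) f(2) x(1)] that by blast
qed

end


locale regular_cat = cat C for C :: "('o, 'a) cat" (structure) +
  assumes regular: "regular_category C"
begin

section \<open>Covers and images in a regular category\<close>

lemma pullback_ex:
  assumes "\<guillemotleft>f : A \<rightarrow> D\<guillemotright>" "\<guillemotleft>g : B \<rightarrow> D\<guillemotright>"
  obtains P p q where "is_pullback C f g p q" "\<guillemotleft>p : P \<rightarrow> A\<guillemotright>" "\<guillemotleft>q : P \<rightarrow> B\<guillemotright>" "f \<cdot> p = g \<cdot> q"
proof -
  have "f \<in> Ar C" "g \<in> Ar C" "Cod C f = Cod C g" using assms by (simp_all add: hom_def)
  moreover have "finitely_complete C" using regular by (simp add: regular_category_def)
  ultimately obtain p q where pq: "is_pullback C f g p q"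
    unfolding finitely_complete_def by blast
  have "\<guillemotleft>p : Dom C p \<rightarrow> A\<guillemotright>" "\<guillemotleft>q : Dom C p \<rightarrow> B\<guillemotright>" "f \<cdot> p = g \<cdot> q"
    using pullbackD[OF pq] assms by (auto simp: hom_def)
  then show thesis using that pq by blast
qed

lemma pullback_regular_epi:
  assumes "is_pullback C f g p q"
  shows "regular_epi C g \<Longrightarrow> regular_epi C p" "regular_epi C f \<Longrightarrow> regular_epi C q"
  using assms pullback_swap[OF assms] regular unfolding regular_category_def by blast+

text \<open>The pullback \<open>z\<close> of \<open>e\<close> is thought of as a cover of \<open>Z\<close>: the generalized element \<open>x\<close> of \<open>B\<close> lifts
  along \<open>e\<close> locally.\<close>

lemma cover:
  assumes "regular_epi C e" "\<guillemotleft>e : A \<rightarrow> B\<guillemotright>" "\<guillemotleft>x : Z \<rightarrow> B\<guillemotright>"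
  obtains W z y where "regular_epi C z" "\<guillemotleft>z : W \<rightarrow> Z\<guillemotright>" "\<guillemotleft>y : W \<rightarrow> A\<guillemotright>" "e \<cdot> y = x \<cdot> z"
proof -
  obtain P p q where pb: "is_pullback C e x p q" "\<guillemotleft>p : P \<rightarrow> A\<guillemotright>" "\<guillemotleft>q : P \<rightarrow> Z\<guillemotright>" "e \<cdot> p = x \<cdot> q"
    using pullback_ex[OF assms(2,3)] by blast
  then show thesis using that pullback_regular_epi[OF pb(1)] assms(1) by blast
qed

text \<open>\<open>e\<close> is the coequalizer of the kernel pair of \<open>f\<close>. That
  \<open>m\<close> is monic is checked locally: two elements of \<open>M\<close> are lifted to
  \<open>A\<close> on successive covers, and if their lifts agree under \<open>f\<close> they form
  an element of the kernel pair, which \<open>e\<close> merges.\<close>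

lemma image:
  assumes f: "\<guillemotleft>f : A \<rightarrow> B\<guillemotright>"
  obtains M e m where "regular_epi C e" "\<guillemotleft>e : A \<rightarrow> M\<guillemotright>" "monic C m" "\<guillemotleft>m : M \<rightarrow> B\<guillemotright>" "m \<cdot> e = f"
proof -
  obtain E f0 f1 where kp: "is_pullback C f f f0 f1" and t: "\<guillemotleft>f0 : E \<rightarrow> A\<guillemotright>" "\<guillemotleft>f1 : E \<rightarrow> A\<guillemotright>"
    and feq: "f \<cdot> f0 = f \<cdot> f1"
    using pullback_ex[OF f f] by blast
  obtain e where ce: "is_coequalizer C f0 f1 e"
    using regular kp unfolding regular_category_def by blast
  define M where "M = Cod C e"
  have e: "\<guillemotleft>e : A \<rightarrow> M\<guillemotright>" "e \<cdot> f0 = e \<cdot> f1" "regular_epi C e"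
    using ce t unfolding is_coequalizer_def regular_epi_def M_def hom_def by auto
  obtain m where m: "\<guillemotleft>m : M \<rightarrow> B\<guillemotright>" "m \<cdot> e = f"
    using coequalizer_lift[OF ce t(1) e(1) f feq] by blast
  have "monic C m"
  proof (rule monicI[OF m(1)])
    fix Z x y assume x: "\<guillemotleft>x : Z \<rightarrow> M\<guillemotright>" and y: "\<guillemotleft>y : Z \<rightarrow> M\<guillemotright>" and xy: "m \<cdot> x = m \<cdot> y"
    obtain V v x' where v: "regular_epi C v" "\<guillemotleft>v : V \<rightarrow> Z\<guillemotright>" "\<guillemotleft>x' : V \<rightarrow> A\<guillemotright>" "e \<cdot> x' = x \<cdot> v"
      using cover[OF e(3,1) x] by blast
    have yv: "\<guillemotleft>y \<cdot> v : V \<rightarrow> M\<guillemotright>" using y v by blast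
    obtain W w y' where w: "regular_epi C w" "\<guillemotleft>w : W \<rightarrow> V\<guillemotright>" "\<guillemotleft>y' : W \<rightarrow> A\<guillemotright>" "e \<cdot> y' = (y \<cdot> v) \<cdot> w"
      using cover[OF e(3,1) yv] by blast
    have "f \<cdot> (x' \<cdot> w) = f \<cdot> y'"
      using v(2,3) w(2,3) x y m(1) e(1) f
      by (simp add: hom_def m(2)[symmetric] w(4) v(4) reassoc[OF v(4)] reassoc[OF xy])
    then obtain h where h: "\<guillemotleft>h : W \<rightarrow> E\<guillemotright>" "f0 \<cdot> h = x' \<cdot> w" "f1 \<cdot> h = y'"
      using pullback_lift[OF kp t, of "x' \<cdot> w" W y'] v w by blast
    have "(x \<cdot> v) \<cdot> w = e \<cdot> (f0 \<cdot> h)"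
      using v(2,3) w(2,3) x e(1) h by (simp add: hom_def reassoc[OF v(4)])
    also have "\<dots> = e \<cdot> (f1 \<cdot> h)" using e(1) t h(1) by (simp add: hom_def reassoc[OF e(2)])
    also have "\<dots> = (y \<cdot> v) \<cdot> w" using h(3) w(4) by simp
    finally have "x \<cdot> v = y \<cdot> v" using regular_epi_cancel[OF w(1,2), of "x \<cdot> v" M "y \<cdot> v"] x y v(2) by blast
    then show "x = y" using regular_epi_cancel[OF v(1,2) x y] by blast
  qed
  then show thesis using that e m by blast
qed

text \<open>The monic part of the image factorization is invertible by \<open>strong\<close>, so
  \<open>f\<close> inherits the universal property of \<open>e\<close>. Extremality is easier to
  verify for composites than being a coequalizer.\<close>

lemma strong_epi_regular:
  assumes f: "\<guillemotleft>f : A \<rightarrow> B\<guillemotright>"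
    and strong: "\<And>M m x. monic C m \<Longrightarrow> \<guillemotleft>m : M \<rightarrow> B\<guillemotright> \<Longrightarrow> \<guillemotleft>x : A \<rightarrow> M\<guillemotright> \<Longrightarrow> m \<cdot> x = f \<Longrightarrow> iso C m"
  shows "regular_epi C f"
proof -
  obtain M e m where im: "regular_epi C e" "\<guillemotleft>e : A \<rightarrow> M\<guillemotright>" "monic C m" "\<guillemotleft>m : M \<rightarrow> B\<guillemotright>" "m \<cdot> e = f"
    using image[OF f] by blast
  obtain n where n: "\<guillemotleft>n : B \<rightarrow> M\<guillemotright>" "n \<cdot> m = idt M" "m \<cdot> n = idt B"
    using isoE[OF strong[OF im(3,4,2,5)] im(4)] by blast
  obtain u v where uv: "is_coequalizer C u v e" using im(1) unfolding regular_epi_def by auto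
  have t: "u \<in> Ar C" "v \<in> Ar C" "Cod C u = A" "Cod C v = A" "Dom C v = Dom C u" "e \<cdot> u = e \<cdot> v" "Cod C e = M"
    using uv im(2) unfolding is_coequalizer_def hom_def by auto
  have "is_coequalizer C u v f"
    unfolding is_coequalizer_def
  proof (intro conjI allI ballI impI)
    show "f \<cdot> u = f \<cdot> v" using t im(2,4) by (simp add: hom_def im(5)[symmetric])
    fix Z x assume x: "x \<in> hom C (Cod C u) Z" and xuv: "x \<cdot> u = x \<cdot> v"
    then obtain h where h: "\<guillemotleft>h : M \<rightarrow> Z\<guillemotright>" "h \<cdot> e = x"
      using uv t unfolding is_coequalizer_def by metis
    show "\<exists>!h. h \<in> hom C (Cod C f) Z \<and> h \<cdot> f = x"
    proof
      show "h \<cdot> n \<in> hom C (Cod C f) Z \<and> (h \<cdot> n) \<cdot> f = x"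
        using h(1) n(1) f im(2,4) by (simp add: hom_def im(5)[symmetric] reassoc[OF n(2)] h(2))
      fix h' assume h': "h' \<in> hom C (Cod C f) Z \<and> h' \<cdot> f = x"
      have B: "Cod C f = B" using f by (simp add: hom_def)
      have "(h' \<cdot> m) \<cdot> e = h \<cdot> e" using h' h im(2,4,5) B by (auto simp: hom_def)
      moreover have "\<guillemotleft>h' \<cdot> m : M \<rightarrow> Z\<guillemotright>" using h' im(4) B by auto
      ultimately have "h' \<cdot> m = h" using regular_epi_cancel[OF im(1,2)] h(1) by blast
      then have "h \<cdot> n = h' \<cdot> (m \<cdot> n)" using h' im(4) n(1) B by (auto simp: hom_def)
      then show "h' = h \<cdot> n" using h' n B f by (auto simp: hom_def)
    qed
  qed (use t f in \<open>auto simp: hom_def\<close>)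
  then show ?thesis unfolding regular_epi_def by blast
qed

text \<open>A monomorphism through which \<open>g\<close> factors is also one through which
  \<open>g \<cdot> f\<close> factors, and so is invertible.\<close>

lemma regular_epi_comp_cancel:
  assumes "regular_epi C (g \<cdot> f)" "\<guillemotleft>f : A \<rightarrow> B\<guillemotright>" "\<guillemotleft>g : B \<rightarrow> D\<guillemotright>"
  shows "regular_epi C g"
proof (rule strong_epi_regular[OF assms(3)])
  fix M m x assume m: "monic C m" "\<guillemotleft>m : M \<rightarrow> D\<guillemotright>" "\<guillemotleft>x : B \<rightarrow> M\<guillemotright>" "m \<cdot> x = g"
  have "m \<cdot> (x \<cdot> f) = g \<cdot> f" using assms(2,3) m(2,3) by (simp add: hom_def reassoc[OF m(4)])
  moreover have "\<guillemotleft>x \<cdot> f : A \<rightarrow> M\<guillemotright>" "\<guillemotleft>g \<cdot> f : A \<rightarrow> D\<guillemotright>"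
    using comp_in_hom[OF assms(2) m(3)] comp_in_hom[OF assms(2,3)] .
  ultimately show "iso C m" using regular_epi_factor_iso[OF assms(1) _ m(1,2)] by blast
qed

lemma regular_epi_comp:
  assumes "regular_epi C f" "regular_epi C g" "\<guillemotleft>f : A \<rightarrow> B\<guillemotright>" "\<guillemotleft>g : B \<rightarrow> D\<guillemotright>"
  shows "regular_epi C (g \<cdot> f)"
proof (rule strong_epi_regular)
  show "\<guillemotleft>g \<cdot> f : A \<rightarrow> D\<guillemotright>" using assms by blast
  fix M m x assume m: "monic C m" "\<guillemotleft>m : M \<rightarrow> D\<guillemotright>" "\<guillemotleft>x : A \<rightarrow> M\<guillemotright>" "m \<cdot> x = g \<cdot> f"
  obtain d where "\<guillemotleft>d : B \<rightarrow> M\<guillemotright>" "m \<cdot> d = g"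
    using regular_epi_diagonal[OF assms(1,3) m(1-3) assms(4) m(4)] by blast
  then show "iso C m" using regular_epi_factor_iso[OF assms(2,4) m(1,2)] by blast
qed

end


section \<open>Kernels and protomodularity\<close>

locale semi_abelian_cat = regular_cat C for C :: "('o, 'a) cat" (structure) +
  assumes semi_abelian: "semi_abelian C"
begin

section \<open>Zero maps and zero objects\<close>

text \<open>\<open>zero_arr\<close> is a predicate that allows any zero object as intermediate
  object. Naming the one zero map between two objects turns vanishing into an equation that can be
  used for rewriting.\<close>

definition zmap :: "'o \<Rightarrow> 'o \<Rightarrow> 'a" where
  "zmap A B = (THE f. \<guillemotleft>f : A \<rightarrow> B\<guillemotright> \<and> zero_arr C f)"

lemma zero_obj_ex: obtains Z where "zero_obj C Z" "Z \<in> Ob C"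
  using semi_abelian unfolding semi_abelian_def pointed_def zero_obj_def initial_obj_def by blast

lemma zero_obj_ob: "zero_obj C Z \<Longrightarrow> Z \<in> Ob C"
  unfolding zero_obj_def initial_obj_def by simp

lemma zero_obj_arr:
  assumes "zero_obj C Z" "A \<in> Ob C"
  obtains s t where "\<guillemotleft>t : A \<rightarrow> Z\<guillemotright>" "\<guillemotleft>s : Z \<rightarrow> A\<guillemotright>"
  using assms unfolding zero_obj_def initial_obj_def terminal_obj_def by metis

lemma zero_obj_unique:
  assumes "zero_obj C Z"
  shows "\<guillemotleft>f : A \<rightarrow> Z\<guillemotright> \<Longrightarrow> \<guillemotleft>g : A \<rightarrow> Z\<guillemotright> \<Longrightarrow> f = g" "\<guillemotleft>f : Z \<rightarrow> A\<guillemotright> \<Longrightarrow> \<guillemotleft>g : Z \<rightarrow> A\<guillemotright> \<Longrightarrow> f = g"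
proof -
  have *: "\<exists>!f. \<guillemotleft>f : A \<rightarrow> Z\<guillemotright>" "\<exists>!f. \<guillemotleft>f : Z \<rightarrow> A\<guillemotright>" if "A \<in> Ob C"
    using assms that unfolding zero_obj_def initial_obj_def terminal_obj_def by simp_all
  show "f = g" if "\<guillemotleft>f : A \<rightarrow> Z\<guillemotright>" "\<guillemotleft>g : A \<rightarrow> Z\<guillemotright>" using *(1)[OF in_hom_ob(1)[OF that(1)]] that by blast
  show "f = g" if "\<guillemotleft>f : Z \<rightarrow> A\<guillemotright>" "\<guillemotleft>g : Z \<rightarrow> A\<guillemotright>" using *(2)[OF in_hom_ob(2)[OF that(1)]] that by blast
qed

lemma zero_arrI:
  assumes "zero_obj C Z" "\<guillemotleft>t : A \<rightarrow> Z\<guillemotright>" "\<guillemotleft>s : Z \<rightarrow> B\<guillemotright>"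
  shows "zero_arr C (s \<cdot> t)"
proof -
  have "s \<cdot> t \<in> Ar C" "\<guillemotleft>t : Dom C (s \<cdot> t) \<rightarrow> Z\<guillemotright>" "\<guillemotleft>s : Z \<rightarrow> Cod C (s \<cdot> t)\<guillemotright>"
    using assms(2,3) by (simp_all add: hom_def)
  then show ?thesis using assms(1) unfolding zero_arr_def by blast
qed

lemma zero_arrE:
  assumes "zero_arr C f" "\<guillemotleft>f : A \<rightarrow> B\<guillemotright>"
  obtains Z t s where "zero_obj C Z" "\<guillemotleft>t : A \<rightarrow> Z\<guillemotright>" "\<guillemotleft>s : Z \<rightarrow> B\<guillemotright>" "f = s \<cdot> t"
  using assms unfolding zero_arr_def hom_def by auto

lemma zero_arr_ex1:
  assumes "A \<in> Ob C" "B \<in> Ob C"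
  shows "\<exists>!f. \<guillemotleft>f : A \<rightarrow> B\<guillemotright> \<and> zero_arr C f"
proof -
  obtain Z where Z: "zero_obj C Z" using zero_obj_ex by blast
  obtain t where t: "\<guillemotleft>t : A \<rightarrow> Z\<guillemotright>" using zero_obj_arr[OF Z assms(1)] by blast
  obtain s where s: "\<guillemotleft>s : Z \<rightarrow> B\<guillemotright>" using zero_obj_arr[OF Z assms(2)] by blast
  have "f = s \<cdot> t" if f: "\<guillemotleft>f : A \<rightarrow> B\<guillemotright>" "zero_arr C f" for f
  proof -
    obtain W t' s' where W: "zero_obj C W" "\<guillemotleft>t' : A \<rightarrow> W\<guillemotright>" "\<guillemotleft>s' : W \<rightarrow> B\<guillemotright>" "f = s' \<cdot> t'"
      using zero_arrE[OF f(2,1)] .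
    \<comment> \<open>An arrow through another zero object \<open>W\<close> also factors through the
      fixed \<open>Z\<close>, by way of \<open>W -> Z\<close>.\<close>
    obtain i where i: "\<guillemotleft>i : W \<rightarrow> Z\<guillemotright>" using zero_obj_arr[OF Z] W(2) in_hom_ob(2) by metis
    have "s' = s \<cdot> i" using zero_obj_unique(2)[OF W(1,3)] comp_in_hom[OF i s] by blast
    moreover have "i \<cdot> t' = t" using zero_obj_unique(1)[OF Z comp_in_hom[OF W(2) i] t] .
    ultimately show ?thesis using W(2,4) i s by (simp add: hom_def)
  qed
  then show ?thesis using zero_arrI[OF Z t s] comp_in_hom[OF t s] by blast
qed

lemma zmap_in_hom: "A \<in> Ob C \<Longrightarrow> B \<in> Ob C \<Longrightarrow> \<guillemotleft>zmap A B : A \<rightarrow> B\<guillemotright>"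
  and zmap_zero_arr: "A \<in> Ob C \<Longrightarrow> B \<in> Ob C \<Longrightarrow> zero_arr C (zmap A B)"
  using theI'[OF zero_arr_ex1] unfolding zmap_def by blast+

lemma zmap_arr [simp]:
  assumes "A \<in> Ob C" "B \<in> Ob C"
  shows "zmap A B \<in> Ar C" "Dom C (zmap A B) = A" "Cod C (zmap A B) = B"
  using zmap_in_hom[OF assms] by (simp_all add: hom_def)

lemma zero_arr_iff:
  assumes "\<guillemotleft>f : A \<rightarrow> B\<guillemotright>"
  shows "zero_arr C f \<longleftrightarrow> f = zmap A B"
  using zero_arr_ex1[OF in_hom_ob[OF assms]] zmap_in_hom[OF in_hom_ob[OF assms]]
    zmap_zero_arr[OF in_hom_ob[OF assms]] assms by blast

lemma zmap_comp [simp]: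
  assumes "f \<in> Ar C"
  shows "Dom C f = B \<Longrightarrow> A \<in> Ob C \<Longrightarrow> f \<cdot> zmap A B = zmap A (Cod C f)"
    and "Cod C f = B \<Longrightarrow> D \<in> Ob C \<Longrightarrow> zmap B D \<cdot> f = zmap (Dom C f) D"
proof -
  have f: "\<guillemotleft>f : Dom C f \<rightarrow> Cod C f\<guillemotright>" using assms by (simp add: hom_def)
  obtain Z where Z: "zero_obj C Z" using zero_obj_ex by blast
  show "f \<cdot> zmap A B = zmap A (Cod C f)" if B: "Dom C f = B" and A: "A \<in> Ob C"
  proof -
    have zmap: "\<guillemotleft>zmap A B : A \<rightarrow> B\<guillemotright>" "zero_arr C (zmap A B)"
      using zmap_in_hom zmap_zero_arr A in_hom_ob[OF f] B by auto
    obtain W t s where W: "zero_obj C W" "\<guillemotleft>t : A \<rightarrow> W\<guillemotright>" "\<guillemotleft>s : W \<rightarrow> B\<guillemotright>" "zmap A B = s \<cdot> t"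
      using zero_arrE[OF zmap(2,1)] .
    have "f \<cdot> zmap A B = (f \<cdot> s) \<cdot> t" using W f B by (simp add: hom_def)
    then have "zero_arr C (f \<cdot> zmap A B)" using zero_arrI[OF W(1,2)] W(3) f B by auto
    then show ?thesis using zero_arr_iff f B zmap(1) by blast
  qed
  show "zmap B D \<cdot> f = zmap (Dom C f) D" if B: "Cod C f = B" and D: "D \<in> Ob C"
  proof -
    have zmap: "\<guillemotleft>zmap B D : B \<rightarrow> D\<guillemotright>" "zero_arr C (zmap B D)"
      using zmap_in_hom zmap_zero_arr D in_hom_ob[OF f] B by auto
    obtain W t s where W: "zero_obj C W" "\<guillemotleft>t : B \<rightarrow> W\<guillemotright>" "\<guillemotleft>s : W \<rightarrow> D\<guillemotright>" "zmap B D = s \<cdot> t"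
      using zero_arrE[OF zmap(2,1)] .
    have "zmap B D \<cdot> f = s \<cdot> (t \<cdot> f)" using W f B by (simp add: hom_def)
    then have "zero_arr C (zmap B D \<cdot> f)" using zero_arrI[OF W(1) _ W(3)] W(2) f B by auto
    then show ?thesis using zero_arr_iff f B zmap(1) by blast
  qed
qed

lemma zero_objI:
  assumes A: "A \<in> Ob C" and z: "idt A = zmap A A"
  shows "zero_obj C A"
proof -
  have "f = zmap A B" if f: "\<guillemotleft>f : A \<rightarrow> B\<guillemotright>" for f B
  proof -
    have "f \<cdot> zmap A A = f" unfolding z[symmetric] using f A by (simp add: hom_def)
    then show ?thesis using f A by (simp add: hom_def)
  qed
  moreover have "f = zmap B A" if f: "\<guillemotleft>f : B \<rightarrow> A\<guillemotright>" for f B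
  proof -
    have "zmap A A \<cdot> f = f" unfolding z[symmetric] using f A by (simp add: hom_def)
    then show ?thesis using f A by (simp add: hom_def)
  qed
  ultimately have "\<exists>!f. \<guillemotleft>f : A \<rightarrow> B\<guillemotright>" "\<exists>!f. \<guillemotleft>f : B \<rightarrow> A\<guillemotright>" if "B \<in> Ob C" for B
    using ex1I[of "\<lambda>f. \<guillemotleft>f : A \<rightarrow> B\<guillemotright>", OF zmap_in_hom[OF A that]]
      ex1I[of "\<lambda>f. \<guillemotleft>f : B \<rightarrow> A\<guillemotright>", OF zmap_in_hom[OF that A]] by simp_all
  then show ?thesis
    unfolding zero_obj_def initial_obj_def terminal_obj_def using A by simp
qed

lemma zero_obj_zmap:
  assumes "zero_obj C Z"
  shows "\<guillemotleft>f : A \<rightarrow> Z\<guillemotright> \<Longrightarrow> f = zmap A Z" "\<guillemotleft>f : Z \<rightarrow> A\<guillemotright> \<Longrightarrow> f = zmap Z A"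
  by (rule zero_obj_unique[OF assms]; auto intro!: zmap_in_hom dest: in_hom_ob)+

section \<open>Kernels\<close>

lemma kernelD:
  assumes "is_kernel C k f"
  shows "f \<in> Ar C" "\<guillemotleft>k : Dom C k \<rightarrow> Dom C f\<guillemotright>" "zero_arr C (f \<cdot> k)"
  using assms unfolding is_kernel_def by metis+

lemma kernelE:
  assumes "is_kernel C k f" "\<guillemotleft>f : A \<rightarrow> B\<guillemotright>"
  obtains K where "\<guillemotleft>k : K \<rightarrow> A\<guillemotright>" "f \<cdot> k = zmap K B"
proof -
  have k: "\<guillemotleft>k : Dom C k \<rightarrow> A\<guillemotright>" using kernelD(2)[OF assms(1)] assms(2) by (simp add: hom_def)
  then show thesis
    using that zero_arr_iff[OF comp_in_hom[OF k assms(2)]] kernelD(3)[OF assms(1)] by simp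
qed

lemma kernel_comp:
  assumes "is_kernel C k f" "\<guillemotleft>f : A \<rightarrow> B\<guillemotright>" "\<guillemotleft>k : K \<rightarrow> A\<guillemotright>"
  shows "f \<cdot> k = zmap K B"
  using kernelE[OF assms(1,2)] assms(3) by (auto simp: hom_def)

lemma kernel_lift:
  assumes "is_kernel C k f" "\<guillemotleft>f : A \<rightarrow> B\<guillemotright>" "\<guillemotleft>k : K \<rightarrow> A\<guillemotright>" "\<guillemotleft>x : Z \<rightarrow> A\<guillemotright>" "f \<cdot> x = zmap Z B"
  obtains h where "\<guillemotleft>h : Z \<rightarrow> K\<guillemotright>" "k \<cdot> h = x"
proof -
  have "zero_arr C (f \<cdot> x)" using zero_arr_iff[OF comp_in_hom[OF assms(4,2)]] assms(5) by simp
  moreover have "Dom C f = A" "Dom C k = K" using assms(2,3) by (simp_all add: hom_def)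
  ultimately show thesis using assms(1,4) that unfolding is_kernel_def by metis
qed

lemma kernel_monic:
  assumes "is_kernel C k f"
  shows "monic C k"
proof -
  have f: "\<guillemotleft>f : Dom C f \<rightarrow> Cod C f\<guillemotright>" using kernelD[OF assms] by (simp add: hom_def)
  obtain K where k: "\<guillemotleft>k : K \<rightarrow> Dom C f\<guillemotright>" "f \<cdot> k = zmap K (Cod C f)" using kernelE[OF assms f] .
  show ?thesis
  proof (rule monicI[OF k(1)])
    fix Z x y assume xy: "\<guillemotleft>x : Z \<rightarrow> K\<guillemotright>" "\<guillemotleft>y : Z \<rightarrow> K\<guillemotright>" "k \<cdot> x = k \<cdot> y"
    have "f \<cdot> (k \<cdot> y) = zmap Z (Cod C f)" using k(1) f xy(2) by (simp add: hom_def reassoc[OF k(2)])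
    then have "zero_arr C (f \<cdot> (k \<cdot> y))"
      using zero_arr_iff[OF comp_in_hom[OF comp_in_hom[OF xy(2) k(1)] f]] by simp
    moreover have "\<guillemotleft>k \<cdot> y : Z \<rightarrow> Dom C f\<guillemotright>" using k(1) xy(2) by blast
    ultimately have "\<exists>!h. h \<in> hom C Z (Dom C k) \<and> k \<cdot> h = k \<cdot> y"
      using assms unfolding is_kernel_def by blast
    moreover have "Dom C k = K" using k(1) by (simp add: hom_def)
    ultimately show "x = y" using xy by auto
  qed
qed

lemma kernelI:
  assumes "\<guillemotleft>f : A \<rightarrow> B\<guillemotright>" "\<guillemotleft>k : K \<rightarrow> A\<guillemotright>" "f \<cdot> k = zmap K B" "monic C k"
    and "\<And>Z x. \<guillemotleft>x : Z \<rightarrow> A\<guillemotright> \<Longrightarrow> f \<cdot> x = zmap Z B \<Longrightarrow> \<exists>h. \<guillemotleft>h : Z \<rightarrow> K\<guillemotright> \<and> k \<cdot> h = x"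
  shows "is_kernel C k f"
proof -
  have d: "Dom C k = K" "Dom C f = A" "f \<in> Ar C" using assms(1,2) by (simp_all add: hom_def)
  have "\<exists>!h. \<guillemotleft>h : Z \<rightarrow> K\<guillemotright> \<and> k \<cdot> h = x" if x: "\<guillemotleft>x : Z \<rightarrow> A\<guillemotright>" "zero_arr C (f \<cdot> x)" for Z x
  proof -
    have "f \<cdot> x = zmap Z B" using x zero_arr_iff[OF comp_in_hom[OF x(1) assms(1)]] by simp
    then show ?thesis using assms(5)[OF x(1)] monic_cancel[OF assms(4,2)] by metis
  qed
  moreover have "zero_arr C (f \<cdot> k)" using zero_arr_iff[OF comp_in_hom[OF assms(2,1)]] assms(3) by simp
  ultimately show ?thesis unfolding is_kernel_def d using assms(2) d(3) by blast
qed

text \<open>The kernel is the pullback of \<open>f\<close> along the zero map out of a zero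
  object.\<close>

lemma kernel_ex:
  assumes f: "\<guillemotleft>f : A \<rightarrow> B\<guillemotright>"
  obtains K k where "is_kernel C k f" "\<guillemotleft>k : K \<rightarrow> A\<guillemotright>" "f \<cdot> k = zmap K B"
proof -
  obtain Z where Z: "zero_obj C Z" "Z \<in> Ob C" using zero_obj_ex .
  have B: "B \<in> Ob C" using f in_hom_ob by blast
  obtain K k t where pb: "is_pullback C f (zmap Z B) k t" and t: "\<guillemotleft>k : K \<rightarrow> A\<guillemotright>" "\<guillemotleft>t : K \<rightarrow> Z\<guillemotright>"
    and eq: "f \<cdot> k = zmap Z B \<cdot> t"
    using pullback_ex[OF f zmap_in_hom[OF Z(2) B]] by blast
  have K: "f \<cdot> k = zmap K B" using eq t(2) B by (simp add: hom_def)
  have "is_kernel C k f"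
  proof (rule kernelI[OF f t(1) K])
    show "monic C k"
    proof (rule monicI[OF t(1)])
      fix Y x y assume xy: "\<guillemotleft>x : Y \<rightarrow> K\<guillemotright>" "\<guillemotleft>y : Y \<rightarrow> K\<guillemotright>" "k \<cdot> x = k \<cdot> y"
      have "t \<cdot> x = t \<cdot> y"
        using zero_obj_unique(1)[OF Z(1) comp_in_hom[OF xy(1) t(2)] comp_in_hom[OF xy(2) t(2)]] .
      then show "x = y" using pullback_unique[OF pb t(1) xy] by simp
    qed
    fix Y x assume x: "\<guillemotleft>x : Y \<rightarrow> A\<guillemotright>" "f \<cdot> x = zmap Y B"
    have Y: "Y \<in> Ob C" using x(1) in_hom_ob by blast
    have "f \<cdot> x = zmap Z B \<cdot> zmap Y Z" using x(2) Y Z B by simp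
    then show "\<exists>h. \<guillemotleft>h : Y \<rightarrow> K\<guillemotright> \<and> k \<cdot> h = x"
      using pullback_lift[OF pb t x(1) zmap_in_hom[OF Y Z(2)]] by metis
  qed
  then show thesis using that t(1) K by blast
qed

text \<open>Exhibits an arbitrary kernel as a change of base, the shape in which
  \<open>protomodular\<close> accepts it.\<close>

lemma kernel_pullback:
  assumes k: "is_kernel C k f" and f: "\<guillemotleft>f : A \<rightarrow> B\<guillemotright>" and kt: "\<guillemotleft>k : K \<rightarrow> A\<guillemotright>" and Z: "zero_obj C Z"
  shows "is_pullback C (zmap Z B) f (zmap K Z) k"
proof -
  have ob: "Z \<in> Ob C" "K \<in> Ob C" "B \<in> Ob C"
    using zero_obj_ob[OF Z] in_hom_ob(1)[OF kt] in_hom_ob(2)[OF f] .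
  show ?thesis
  proof (rule pullbackI[OF zmap_in_hom[OF ob(1,3)] f zmap_in_hom[OF ob(2,1)] kt])
    show "zmap Z B \<cdot> zmap K Z = f \<cdot> k" using kernel_comp[OF k f kt] ob by simp
    show "x = y" if "\<guillemotleft>x : Y \<rightarrow> K\<guillemotright>" "\<guillemotleft>y : Y \<rightarrow> K\<guillemotright>" "k \<cdot> x = k \<cdot> y" for Y x y
      using monic_cancel[OF kernel_monic[OF k] kt that] .
    fix Y x y assume x: "\<guillemotleft>x : Y \<rightarrow> Z\<guillemotright>" and y: "\<guillemotleft>y : Y \<rightarrow> A\<guillemotright>" and e: "zmap Z B \<cdot> x = f \<cdot> y"
    have "f \<cdot> y = zmap Y B" using e[symmetric] x ob by (simp add: hom_def)
    then obtain h where h: "\<guillemotleft>h : Y \<rightarrow> K\<guillemotright>" "k \<cdot> h = y" using kernel_lift[OF k f kt y] by blast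
    have "zmap K Z \<cdot> h = x" using zero_obj_unique(1)[OF Z _ x] comp_in_hom[OF h(1) zmap_in_hom[OF ob(2,1)]] by blast
    then show "\<exists>h. \<guillemotleft>h : Y \<rightarrow> K\<guillemotright> \<and> zmap K Z \<cdot> h = x \<and> k \<cdot> h = y" using h by blast
  qed
qed

section \<open>Products and equalizers\<close>

lemma productI:
  assumes "\<guillemotleft>p : P \<rightarrow> A\<guillemotright>" "\<guillemotleft>q : P \<rightarrow> B\<guillemotright>"
    and ex: "\<And>Z x y. \<guillemotleft>x : Z \<rightarrow> A\<guillemotright> \<Longrightarrow> \<guillemotleft>y : Z \<rightarrow> B\<guillemotright> \<Longrightarrow> \<exists>h. \<guillemotleft>h : Z \<rightarrow> P\<guillemotright> \<and> p \<cdot> h = x \<and> q \<cdot> h = y"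
    and un: "\<And>Z x y. \<guillemotleft>x : Z \<rightarrow> P\<guillemotright> \<Longrightarrow> \<guillemotleft>y : Z \<rightarrow> P\<guillemotright> \<Longrightarrow> p \<cdot> x = p \<cdot> y \<Longrightarrow> q \<cdot> x = q \<cdot> y \<Longrightarrow> x = y"
  shows "is_product C A B p q"
proof -
  have d: "Dom C p = P" "Dom C q = P" using assms(1,2) by (simp_all add: hom_def)
  have "\<exists>!h. \<guillemotleft>h : Z \<rightarrow> P\<guillemotright> \<and> p \<cdot> h = x \<and> q \<cdot> h = y"
    if "\<guillemotleft>x : Z \<rightarrow> A\<guillemotright>" "\<guillemotleft>y : Z \<rightarrow> B\<guillemotright>" for Z x y
    using ex[OF that] un by metis
  then show ?thesis unfolding is_product_def d using assms(1,2) by simp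
qed

lemma product_lift:
  assumes "is_product C A B p q" "\<guillemotleft>p : P \<rightarrow> A\<guillemotright>" "\<guillemotleft>x : Z \<rightarrow> A\<guillemotright>" "\<guillemotleft>y : Z \<rightarrow> B\<guillemotright>"
  obtains h where "\<guillemotleft>h : Z \<rightarrow> P\<guillemotright>" "p \<cdot> h = x" "q \<cdot> h = y"
proof -
  have "Dom C p = P" using assms(2) by (simp add: hom_def)
  then show thesis using assms(1,3,4) that unfolding is_product_def by metis
qed

lemma product_unique:
  assumes "is_product C A B p q" "\<guillemotleft>p : P \<rightarrow> A\<guillemotright>" "\<guillemotleft>q : P \<rightarrow> B\<guillemotright>"
    and "\<guillemotleft>x : Z \<rightarrow> P\<guillemotright>" "\<guillemotleft>y : Z \<rightarrow> P\<guillemotright>" "p \<cdot> x = p \<cdot> y" "q \<cdot> x = q \<cdot> y"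
  shows "x = y"
proof -
  have "Dom C p = P" using assms(2) by (simp add: hom_def)
  moreover have "\<guillemotleft>p \<cdot> y : Z \<rightarrow> A\<guillemotright>" "\<guillemotleft>q \<cdot> y : Z \<rightarrow> B\<guillemotright>"
    using comp_in_hom[OF assms(5,2)] comp_in_hom[OF assms(5,3)] .
  ultimately have "\<exists>!h. \<guillemotleft>h : Z \<rightarrow> P\<guillemotright> \<and> p \<cdot> h = p \<cdot> y \<and> q \<cdot> h = q \<cdot> y"
    using assms(1) unfolding is_product_def by blast
  then show ?thesis using assms(4-7) by blast
qed

lemma product_ex:
  assumes "A \<in> Ob C" "B \<in> Ob C"
  obtains P p q where "is_product C A B p q" "\<guillemotleft>p : P \<rightarrow> A\<guillemotright>" "\<guillemotleft>q : P \<rightarrow> B\<guillemotright>"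
proof -
  obtain Z where Z: "zero_obj C Z" "Z \<in> Ob C" using zero_obj_ex .
  have z: "\<guillemotleft>zmap A Z : A \<rightarrow> Z\<guillemotright>" "\<guillemotleft>zmap B Z : B \<rightarrow> Z\<guillemotright>" using zmap_in_hom assms Z by blast+
  obtain P p q where pb: "is_pullback C (zmap A Z) (zmap B Z) p q" and t: "\<guillemotleft>p : P \<rightarrow> A\<guillemotright>" "\<guillemotleft>q : P \<rightarrow> B\<guillemotright>"
    using pullback_ex[OF z] by blast
  have "is_product C A B p q"
  proof (rule productI[OF t])
    fix W x y assume xy: "\<guillemotleft>x : W \<rightarrow> A\<guillemotright>" "\<guillemotleft>y : W \<rightarrow> B\<guillemotright>"
    have "zmap A Z \<cdot> x = zmap B Z \<cdot> y"
      using zero_obj_unique(1)[OF Z(1) comp_in_hom[OF xy(1) z(1)] comp_in_hom[OF xy(2) z(2)]] .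
    then show "\<exists>h. \<guillemotleft>h : W \<rightarrow> P\<guillemotright> \<and> p \<cdot> h = x \<and> q \<cdot> h = y"
      using pullback_lift[OF pb t xy] by blast
  qed (rule pullback_unique[OF pb t(1)])
  then show thesis using that t by blast
qed

text \<open>The equalizer is the pullback of the two graphs \<open>(1, g)\<close> and
  \<open>(1, h)\<close> in \<open>A \<times> B\<close>; the first coordinate forces both projections
  of this pullback to coincide.\<close>

lemma equalizer_ex:
  assumes g: "\<guillemotleft>g : A \<rightarrow> B\<guillemotright>" and h: "\<guillemotleft>h : A \<rightarrow> B\<guillemotright>"
  obtains E m where "monic C m" "\<guillemotleft>m : E \<rightarrow> A\<guillemotright>" "g \<cdot> m = h \<cdot> m"
    "\<forall>Z x. \<guillemotleft>x : Z \<rightarrow> A\<guillemotright> \<longrightarrow> g \<cdot> x = h \<cdot> x \<longrightarrow> (\<exists>y. \<guillemotleft>y : Z \<rightarrow> E\<guillemotright> \<and> m \<cdot> y = x)"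
proof -
  have ob: "A \<in> Ob C" "B \<in> Ob C" using g in_hom_ob by blast+
  obtain P p q where pr: "is_product C A B p q" and t: "\<guillemotleft>p : P \<rightarrow> A\<guillemotright>" "\<guillemotleft>q : P \<rightarrow> B\<guillemotright>"
    using product_ex[OF ob] .
  obtain u where u: "\<guillemotleft>u : A \<rightarrow> P\<guillemotright>" "p \<cdot> u = idt A" "q \<cdot> u = g"
    using product_lift[OF pr t(1) ident_in_hom[OF ob(1)] g] .
  obtain v where v: "\<guillemotleft>v : A \<rightarrow> P\<guillemotright>" "p \<cdot> v = idt A" "q \<cdot> v = h"
    using product_lift[OF pr t(1) ident_in_hom[OF ob(1)] h] .
  obtain E a b where pb: "is_pullback C u v a b" and ab: "\<guillemotleft>a : E \<rightarrow> A\<guillemotright>" "\<guillemotleft>b : E \<rightarrow> A\<guillemotright>" "u \<cdot> a = v \<cdot> b"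
    using pullback_ex[OF u(1) v(1)] by blast
  have "p \<cdot> (u \<cdot> a) = p \<cdot> (v \<cdot> b)" "q \<cdot> (u \<cdot> a) = q \<cdot> (v \<cdot> b)" using ab(3) by simp_all
  then have eq: "a = b" "g \<cdot> a = h \<cdot> b"
    using ab(1,2) u(1) v(1) t by (simp_all add: hom_def reassoc[OF u(2)] reassoc[OF v(2)] reassoc[OF u(3)] reassoc[OF v(3)])
  have "\<exists>y. \<guillemotleft>y : Z \<rightarrow> E\<guillemotright> \<and> a \<cdot> y = x" if x: "\<guillemotleft>x : Z \<rightarrow> A\<guillemotright>" "g \<cdot> x = h \<cdot> x" for Z x
  proof -
    have "u \<cdot> x = v \<cdot> x"
    proof (rule product_unique[OF pr t comp_in_hom[OF x(1) u(1)] comp_in_hom[OF x(1) v(1)]])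
      show "p \<cdot> (u \<cdot> x) = p \<cdot> (v \<cdot> x)" "q \<cdot> (u \<cdot> x) = q \<cdot> (v \<cdot> x)" using t u(1) v(1) x
        by (simp_all add: hom_def reassoc[OF u(2)] reassoc[OF v(2)] reassoc[OF u(3)] reassoc[OF v(3)])
    qed
    then show ?thesis using pullback_lift[OF pb ab(1,2) x(1) x(1)] by blast
  qed
  moreover have "monic C a" using pullback_monic[OF pb] split_mono[OF v(1) t(1) v(2)] by blast
  ultimately show thesis using that ab(1) eq by simp
qed

section \<open>Consequences of protomodularity\<close>

text \<open>The split short five lemma. It is Bourn's condition for \<open>v : 0 -> B\<close>,
  because pulling a point back along this arrow gives its kernel.\<close>

lemma iso_of_iso_on_kernels:
  assumes p: "\<guillemotleft>p : A \<rightarrow> B\<guillemotright>" "\<guillemotleft>s : B \<rightarrow> A\<guillemotright>" "p \<cdot> s = idt B"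
    and p': "\<guillemotleft>p' : A' \<rightarrow> B\<guillemotright>" "\<guillemotleft>s' : B \<rightarrow> A'\<guillemotright>" "p' \<cdot> s' = idt B"
    and h: "\<guillemotleft>h : A \<rightarrow> A'\<guillemotright>" "p' \<cdot> h = p" "h \<cdot> s = s'"
    and k: "is_kernel C k p" "\<guillemotleft>k : K \<rightarrow> A\<guillemotright>" and k': "is_kernel C k' p'" "\<guillemotleft>k' : K' \<rightarrow> A'\<guillemotright>"
    and j: "iso C j" "\<guillemotleft>j : K \<rightarrow> K'\<guillemotright>" "k' \<cdot> j = h \<cdot> k"
  shows "iso C h"
proof -
  obtain Z where Z: "zero_obj C Z" "Z \<in> Ob C" using zero_obj_ex .
  have ob: "B \<in> Ob C" "K \<in> Ob C" "K' \<in> Ob C" using p j in_hom_ob by blast+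
  have PM: "protomodular C" using semi_abelian by (simp add: semi_abelian_def)
  note PM' = PM[unfolded protomodular_def, rule_format]
  show ?thesis
  proof (rule PM'[of "zmap Z B" p s p' s' h "zmap K Z" k "zmap K' Z" k' j])
    show "point C (Cod C (zmap Z B)) p s" "point C (Cod C (zmap Z B)) p' s'"
      using p p' Z ob unfolding point_def by (auto simp: hom_def)
    show "is_pullback C (zmap Z B) p (zmap K Z) k" "is_pullback C (zmap Z B) p' (zmap K' Z) k'"
      using kernel_pullback[OF _ _ _ Z(1)] k k' p p' by blast+
    show "zmap K' Z \<cdot> j = zmap K Z" using j(2) Z ob by (simp add: hom_def)
  qed (use Z ob h j p(1) p'(1) in \<open>auto simp: hom_def\<close>)
qed

text \<open>The restriction \<open>p \<cdot> m\<close> is again split, by \<open>s'\<close>, and has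
  the same kernel \<open>K\<close>. So \<open>m\<close> is a morphism of points over
  \<open>B\<close> that is the identity on kernels, and the split short five lemma applies.\<close>

lemma jointly_strongly_epic:
  assumes p: "\<guillemotleft>p : A \<rightarrow> B\<guillemotright>" "\<guillemotleft>s : B \<rightarrow> A\<guillemotright>" "p \<cdot> s = idt B"
    and k: "is_kernel C k p" "\<guillemotleft>k : K \<rightarrow> A\<guillemotright>"
    and m: "monic C m" "\<guillemotleft>m : M \<rightarrow> A\<guillemotright>"
    and s': "\<guillemotleft>s' : B \<rightarrow> M\<guillemotright>" "m \<cdot> s' = s" and k': "\<guillemotleft>k' : K \<rightarrow> M\<guillemotright>" "m \<cdot> k' = k"
  shows "iso C m"
proof (rule iso_of_iso_on_kernels[OF _ s'(1) _ p m(2) _ s'(2) _ k'(1) k])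
  have K: "K \<in> Ob C" using k(2) in_hom_ob by blast
  show t: "\<guillemotleft>p \<cdot> m : M \<rightarrow> B\<guillemotright>" using p(1) m(2) by blast
  show "(p \<cdot> m) \<cdot> s' = idt B" using p m(2) s' by (simp add: hom_def)
  show "iso C (idt K)" "\<guillemotleft>idt K : K \<rightarrow> K\<guillemotright>" "k \<cdot> idt K = m \<cdot> k'"
    using iso_ident[OF K] ident_in_hom[OF K] k(2) k'(2) by (simp_all add: hom_def)
  show "is_kernel C k' (p \<cdot> m)"
  proof (rule kernelI[OF t k'(1)])
    show "(p \<cdot> m) \<cdot> k' = zmap K B"
      using p(1) m(2) k' kernel_comp[OF k(1) p(1) k(2)] by (simp add: hom_def)
    show "monic C k'" using monic_comp_cancel[OF _ k'(1) m(2)] kernel_monic[OF k(1)] k'(2) by simp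
    fix Z x assume x: "\<guillemotleft>x : Z \<rightarrow> M\<guillemotright>" "(p \<cdot> m) \<cdot> x = zmap Z B"
    have mx: "\<guillemotleft>m \<cdot> x : Z \<rightarrow> A\<guillemotright>" "p \<cdot> (m \<cdot> x) = zmap Z B" using x p(1) m(2) by (simp_all add: hom_def)
    obtain h where h: "\<guillemotleft>h : Z \<rightarrow> K\<guillemotright>" "k \<cdot> h = m \<cdot> x" using kernel_lift[OF k(1) p(1) k(2) mx] .
    have "m \<cdot> (k' \<cdot> h) = m \<cdot> x" using h k'(1) m(2) by (simp add: hom_def reassoc[OF k'(2)])
    then have "k' \<cdot> h = x" using monic_cancel[OF m comp_in_hom[OF h(1) k'(1)] x(1)] by simp
    then show "\<exists>h. \<guillemotleft>h : Z \<rightarrow> K\<guillemotright> \<and> k' \<cdot> h = x" using h(1) by blast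
  qed
qed simp

text \<open>The equalizer of \<open>g\<close> and \<open>h\<close> is a subobject containing both
  the section and the kernel.\<close>

lemma jointly_epic:
  assumes p: "\<guillemotleft>p : A \<rightarrow> B\<guillemotright>" "\<guillemotleft>s : B \<rightarrow> A\<guillemotright>" "p \<cdot> s = idt B"
    and k: "is_kernel C k p" "\<guillemotleft>k : K \<rightarrow> A\<guillemotright>"
    and g: "\<guillemotleft>g : A \<rightarrow> D\<guillemotright>" and h: "\<guillemotleft>h : A \<rightarrow> D\<guillemotright>" and eq: "g \<cdot> s = h \<cdot> s" "g \<cdot> k = h \<cdot> k"
  shows "g = h"
proof -
  obtain E m where m: "monic C m" "\<guillemotleft>m : E \<rightarrow> A\<guillemotright>" "g \<cdot> m = h \<cdot> m"
    and un: "\<forall>Z x. \<guillemotleft>x : Z \<rightarrow> A\<guillemotright> \<longrightarrow> g \<cdot> x = h \<cdot> x \<longrightarrow> (\<exists>y. \<guillemotleft>y : Z \<rightarrow> E\<guillemotright> \<and> m \<cdot> y = x)"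
    using equalizer_ex[OF g h] .
  have "iso C m"
    using un p(2) k(2) eq jointly_strongly_epic[OF p k m(1,2)] by blast
  then show ?thesis using regular_epi_cancel[OF iso_regular_epi m(2) g h m(3)] m(2) by blast
qed

lemma kernel_pair_ex:
  assumes f: "\<guillemotleft>f : A \<rightarrow> B\<guillemotright>"
  obtains R r0 r1 d where "kernel_pair C f r0 r1" "\<guillemotleft>r0 : R \<rightarrow> A\<guillemotright>" "\<guillemotleft>r1 : R \<rightarrow> A\<guillemotright>" "f \<cdot> r0 = f \<cdot> r1"
    "\<guillemotleft>d : A \<rightarrow> R\<guillemotright>" "r0 \<cdot> d = idt A" "r1 \<cdot> d = idt A"
proof -
  have A: "A \<in> Ob C" using f in_hom_ob by blast
  obtain R r0 r1 where r: "kernel_pair C f r0 r1" "\<guillemotleft>r0 : R \<rightarrow> A\<guillemotright>" "\<guillemotleft>r1 : R \<rightarrow> A\<guillemotright>" "f \<cdot> r0 = f \<cdot> r1"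
    using pullback_ex[OF f f] .
  then show thesis
    using that[OF r] pullback_lift[OF r(1-3) ident_in_hom[OF A] ident_in_hom[OF A]] by metis
qed

text \<open>The kernel pair is split by its diagonal, so \<open>r0 = r1\<close> needs checking only
  on the diagonal and on the kernel of \<open>r0\<close>. On the latter \<open>r1\<close> is killed
  by \<open>f\<close> and hence zero.\<close>

lemma monic_of_zero_kernel:
  assumes f: "\<guillemotleft>f : A \<rightarrow> B\<guillemotright>"
    and z: "\<And>Z x. \<guillemotleft>x : Z \<rightarrow> A\<guillemotright> \<Longrightarrow> f \<cdot> x = zmap Z B \<Longrightarrow> x = zmap Z A"
  shows "monic C f"
proof -
  obtain R r0 r1 d where r: "kernel_pair C f r0 r1" "\<guillemotleft>r0 : R \<rightarrow> A\<guillemotright>" "\<guillemotleft>r1 : R \<rightarrow> A\<guillemotright>" "f \<cdot> r0 = f \<cdot> r1"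
    and d: "\<guillemotleft>d : A \<rightarrow> R\<guillemotright>" "r0 \<cdot> d = idt A" "r1 \<cdot> d = idt A"
    using kernel_pair_ex[OF f] .
  obtain K k where k: "is_kernel C k r0" "\<guillemotleft>k : K \<rightarrow> R\<guillemotright>" "r0 \<cdot> k = zmap K A" using kernel_ex[OF r(2)] .
  have ob: "A \<in> Ob C" "K \<in> Ob C" using f k(2) in_hom_ob by blast+
  have "f \<cdot> (r1 \<cdot> k) = zmap K B" using f r(2,3) k(2) ob by (simp add: hom_def reassoc[OF r(4)[symmetric]] k(3))
  then have "r1 \<cdot> k = zmap K A" using z r(3) k(2) by blast
  then have "r0 = r1" using jointly_epic[OF r(2) d(1,2) k(1,2) r(2,3)] d k(3) by simp
  then show ?thesis
    using pullback_lift[OF r(1-3)] monicI[OF f] by metis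
qed

text \<open>A regular epimorphism is the cokernel of its kernel. By \<open>jointly_epic\<close>,
  merging the kernel pair reduces to the diagonal and the kernel of \<open>r0\<close>, which
  \<open>r1\<close> carries into the kernel of \<open>f\<close>.\<close>

lemma regular_epi_kernel_lift:
  assumes f: "regular_epi C f" "\<guillemotleft>f : A \<rightarrow> B\<guillemotright>" and k: "is_kernel C k f" "\<guillemotleft>k : K \<rightarrow> A\<guillemotright>"
    and x: "\<guillemotleft>x : A \<rightarrow> D\<guillemotright>" "x \<cdot> k = zmap K D"
  obtains y where "\<guillemotleft>y : B \<rightarrow> D\<guillemotright>" "y \<cdot> f = x"
proof -
  obtain R r0 r1 d where r: "kernel_pair C f r0 r1" "\<guillemotleft>r0 : R \<rightarrow> A\<guillemotright>" "\<guillemotleft>r1 : R \<rightarrow> A\<guillemotright>" "f \<cdot> r0 = f \<cdot> r1"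
    and d: "\<guillemotleft>d : A \<rightarrow> R\<guillemotright>" "r0 \<cdot> d = idt A" "r1 \<cdot> d = idt A"
    using kernel_pair_ex[OF f(2)] .
  obtain L l where l: "is_kernel C l r0" "\<guillemotleft>l : L \<rightarrow> R\<guillemotright>" "r0 \<cdot> l = zmap L A" using kernel_ex[OF r(2)] .
  have ob: "A \<in> Ob C" "L \<in> Ob C" "D \<in> Ob C" using f l(2) x in_hom_ob by blast+
  have r1l: "\<guillemotleft>r1 \<cdot> l : L \<rightarrow> A\<guillemotright>" using r(3) l(2) by blast
  have "f \<cdot> (r1 \<cdot> l) = zmap L B" using f r(2,3) l(2) ob by (simp add: hom_def reassoc[OF r(4)[symmetric]] l(3))
  then obtain h where h: "\<guillemotleft>h : L \<rightarrow> K\<guillemotright>" "k \<cdot> h = r1 \<cdot> l" using kernel_lift[OF k(1) f(2) k(2) r1l] by blast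
  have "x \<cdot> (r1 \<cdot> l) = zmap L D"
    using h(1) k(2) x(1) ob by (simp add: hom_def h(2)[symmetric] reassoc[OF x(2)])
  then have "(x \<cdot> r0) \<cdot> l = (x \<cdot> r1) \<cdot> l" using x(1) r(2,3) l(2,3) ob by (simp add: hom_def)
  moreover have "(x \<cdot> r0) \<cdot> d = (x \<cdot> r1) \<cdot> d" using x(1) r(2,3) d by (simp add: hom_def)
  ultimately have xr: "x \<cdot> r0 = x \<cdot> r1"
    using jointly_epic[OF r(2) d(1,2) l(1,2)] x(1) r(2,3) by blast
  show thesis using regular_epi_kernel_pair_lift[OF f r(1-3) x(1) xr] that by blast
qed

text \<open>The short five lemma for monomorphisms of extensions: \<open>T \<times>\<^sub>D T \<rightarrow> T \<times>\<^sub>D E\<close> contains the section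
  and the kernel of the first projection.\<close>

lemma short_five:
  assumes t: "monic C t" "\<guillemotleft>t : T \<rightarrow> E\<guillemotright>" and p: "\<guillemotleft>p : E \<rightarrow> D\<guillemotright>" and pt: "regular_epi C (p \<cdot> t)"
    and k: "\<And>Z x. \<guillemotleft>x : Z \<rightarrow> E\<guillemotright> \<Longrightarrow> p \<cdot> x = zmap Z D \<Longrightarrow> \<exists>y. \<guillemotleft>y : Z \<rightarrow> T\<guillemotright> \<and> t \<cdot> y = x"
  shows "iso C t"
proof -
  have ptt: "\<guillemotleft>p \<cdot> t : T \<rightarrow> D\<guillemotright>" using t(2) p by blast
  have ob: "T \<in> Ob C" "E \<in> Ob C" "D \<in> Ob C" using t(2) p in_hom_ob by blast+
  obtain R r0 r1 d where r: "kernel_pair C (p \<cdot> t) r0 r1" "\<guillemotleft>r0 : R \<rightarrow> T\<guillemotright>" "\<guillemotleft>r1 : R \<rightarrow> T\<guillemotright>" "(p \<cdot> t) \<cdot> r0 = (p \<cdot> t) \<cdot> r1"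
    and d: "\<guillemotleft>d : T \<rightarrow> R\<guillemotright>" "r0 \<cdot> d = idt T" "r1 \<cdot> d = idt T"
    using kernel_pair_ex[OF ptt] .
  obtain W w0 w1 where w: "is_pullback C (p \<cdot> t) p w0 w1" "\<guillemotleft>w0 : W \<rightarrow> T\<guillemotright>" "\<guillemotleft>w1 : W \<rightarrow> E\<guillemotright>" "(p \<cdot> t) \<cdot> w0 = p \<cdot> w1"
    using pullback_ex[OF ptt p] .
  have "(p \<cdot> t) \<cdot> r0 = p \<cdot> (t \<cdot> r1)" using r p t(2) by (simp add: hom_def)
  \<comment> \<open>\<open>m\<close> is the comparison from \<open>T \<times> T\<close> over
    \<open>D\<close> to \<open>T \<times> E\<close> over \<open>D\<close>, that is, the pullback of
    \<open>t\<close>.\<close>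
  then obtain m where m: "\<guillemotleft>m : R \<rightarrow> W\<guillemotright>" "w0 \<cdot> m = r0" "w1 \<cdot> m = t \<cdot> r1"
    using pullback_lift[OF w(1-3) r(2)] r(3) t(2) by blast
  have "(p \<cdot> t) \<cdot> idt T = p \<cdot> t" using ptt by (simp add: hom_def)
  then obtain s where s: "\<guillemotleft>s : T \<rightarrow> W\<guillemotright>" "w0 \<cdot> s = idt T" "w1 \<cdot> s = t"
    using pullback_lift[OF w(1-3) ident_in_hom[OF ob(1)] t(2)] by blast
  have mm: "monic C m"
  proof (rule monicI[OF m(1)])
    fix Z x y assume xy: "\<guillemotleft>x : Z \<rightarrow> R\<guillemotright>" "\<guillemotleft>y : Z \<rightarrow> R\<guillemotright>" "m \<cdot> x = m \<cdot> y"
    then have "w0 \<cdot> (m \<cdot> x) = w0 \<cdot> (m \<cdot> y)" "w1 \<cdot> (m \<cdot> x) = w1 \<cdot> (m \<cdot> y)" by simp_all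
    then have e: "r0 \<cdot> x = r0 \<cdot> y" "t \<cdot> (r1 \<cdot> x) = t \<cdot> (r1 \<cdot> y)"
      using xy(1,2) m(1) w(2,3) r(3) t(2) by (simp_all add: hom_def reassoc[OF m(2)] reassoc[OF m(3)])
    have "r1 \<cdot> x = r1 \<cdot> y" using monic_cancel[OF t comp_in_hom[OF xy(1) r(3)] comp_in_hom[OF xy(2) r(3)] e(2)] .
    then show "x = y" using pullback_unique[OF r(1,2) xy(1,2) e(1)] by blast
  qed
  have md: "m \<cdot> d = s"
  proof (rule pullback_unique[OF w(1,2) _ s(1)])
    show "w0 \<cdot> (m \<cdot> d) = w0 \<cdot> s" "w1 \<cdot> (m \<cdot> d) = w1 \<cdot> s"
      using m(1) d w(2,3) s r(3) t(2) by (simp_all add: hom_def reassoc[OF m(2)] reassoc[OF m(3)])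
  qed (use m d in blast)
  obtain L l where l: "is_kernel C l w0" "\<guillemotleft>l : L \<rightarrow> W\<guillemotright>" "w0 \<cdot> l = zmap L T" using kernel_ex[OF w(2)] .
  have L: "L \<in> Ob C" using l in_hom_ob by blast
  have w1l: "\<guillemotleft>w1 \<cdot> l : L \<rightarrow> E\<guillemotright>" using w l by blast
  have w4: "p \<cdot> w1 = p \<cdot> (t \<cdot> w0)" using w(2,4) t(2) p by (simp add: hom_def)
  have "p \<cdot> (w1 \<cdot> l) = zmap L D" using w(2,3) t(2) p l(2) ob L by (simp add: hom_def reassoc[OF w4] l(3))
  then obtain y where y: "\<guillemotleft>y : L \<rightarrow> T\<guillemotright>" "t \<cdot> y = w1 \<cdot> l" using k[OF w1l] by blast
  have "(p \<cdot> t) \<cdot> zmap L T = (p \<cdot> t) \<cdot> y"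
    using ptt p t(2) y ob L \<open>p \<cdot> (w1 \<cdot> l) = zmap L D\<close> by (simp add: hom_def)
  then obtain l' where l': "\<guillemotleft>l' : L \<rightarrow> R\<guillemotright>" "r0 \<cdot> l' = zmap L T" "r1 \<cdot> l' = y"
    using pullback_lift[OF r(1-3) zmap_in_hom[OF L ob(1)] y(1)] by blast
  have ml: "m \<cdot> l' = l"
  proof (rule pullback_unique[OF w(1,2) _ l(2)])
    show "w0 \<cdot> (m \<cdot> l') = w0 \<cdot> l" "w1 \<cdot> (m \<cdot> l') = w1 \<cdot> l"
      using m(1) l' w(2,3) l r(3) t(2) y by (simp_all add: hom_def reassoc[OF m(2)] reassoc[OF m(3)])
  qed (use m l' in blast)
  have "iso C m" using jointly_strongly_epic[OF w(2) s(1,2) l(1,2) mm m(1) d(1) md l'(1) ml] .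
  \<comment> \<open>\<open>w1\<close> is a pullback of the regular epimorphism
    \<open>p \<cdot> t\<close>. With \<open>m\<close> invertible,
    \<open>w1 \<cdot> m = t \<cdot> r1\<close> is a regular epimorphism, and so is its last factor
    \<open>t\<close>.\<close>
  then have "regular_epi C (w1 \<cdot> m)"
    using regular_epi_comp[OF iso_regular_epi _ m(1) w(3)] m(1) pullback_regular_epi(2)[OF w(1) pt] by blast
  then have "regular_epi C t" using regular_epi_comp_cancel[OF _ r(3) t(2)] m(3) by simp
  then show ?thesis using regular_epi_monic_iso t by blast
qed

text \<open>The Mal'tsev property, in the form \<open>x S y \<and> x S z \<Longrightarrow> y S z\<close>: the triples \<open>(x, y, z)\<close> satisfying
  the conclusion contain those with \<open>y = z\<close> and those with \<open>x = y = 0\<close>.\<close>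

lemma reflexive_relation_euclidean:
  assumes r: "\<guillemotleft>r0 : S \<rightarrow> X\<guillemotright>" "\<guillemotleft>r1 : S \<rightarrow> X\<guillemotright>"
    and jm: "\<forall>Z x y. \<guillemotleft>x : Z \<rightarrow> S\<guillemotright> \<longrightarrow> \<guillemotleft>y : Z \<rightarrow> S\<guillemotright> \<longrightarrow> r0 \<cdot> x = r0 \<cdot> y \<longrightarrow> r1 \<cdot> x = r1 \<cdot> y \<longrightarrow> x = y"
    and e: "\<guillemotleft>e : X \<rightarrow> S\<guillemotright>" "r0 \<cdot> e = idt X" "r1 \<cdot> e = idt X"
    and uv: "\<guillemotleft>u : Z \<rightarrow> S\<guillemotright>" "\<guillemotleft>v : Z \<rightarrow> S\<guillemotright>" "r0 \<cdot> u = r0 \<cdot> v"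
  obtains w where "\<guillemotleft>w : Z \<rightarrow> S\<guillemotright>" "r0 \<cdot> w = r1 \<cdot> u" "r1 \<cdot> w = r1 \<cdot> v"
proof -
  have ob: "S \<in> Ob C" "X \<in> Ob C" using in_hom_ob[OF r(1)] .
  obtain P p q where pr: "is_product C X X p q" and pq: "\<guillemotleft>p : P \<rightarrow> X\<guillemotright>" "\<guillemotleft>q : P \<rightarrow> X\<guillemotright>"
    using product_ex[OF ob(2,2)] .
  obtain T t0 t1 where T: "is_pullback C r0 r0 t0 t1" and t: "\<guillemotleft>t0 : T \<rightarrow> S\<guillemotright>" "\<guillemotleft>t1 : T \<rightarrow> S\<guillemotright>" "r0 \<cdot> t0 = r0 \<cdot> t1"
    using pullback_ex[OF r(1,1)] .
  obtain \<rho> where \<rho>: "\<guillemotleft>\<rho> : S \<rightarrow> P\<guillemotright>" "p \<cdot> \<rho> = r0" "q \<cdot> \<rho> = r1" using product_lift[OF pr pq(1) r] .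
  obtain \<tau> where \<tau>: "\<guillemotleft>\<tau> : T \<rightarrow> P\<guillemotright>" "p \<cdot> \<tau> = r1 \<cdot> t0" "q \<cdot> \<tau> = r1 \<cdot> t1"
    using product_lift[OF pr pq(1) comp_in_hom[OF t(1) r(2)] comp_in_hom[OF t(2) r(2)]] .
  \<comment> \<open>An element of \<open>T\<close> is a triple \<open>(x, y, z)\<close> with
    \<open>x S y\<close> and \<open>x S z\<close>; \<open>M\<close> is the subobject of those with
    \<open>y S z\<close>. The goal is that \<open>m\<close> is invertible.\<close>
  obtain M m n where M: "is_pullback C \<tau> \<rho> m n" and mn: "\<guillemotleft>m : M \<rightarrow> T\<guillemotright>" "\<guillemotleft>n : M \<rightarrow> S\<guillemotright>" "\<tau> \<cdot> m = \<rho> \<cdot> n"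
    using pullback_ex[OF \<tau>(1) \<rho>(1)] .
  have "monic C \<rho>"
  proof (rule monicI[OF \<rho>(1)])
    fix Z x y assume xy: "\<guillemotleft>x : Z \<rightarrow> S\<guillemotright>" "\<guillemotleft>y : Z \<rightarrow> S\<guillemotright>" "\<rho> \<cdot> x = \<rho> \<cdot> y"
    then have "p \<cdot> (\<rho> \<cdot> x) = p \<cdot> (\<rho> \<cdot> y)" "q \<cdot> (\<rho> \<cdot> x) = q \<cdot> (\<rho> \<cdot> y)" by simp_all
    then show "x = y"
      using jm[rule_format, OF xy(1,2)] xy(1,2) pq \<rho>(1) by (simp add: hom_def reassoc[OF \<rho>(2)] reassoc[OF \<rho>(3)])
  qed
  then have mm: "monic C m" using pullback_monic[OF M] by blast
  have eqI: "\<tau> \<cdot> x = \<rho> \<cdot> y" if xy: "\<guillemotleft>x : Z \<rightarrow> T\<guillemotright>" "\<guillemotleft>y : Z \<rightarrow> S\<guillemotright>" "r1 \<cdot> (t0 \<cdot> x) = r0 \<cdot> y" "r1 \<cdot> (t1 \<cdot> x) = r1 \<cdot> y" for Z x y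
  proof (rule product_unique[OF pr pq comp_in_hom[OF xy(1) \<tau>(1)] comp_in_hom[OF xy(2) \<rho>(1)]])
    show "p \<cdot> (\<tau> \<cdot> x) = p \<cdot> (\<rho> \<cdot> y)" "q \<cdot> (\<tau> \<cdot> x) = q \<cdot> (\<rho> \<cdot> y)"
      using xy pq r t(1,2) \<rho>(1) \<tau>(1)
      by (simp_all add: hom_def reassoc[OF \<rho>(2)] reassoc[OF \<rho>(3)] reassoc[OF \<tau>(2)] reassoc[OF \<tau>(3)])
  qed
  \<comment> \<open>The triples with \<open>y = z\<close> form a section of \<open>t0\<close>;
    reflexivity places them in \<open>M\<close>.\<close>
  obtain \<sigma> where \<sigma>: "\<guillemotleft>\<sigma> : S \<rightarrow> T\<guillemotright>" "t0 \<cdot> \<sigma> = idt S" "t1 \<cdot> \<sigma> = idt S"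
    using pullback_lift[OF T t(1,2) ident_in_hom[OF ob(1)] ident_in_hom[OF ob(1)]] by blast
  have "\<tau> \<cdot> \<sigma> = \<rho> \<cdot> (e \<cdot> r1)"
    by (rule eqI[OF \<sigma>(1)]) (use r e \<sigma> in \<open>simp_all add: hom_def reassoc[OF e(2)] reassoc[OF e(3)]\<close>)
  then obtain s' where s': "\<guillemotleft>s' : S \<rightarrow> M\<guillemotright>" "m \<cdot> s' = \<sigma>"
    using pullback_lift[OF M mn(1,2) \<sigma>(1) comp_in_hom[OF r(2) e(1)]] by blast
  \<comment> \<open>On the kernel of \<open>t0\<close> the first pair is \<open>(0, 0)\<close>, so
    the second pair \<open>(0, z)\<close> already is the required pair
    \<open>(y, z)\<close>.\<close>
  obtain K k where k: "is_kernel C k t0" "\<guillemotleft>k : K \<rightarrow> T\<guillemotright>" "t0 \<cdot> k = zmap K S" using kernel_ex[OF t(1)] .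
  have K: "K \<in> Ob C" using in_hom_ob(1)[OF k(2)] .
  have "\<tau> \<cdot> k = \<rho> \<cdot> (t1 \<cdot> k)"
    by (rule eqI[OF k(2) comp_in_hom[OF k(2) t(2)]])
      (use r t(1,2) k(2) ob K in \<open>simp_all add: hom_def k(3) reassoc[OF t(3)[symmetric]]\<close>)
  then obtain k' where k': "\<guillemotleft>k' : K \<rightarrow> M\<guillemotright>" "m \<cdot> k' = k"
    using pullback_lift[OF M mn(1,2) k(2) comp_in_hom[OF k(2) t(2)]] by blast
  have "iso C m" using jointly_strongly_epic[OF t(1) \<sigma>(1,2) k(1,2) mm mn(1) s' k'] .
  then obtain m' where m': "\<guillemotleft>m' : T \<rightarrow> M\<guillemotright>" "m \<cdot> m' = idt T" using isoE[OF _ mn(1)] by blast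
  obtain h where h: "\<guillemotleft>h : Z \<rightarrow> T\<guillemotright>" "t0 \<cdot> h = u" "t1 \<cdot> h = v"
    using pullback_lift[OF T t(1,2) uv] .
  have mh: "\<guillemotleft>m' \<cdot> h : Z \<rightarrow> M\<guillemotright>" using h(1) m'(1) by blast
  have "\<rho> \<cdot> (n \<cdot> (m' \<cdot> h)) = \<tau> \<cdot> h"
    using \<rho>(1) \<tau>(1) mn(1,2) m'(1) h(1) by (simp add: hom_def reassoc[OF mn(3)[symmetric]] reassoc[OF m'(2)])
  then have "p \<cdot> (\<rho> \<cdot> (n \<cdot> (m' \<cdot> h))) = p \<cdot> (\<tau> \<cdot> h)" "q \<cdot> (\<rho> \<cdot> (n \<cdot> (m' \<cdot> h))) = q \<cdot> (\<tau> \<cdot> h)" by simp_all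
  then have "r0 \<cdot> (n \<cdot> (m' \<cdot> h)) = r1 \<cdot> u" "r1 \<cdot> (n \<cdot> (m' \<cdot> h)) = r1 \<cdot> v"
    using pq r t(1,2) \<rho>(1) \<tau>(1) mn(1,2) m'(1) h
    by (simp_all add: hom_def reassoc[OF \<rho>(2)] reassoc[OF \<rho>(3)] reassoc[OF \<tau>(2)] reassoc[OF \<tau>(3)])
  then show thesis using that[of "n \<cdot> (m' \<cdot> h)"] comp_in_hom[OF mh mn(2)] by blast
qed

text \<open>A reflexive and Euclidean relation is an equivalence relation, so exactness makes it the
  kernel pair of some arrow, and then of its own coequalizer as well.\<close>

lemma reflexive_relation_effective:
  assumes r: "\<guillemotleft>r0 : S \<rightarrow> X\<guillemotright>" "\<guillemotleft>r1 : S \<rightarrow> X\<guillemotright>"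
    and jm: "\<forall>Z x y. \<guillemotleft>x : Z \<rightarrow> S\<guillemotright> \<longrightarrow> \<guillemotleft>y : Z \<rightarrow> S\<guillemotright> \<longrightarrow> r0 \<cdot> x = r0 \<cdot> y \<longrightarrow> r1 \<cdot> x = r1 \<cdot> y \<longrightarrow> x = y"
    and e: "\<guillemotleft>e : X \<rightarrow> S\<guillemotright>" "r0 \<cdot> e = idt X" "r1 \<cdot> e = idt X"
  obtains Q q where "is_coequalizer C r0 r1 q" "kernel_pair C q r0 r1" "\<guillemotleft>q : X \<rightarrow> Q\<guillemotright>"
proof -
  have ob: "S \<in> Ob C" "X \<in> Ob C" using in_hom_ob[OF r(1)] .
  \<comment> \<open>Symmetry: \<open>x S y\<close> and \<open>x S x\<close> give
    \<open>y S x\<close>.\<close>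
  have "\<guillemotleft>e \<cdot> r0 : S \<rightarrow> S\<guillemotright>" "r0 \<cdot> idt S = r0 \<cdot> (e \<cdot> r0)"
    using r e by (simp_all add: hom_def reassoc[OF e(2)])
  then obtain s where s: "\<guillemotleft>s : S \<rightarrow> S\<guillemotright>" "r0 \<cdot> s = r1 \<cdot> idt S" "r1 \<cdot> s = r1 \<cdot> (e \<cdot> r0)"
    using reflexive_relation_euclidean[OF r jm e ident_in_hom[OF ob(1)], of "e \<cdot> r0"] by blast
  have s': "r0 \<cdot> s = r1" "r1 \<cdot> s = r0" using s r e(1) by (simp_all add: hom_def reassoc[OF e(3)])
  have trans: "\<exists>t\<in>hom C (Dom C p) S. r0 \<cdot> t = r0 \<cdot> p \<and> r1 \<cdot> t = r1 \<cdot> q" if pb: "is_pullback C r1 r0 p q" for p q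
  proof -
    obtain B T where "\<guillemotleft>r0 : B \<rightarrow> X\<guillemotright>" "\<guillemotleft>p : T \<rightarrow> S\<guillemotright>" "\<guillemotleft>q : T \<rightarrow> B\<guillemotright>" "r1 \<cdot> p = r0 \<cdot> q"
      using pullbackE[OF pb r(2)] .
    then have T: "\<guillemotleft>p : T \<rightarrow> S\<guillemotright>" "\<guillemotleft>q : T \<rightarrow> S\<guillemotright>" "r1 \<cdot> p = r0 \<cdot> q" "Dom C p = T"
      using r(1) by (simp_all add: hom_def)
    \<comment> \<open>Transitivity: after reversing the first pair, \<open>y S x\<close> and
      \<open>y S z\<close> give \<open>x S z\<close>.\<close>
    have "r0 \<cdot> (s \<cdot> p) = r0 \<cdot> q" "r1 \<cdot> (s \<cdot> p) = r0 \<cdot> p"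
      using r s(1) T by (simp_all add: hom_def reassoc[OF s'(1)] reassoc[OF s'(2)])
    then obtain t where "\<guillemotleft>t : T \<rightarrow> S\<guillemotright>" "r0 \<cdot> t = r1 \<cdot> (s \<cdot> p)" "r1 \<cdot> t = r1 \<cdot> q"
      using reflexive_relation_euclidean[OF r jm e comp_in_hom[OF T(1) s(1)] T(2)] by blast
    with \<open>r1 \<cdot> (s \<cdot> p) = r0 \<cdot> p\<close> have "\<guillemotleft>t : T \<rightarrow> S\<guillemotright>" "r0 \<cdot> t = r0 \<cdot> p" "r1 \<cdot> t = r1 \<cdot> q" by simp_all
    then show ?thesis using T(4) by blast
  qed
  have d: "Dom C r0 = S" "Dom C r1 = S" "Cod C r0 = X" using r by (simp_all add: hom_def)
  have "internal_equivalence_relation C X r0 r1"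
    unfolding internal_equivalence_relation_def d
    using r jm e s(1) s' trans by (intro conjI) blast+
  then obtain f where f: "kernel_pair C f r0 r1"
    using semi_abelian unfolding semi_abelian_def barr_exact_def by blast
  then obtain q where q: "is_coequalizer C r0 r1 q"
    using semi_abelian unfolding semi_abelian_def barr_exact_def regular_category_def by blast
  define Q where "Q = Cod C q"
  have qt: "\<guillemotleft>q : X \<rightarrow> Q\<guillemotright>" "q \<cdot> r0 = q \<cdot> r1"
    using q d unfolding is_coequalizer_def Q_def by simp_all
  have ft: "\<guillemotleft>f : X \<rightarrow> Cod C f\<guillemotright>" "f \<cdot> r0 = f \<cdot> r1"
    using pullbackD[OF f] d by (simp_all add: hom_def)
  \<comment> \<open>\<open>f\<close> factors through \<open>q\<close>, so whatever \<open>q\<close>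
    merges is merged by \<open>f\<close> and therefore lies in the relation.\<close>
  obtain g where g: "\<guillemotleft>g : Q \<rightarrow> Cod C f\<guillemotright>" "g \<cdot> q = f" using coequalizer_lift[OF q r(1) qt(1) ft] .
  have "kernel_pair C q r0 r1"
  proof (rule pullbackI[OF qt(1,1) r qt(2)])
    fix Z x y assume xy: "\<guillemotleft>x : Z \<rightarrow> X\<guillemotright>" "\<guillemotleft>y : Z \<rightarrow> X\<guillemotright>" "q \<cdot> x = q \<cdot> y"
    then have "g \<cdot> (q \<cdot> x) = g \<cdot> (q \<cdot> y)" by simp
    then have "f \<cdot> x = f \<cdot> y" using xy(1,2) qt(1) g(1) by (simp add: hom_def reassoc[OF g(2)])
    then show "\<exists>h. \<guillemotleft>h : Z \<rightarrow> S\<guillemotright> \<and> r0 \<cdot> h = x \<and> r1 \<cdot> h = y"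
      using pullback_lift[OF f r xy(1,2)] by blast
  qed (use jm in blast)
  then show thesis using that q qt(1) by blast
qed

section \<open>Internal abelian groups\<close>

text \<open>Evaluates the definite description in terms of which the laws of
  \<open>internal_abelian_group\<close> are phrased.\<close>

lemma pairing_eq:
  assumes "is_product C A B p q" "\<guillemotleft>p : P \<rightarrow> A\<guillemotright>" "\<guillemotleft>q : P \<rightarrow> B\<guillemotright>" "\<guillemotleft>h : Z \<rightarrow> P\<guillemotright>" "p \<cdot> h = x" "q \<cdot> h = y"
  shows "pairing C p q x y = h"
  unfolding pairing_def
proof (rule the_equality)
  have d: "Dom C x = Z" "Dom C p = P" using assms(2,4,5) by (auto simp: hom_def)
  show "h \<in> hom C (Dom C x) (Dom C p) \<and> p \<cdot> h = x \<and> q \<cdot> h = y" using assms d by simp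
  show "h' = h" if "h' \<in> hom C (Dom C x) (Dom C p) \<and> p \<cdot> h' = x \<and> q \<cdot> h' = y" for h'
    using product_unique[OF assms(1-3), of h' Z h] that d assms by simp
qed

lemma product_inclusion_kernel:
  assumes pr: "is_product C A B p q" "\<guillemotleft>p : P \<rightarrow> A\<guillemotright>" "\<guillemotleft>q : P \<rightarrow> B\<guillemotright>"
    and i: "\<guillemotleft>i : B \<rightarrow> P\<guillemotright>" "p \<cdot> i = zmap B A" "q \<cdot> i = idt B"
  shows "is_kernel C i p"
proof (rule kernelI[OF pr(2) i(1,2) split_mono[OF i(1) pr(3) i(3)]])
  fix Z x assume x: "\<guillemotleft>x : Z \<rightarrow> P\<guillemotright>" "p \<cdot> x = zmap Z A"
  have A: "A \<in> Ob C" using in_hom_ob(2)[OF pr(2)] .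
  have "i \<cdot> (q \<cdot> x) = x"
    by (rule product_unique[OF pr _ x(1)])
      (use x pr(2,3) i(1) A in \<open>simp_all add: hom_def reassoc[OF i(2)] reassoc[OF i(3)]\<close>)
  then show "\<exists>h. \<guillemotleft>h : Z \<rightarrow> B\<guillemotright> \<and> i \<cdot> h = x" using comp_in_hom[OF x(1) pr(3)] by blast
qed

text \<open>A magma with unit \<open>0\<close> is automatically an abelian group: all identities can be checked on the
  two inclusions of the factors of a product, which are jointly epic, and
  \<open>(a, b) \<mapsto> (a, m (a, b))\<close> is invertible because it is so on the kernels of the first projections.\<close>

lemma unital_magma_abelian:
  assumes pr: "is_product C A A p q" "\<guillemotleft>p : P \<rightarrow> A\<guillemotright>" "\<guillemotleft>q : P \<rightarrow> A\<guillemotright>"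
    and i1: "\<guillemotleft>i1 : A \<rightarrow> P\<guillemotright>" "p \<cdot> i1 = idt A" "q \<cdot> i1 = zmap A A"
    and i2: "\<guillemotleft>i2 : A \<rightarrow> P\<guillemotright>" "p \<cdot> i2 = zmap A A" "q \<cdot> i2 = idt A"
    and m: "\<guillemotleft>m : P \<rightarrow> A\<guillemotright>" "m \<cdot> i1 = idt A" "m \<cdot> i2 = idt A"
  shows "A \<in> Ab C"
proof -
  have ob: "A \<in> Ob C" "P \<in> Ob C" using in_hom_ob[OF m(1)] by auto
  obtain Z where Z: "zero_obj C Z" "Z \<in> Ob C" using zero_obj_ex .
  obtain Q r z where pr': "is_product C P A r z" and rz: "\<guillemotleft>r : Q \<rightarrow> P\<guillemotright>" "\<guillemotleft>z : Q \<rightarrow> A\<guillemotright>"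
    using product_ex[OF ob(2,1)] .
  note ty = pr(2,3) i1(1) i2(1) m(1) rz
  have zA: "\<guillemotleft>zmap A A : A \<rightarrow> A\<guillemotright>" "\<guillemotleft>zmap P A : P \<rightarrow> A\<guillemotright>" "\<guillemotleft>zmap A P : A \<rightarrow> P\<guillemotright>"
    using zmap_in_hom ob by auto
  note idA = ident_in_hom[OF ob(1)] and idP = ident_in_hom[OF ob(2)]
  have k2: "is_kernel C i2 p" using product_inclusion_kernel[OF pr i2] .
  have je: "f = g" if "\<guillemotleft>f : P \<rightarrow> A\<guillemotright>" "\<guillemotleft>g : P \<rightarrow> A\<guillemotright>" "f \<cdot> i1 = g \<cdot> i1" "f \<cdot> i2 = g \<cdot> i2" for f g
    using jointly_epic[OF pr(2) i1(1,2) k2 i2(1) that] .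
  obtain sw where sw: "\<guillemotleft>sw : P \<rightarrow> P\<guillemotright>" "p \<cdot> sw = q" "q \<cdot> sw = p" using product_lift[OF pr(1,2,3,2)] .
  have sw1: "sw \<cdot> i1 = i2" and sw2: "sw \<cdot> i2 = i1"
    by (rule product_unique[OF pr]; use ty sw i1 i2 in \<open>simp add: hom_def reassoc[OF sw(2)] reassoc[OF sw(3)]\<close>)+
  have comm: "m \<cdot> sw = m"
    by (rule je) (use ty sw m sw1 sw2 in \<open>simp_all add: hom_def\<close>)
  obtain h where h: "\<guillemotleft>h : P \<rightarrow> P\<guillemotright>" "p \<cdot> h = p" "q \<cdot> h = m" using product_lift[OF pr(1,2,2) m(1)] .
  have hi2: "i2 \<cdot> idt A = h \<cdot> i2"
    by (rule product_unique[OF pr]) (use ty h m i2 ob in \<open>simp_all add: hom_def reassoc[OF h(2)] reassoc[OF h(3)]\<close>)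
  have "p \<cdot> (h \<cdot> i1) = idt A" using ty h i1 by (simp add: hom_def reassoc[OF h(2)])
  then have "iso C h"
    using iso_of_iso_on_kernels[OF pr(2) i1(1,2) pr(2) comp_in_hom[OF i1(1) h(1)] _ h(1,2) _ k2 i2(1) k2 i2(1) iso_ident[OF ob(1)] idA hi2]
    by blast
  then obtain g where g: "\<guillemotleft>g : P \<rightarrow> P\<guillemotright>" "h \<cdot> g = idt P" using isoE[OF _ h(1)] by blast
  \<comment> \<open>The inverse of \<open>h\<close> sends \<open>(a, 0)\<close> to the pair
    \<open>(a, b)\<close> with \<open>m (a, b) = 0\<close>; its second component is the inverse of
    \<open>a\<close>.\<close>
  define i where "i = q \<cdot> (g \<cdot> i1)"
  have it: "\<guillemotleft>i : A \<rightarrow> A\<guillemotright>" unfolding i_def using ty g by (simp add: hom_def)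
  have "p \<cdot> (h \<cdot> g) = p" using g ty by (simp add: hom_def)
  then have pg: "p \<cdot> g = p" using ty h(1) g(1) by (simp add: hom_def reassoc[OF h(2)])
  have gi: "\<guillemotleft>g \<cdot> i1 : A \<rightarrow> P\<guillemotright>" "p \<cdot> (g \<cdot> i1) = idt A" "q \<cdot> (g \<cdot> i1) = i"
    using ty g(1) i1 i_def by (simp_all add: hom_def reassoc[OF pg])
  have "q \<cdot> (h \<cdot> (g \<cdot> i1)) = zmap A A" using ty h(1) g(1) i1 by (simp add: hom_def reassoc[OF g(2)])
  then have mgi: "m \<cdot> (g \<cdot> i1) = zmap A A" using ty h(1) g(1) by (simp add: hom_def reassoc[OF h(3)])
  have swgi: "\<guillemotleft>sw \<cdot> (g \<cdot> i1) : A \<rightarrow> P\<guillemotright>" "p \<cdot> (sw \<cdot> (g \<cdot> i1)) = i" "q \<cdot> (sw \<cdot> (g \<cdot> i1)) = idt A"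
    "m \<cdot> (sw \<cdot> (g \<cdot> i1)) = zmap A A"
    using ty sw g(1) gi(2,3) mgi
    by (simp_all add: hom_def reassoc[OF sw(2)] reassoc[OF sw(3)] reassoc[OF comm])
  \<comment> \<open>With \<open>m\<close> written as addition, \<open>a\<close>, \<open>b\<close>
    and \<open>c\<close> send \<open>((x, y), z)\<close> to \<open>(x + y, z)\<close>,
    \<open>(y, z)\<close> and \<open>(x, y + z)\<close>.\<close>
  obtain a where a: "\<guillemotleft>a : Q \<rightarrow> P\<guillemotright>" "p \<cdot> a = m \<cdot> r" "q \<cdot> a = z"
    using product_lift[OF pr(1,2) comp_in_hom[OF rz(1) m(1)] rz(2)] .
  obtain b where b: "\<guillemotleft>b : Q \<rightarrow> P\<guillemotright>" "p \<cdot> b = q \<cdot> r" "q \<cdot> b = z"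
    using product_lift[OF pr(1,2) comp_in_hom[OF rz(1) pr(3)] rz(2)] .
  obtain c where c: "\<guillemotleft>c : Q \<rightarrow> P\<guillemotright>" "p \<cdot> c = p \<cdot> r" "q \<cdot> c = m \<cdot> b"
    using product_lift[OF pr(1,2) comp_in_hom[OF rz(1) pr(2)] comp_in_hom[OF b(1) m(1)]] .
  \<comment> \<open>\<open>s\<close> and \<open>k\<close> are the inclusions of the factors of
    \<open>P \<times> A\<close>, on which associativity is tested.\<close>
  obtain s where s: "\<guillemotleft>s : P \<rightarrow> Q\<guillemotright>" "r \<cdot> s = idt P" "z \<cdot> s = zmap P A"
    using product_lift[OF pr' rz(1) idP zA(2)] .
  obtain k where k: "\<guillemotleft>k : A \<rightarrow> Q\<guillemotright>" "r \<cdot> k = zmap A P" "z \<cdot> k = idt A"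
    using product_lift[OF pr' rz(1) zA(3) idA] .
  have as: "a \<cdot> s = i1 \<cdot> m" and bs: "b \<cdot> s = i1 \<cdot> q"
    by (rule product_unique[OF pr]; use ty a b s i1 ob in
      \<open>simp add: hom_def reassoc[OF a(2)] reassoc[OF a(3)] reassoc[OF b(2)] reassoc[OF b(3)] reassoc[OF i1(2)] reassoc[OF i1(3)]\<close>)+
  have ak: "a \<cdot> k = i2" and bk: "b \<cdot> k = i2"
    by (rule product_unique[OF pr]; use ty a b k i2 ob in
      \<open>simp add: hom_def reassoc[OF a(2)] reassoc[OF a(3)] reassoc[OF b(2)] reassoc[OF b(3)]\<close>)+
  have cs: "c \<cdot> s = idt P"
    by (rule product_unique[OF pr]; use ty b(1) c s bs m(2) ob in
      \<open>simp add: hom_def reassoc[OF c(2)] reassoc[OF c(3)] reassoc[OF m(2)]\<close>)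
  have ck: "c \<cdot> k = i2"
    by (rule product_unique[OF pr]; use ty b(1) c k bk i2 m(3) ob in
      \<open>simp add: hom_def reassoc[OF c(2)] reassoc[OF c(3)]\<close>)
  have "m \<cdot> a = m \<cdot> c"
  proof (rule jointly_epic[OF rz(1) s(1,2) product_inclusion_kernel[OF pr' rz k] k(1)])
    show "(m \<cdot> a) \<cdot> s = (m \<cdot> c) \<cdot> s" "(m \<cdot> a) \<cdot> k = (m \<cdot> c) \<cdot> k"
      using ty a(1) c(1) s(1) k(1) by (simp_all add: hom_def as ak cs ck reassoc[OF m(2)])
  qed (use ty a(1) c(1) in \<open>simp_all add: hom_def\<close>)
  moreover have "pairing C p q (m \<cdot> r) z = a" "pairing C p q (q \<cdot> r) z = b" "pairing C p q (p \<cdot> r) (m \<cdot> b) = c"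
    using pairing_eq[OF pr a] pairing_eq[OF pr b] pairing_eq[OF pr c] .
  moreover have "pairing C p q (zmap A A) (idt A) = i2" "pairing C p q (idt A) (zmap A A) = i1"
    using pairing_eq[OF pr i2] pairing_eq[OF pr i1] .
  moreover have "pairing C p q (idt A) i = g \<cdot> i1" "pairing C p q i (idt A) = sw \<cdot> (g \<cdot> i1)" "pairing C p q q p = sw"
    using pairing_eq[OF pr gi] pairing_eq[OF pr swgi(1-3)] pairing_eq[OF pr sw] .
  moreover have "zmap Z A \<cdot> zmap A Z = zmap A A" using ob Z by simp
  moreover have "terminal_obj C Z" using Z(1) by (simp add: zero_obj_def)
  moreover have "Dom C p = P" using pr(2) by (simp add: hom_def)
  ultimately have "internal_abelian_group C A p q r z m (zmap Z A) Z (zmap A Z) i"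
    unfolding internal_abelian_group_def
    using pr pr' m it mgi swgi(4) comm zmap_in_hom[OF ob(1) Z(2)] zmap_in_hom[OF Z(2) ob(1)] by simp
  then show ?thesis unfolding Ab_def using ob(1) by blast
qed

text \<open>The identity is the zero map, so the diagonal serves as both inclusions and a projection
  as the multiplication.\<close>

lemma zero_obj_abelian:
  assumes "zero_obj C A"
  shows "A \<in> Ab C"
proof -
  have A: "A \<in> Ob C" using zero_obj_ob[OF assms] .
  have z: "idt A = zmap A A" using zero_obj_zmap(1)[OF assms ident_in_hom[OF A]] .
  obtain P p q where pr: "is_product C A A p q" "\<guillemotleft>p : P \<rightarrow> A\<guillemotright>" "\<guillemotleft>q : P \<rightarrow> A\<guillemotright>"
    using product_ex[OF A A] .
  obtain i where i: "\<guillemotleft>i : A \<rightarrow> P\<guillemotright>" "p \<cdot> i = idt A" "q \<cdot> i = idt A"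
    using product_lift[OF pr(1,2) ident_in_hom[OF A] ident_in_hom[OF A]] .
  show ?thesis using unital_magma_abelian[OF pr i(1,2) _ i(1) _ i(3) pr(2) i(2,2)] i(2,3) z by simp
qed

text \<open>Replaces the difference \<open>b1 - b0\<close>, which is only available up to applying \<open>f\<close> and passing to a
  cover: in the object of pairs \<open>(b0, b1)\<close> with \<open>g b0 = g b1\<close> and \<open>f b0 = 0\<close>, those for which \<open>f b1\<close>
  lies in the image of \<open>ker g\<close> contain the diagonal and the pairs with \<open>b0 = 0\<close>.\<close>

lemma local_difference:
  assumes g: "\<guillemotleft>g : B \<rightarrow> D\<guillemotright>" and f: "\<guillemotleft>f : B \<rightarrow> A\<guillemotright>"
    and b: "\<guillemotleft>b0 : W \<rightarrow> B\<guillemotright>" "\<guillemotleft>b1 : W \<rightarrow> B\<guillemotright>" "g \<cdot> b0 = g \<cdot> b1" "f \<cdot> b0 = zmap W A"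
  obtains Y z y where "regular_epi C z" "\<guillemotleft>z : Y \<rightarrow> W\<guillemotright>" "\<guillemotleft>y : Y \<rightarrow> B\<guillemotright>" "g \<cdot> y = zmap Y D" "f \<cdot> y = f \<cdot> (b1 \<cdot> z)"
proof -
  have ob: "A \<in> Ob C" "B \<in> Ob C" "D \<in> Ob C" using f g in_hom_ob by blast+
  obtain E e0 e1 d where e: "kernel_pair C g e0 e1" "\<guillemotleft>e0 : E \<rightarrow> B\<guillemotright>" "\<guillemotleft>e1 : E \<rightarrow> B\<guillemotright>" "g \<cdot> e0 = g \<cdot> e1"
    and d: "\<guillemotleft>d : B \<rightarrow> E\<guillemotright>" "e0 \<cdot> d = idt B" "e1 \<cdot> d = idt B"
    using kernel_pair_ex[OF g] .
  obtain K k where k: "is_kernel C k g" "\<guillemotleft>k : K \<rightarrow> B\<guillemotright>" "g \<cdot> k = zmap K D" using kernel_ex[OF g] .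
  obtain N n where n: "is_kernel C n f" "\<guillemotleft>n : N \<rightarrow> B\<guillemotright>" "f \<cdot> n = zmap N A" using kernel_ex[OF f] .
  obtain L l where l: "is_kernel C l (f \<cdot> e0)" "\<guillemotleft>l : L \<rightarrow> E\<guillemotright>" "(f \<cdot> e0) \<cdot> l = zmap L A"
    using kernel_ex[OF comp_in_hom[OF e(2) f]] .
  \<comment> \<open>\<open>M\<close> is the image of \<open>ker g\<close> under \<open>f\<close>,
    the subobject that \<open>f b1\<close> has to reach.\<close>
  obtain M \<epsilon> m where im: "regular_epi C \<epsilon>" "\<guillemotleft>\<epsilon> : K \<rightarrow> M\<guillemotright>" "monic C m" "\<guillemotleft>m : M \<rightarrow> A\<guillemotright>" "m \<cdot> \<epsilon> = f \<cdot> k"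
    using image[OF comp_in_hom[OF k(2) f]] .
  have ob': "K \<in> Ob C" "N \<in> Ob C" "L \<in> Ob C" "M \<in> Ob C" using k(2) n(2) l(2) im(4) in_hom_ob by blast+
  have "f \<cdot> (e0 \<cdot> l) = zmap L A" using l f e(2) by (simp add: hom_def)
  then obtain \<tau> where \<tau>: "\<guillemotleft>\<tau> : L \<rightarrow> N\<guillemotright>" "n \<cdot> \<tau> = e0 \<cdot> l"
    using kernel_lift[OF n(1) f n(2) comp_in_hom[OF l(2) e(2)]] by blast
  \<comment> \<open>Over \<open>N = ker f\<close> the object \<open>L\<close> of admissible pairs is
    split: \<open>\<tau>\<close> is the first coordinate and \<open>\<delta>\<close> the
    diagonal.\<close>
  have "(f \<cdot> e0) \<cdot> (d \<cdot> n) = zmap N A" using f e(2) d(1) n(2,3) by (simp add: hom_def reassoc[OF d(2)])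
  then obtain \<delta> where \<delta>: "\<guillemotleft>\<delta> : N \<rightarrow> L\<guillemotright>" "l \<cdot> \<delta> = d \<cdot> n"
    using kernel_lift[OF l(1) comp_in_hom[OF e(2) f] l(2) comp_in_hom[OF n(2) d(1)]] by blast
  have "n \<cdot> (\<tau> \<cdot> \<delta>) = n \<cdot> idt N"
    using n(2) \<tau>(1) \<delta> l(2) e(2) d(1) by (simp add: hom_def reassoc[OF \<tau>(2)] reassoc[OF d(2)])
  then have \<tau>\<delta>: "\<tau> \<cdot> \<delta> = idt N"
    using monic_cancel[OF kernel_monic[OF n(1)] n(2) comp_in_hom[OF \<delta>(1) \<tau>(1)] ident_in_hom[OF ob'(2)]] by simp
  obtain J \<kappa> where \<kappa>: "is_kernel C \<kappa> \<tau>" "\<guillemotleft>\<kappa> : J \<rightarrow> L\<guillemotright>" "\<tau> \<cdot> \<kappa> = zmap J N" using kernel_ex[OF \<tau>(1)] .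
  have J: "J \<in> Ob C" using in_hom_ob(1)[OF \<kappa>(2)] .
  have fel: "\<guillemotleft>f \<cdot> (e1 \<cdot> l) : L \<rightarrow> A\<guillemotright>" "\<guillemotleft>e1 \<cdot> (l \<cdot> \<kappa>) : J \<rightarrow> B\<guillemotright>" using f e(3) l(2) \<kappa>(2) by (simp_all add: hom_def)
  have "g \<cdot> (e1 \<cdot> (l \<cdot> \<kappa>)) = g \<cdot> (n \<cdot> (\<tau> \<cdot> \<kappa>))"
    using g e(2,3) l(2) \<kappa>(2) \<tau>(1) n(2) by (simp add: hom_def reassoc[OF e(4)[symmetric]] reassoc[OF \<tau>(2)])
  also have "\<dots> = zmap J D" using \<kappa>(3) g n(2) J ob' by (simp add: hom_def)
  finally obtain j where j: "\<guillemotleft>j : J \<rightarrow> K\<guillemotright>" "k \<cdot> j = e1 \<cdot> (l \<cdot> \<kappa>)"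
    using kernel_lift[OF k(1) g k(2) fel(2)] by blast
  \<comment> \<open>\<open>M'\<close> collects the pairs with \<open>f b1\<close> in
    \<open>M\<close>. On the diagonal \<open>f b1 = 0\<close>; on the kernel of
    \<open>\<tau>\<close> the coordinate \<open>b1\<close> itself lies in
    \<open>ker g\<close>.\<close>
  obtain M' m1 m2 where pb: "is_pullback C (f \<cdot> (e1 \<cdot> l)) m m1 m2" and m: "\<guillemotleft>m1 : M' \<rightarrow> L\<guillemotright>" "\<guillemotleft>m2 : M' \<rightarrow> M\<guillemotright>" "(f \<cdot> (e1 \<cdot> l)) \<cdot> m1 = m \<cdot> m2"
    using pullback_ex[OF fel(1) im(4)] .
  have "(f \<cdot> (e1 \<cdot> l)) \<cdot> \<delta> = m \<cdot> zmap N M"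
    using f e(3) l(2) \<delta> d(1) n(2,3) im(4) ob' by (simp add: hom_def reassoc[OF d(3)])
  then obtain s' where s': "\<guillemotleft>s' : N \<rightarrow> M'\<guillemotright>" "m1 \<cdot> s' = \<delta>"
    using pullback_lift[OF pb m(1,2) \<delta>(1) zmap_in_hom[OF ob'(2,4)]] by blast
  have "(f \<cdot> (e1 \<cdot> l)) \<cdot> \<kappa> = m \<cdot> (\<epsilon> \<cdot> j)"
    using f e(3) l(2) \<kappa>(2) im(2,4) j k(2) by (simp add: hom_def reassoc[OF im(5)])
  then obtain k' where k': "\<guillemotleft>k' : J \<rightarrow> M'\<guillemotright>" "m1 \<cdot> k' = \<kappa>"
    using pullback_lift[OF pb m(1,2) \<kappa>(2) comp_in_hom[OF j(1) im(2)]] by blast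
  have "iso C m1"
    using jointly_strongly_epic[OF \<tau>(1) \<delta>(1) \<tau>\<delta> \<kappa>(1,2) pullback_monic[OF pb im(3)] m(1) s' k'] .
  then obtain m1' where m1': "\<guillemotleft>m1' : L \<rightarrow> M'\<guillemotright>" "m1 \<cdot> m1' = idt L" using isoE[OF _ m(1)] by blast
  obtain w where w: "\<guillemotleft>w : W \<rightarrow> E\<guillemotright>" "e0 \<cdot> w = b0" "e1 \<cdot> w = b1" using pullback_lift[OF e(1-3) b(1-3)] .
  have "(f \<cdot> e0) \<cdot> w = zmap W A" using f e(2) w b(4) by (simp add: hom_def)
  then obtain w' where w': "\<guillemotleft>w' : W \<rightarrow> L\<guillemotright>" "l \<cdot> w' = w"
    using kernel_lift[OF l(1) comp_in_hom[OF e(2) f] l(2) w(1)] by blast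
  have "m \<cdot> (m2 \<cdot> (m1' \<cdot> w')) = (f \<cdot> (e1 \<cdot> l)) \<cdot> w'"
    using fel(1) m(1,2) m1'(1) w'(1) im(4) by (simp only: hom_def mem_Collect_eq) (simp add: reassoc[OF m(3)[symmetric]] reassoc[OF m1'(2)])
  also have "\<dots> = f \<cdot> b1" using f e(3) l(2) w w' by (simp add: hom_def)
  finally have mb: "m \<cdot> (m2 \<cdot> (m1' \<cdot> w')) = f \<cdot> b1" .
  have t: "\<guillemotleft>m2 \<cdot> (m1' \<cdot> w') : W \<rightarrow> M\<guillemotright>" using m(2) m1'(1) w'(1) by (simp add: hom_def)
  obtain Y z y where z: "regular_epi C z" "\<guillemotleft>z : Y \<rightarrow> W\<guillemotright>" "\<guillemotleft>y : Y \<rightarrow> K\<guillemotright>" "\<epsilon> \<cdot> y = (m2 \<cdot> (m1' \<cdot> w')) \<cdot> z"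
    using cover[OF im(1,2) t] .
  have "f \<cdot> (k \<cdot> y) = m \<cdot> (\<epsilon> \<cdot> y)" using f k(2) z(3) im(2,4) by (simp add: hom_def reassoc[OF im(5)])
  also have "\<dots> = (m \<cdot> (m2 \<cdot> (m1' \<cdot> w'))) \<cdot> z" unfolding z(4) using im(4) t z(2) by (simp only: hom_def mem_Collect_eq) (simp del: comp_assoc_arr add: comp_assoc_arr[symmetric])
  also have "\<dots> = f \<cdot> (b1 \<cdot> z)" unfolding mb using f b(2) z(2) by (simp add: hom_def)
  finally have "f \<cdot> (k \<cdot> y) = f \<cdot> (b1 \<cdot> z)" .
  moreover have "g \<cdot> (k \<cdot> y) = zmap Y D" using g k(2) z(3) ob by (simp add: hom_def reassoc[OF k(3)])
  ultimately show thesis using that[OF z(1,2) comp_in_hom[OF z(3) k(2)]] by blast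
qed

end


section \<open>Birkhoff subcategories and central extensions\<close>

locale birkhoff_reflector = semi_abelian_cat C for C :: "('o, 'a) cat" (structure) +
  fixes X :: "'o set" and I :: "('o, 'a) reflector"
  assumes birkhoff: "birkhoff_subcategory C X" and reflector: "is_reflector C X I"
begin

abbreviation \<eta> :: "'o \<Rightarrow> 'a" where "\<eta> \<equiv> Runit I"
abbreviation R\<^sub>o :: "'o \<Rightarrow> 'o" where "R\<^sub>o \<equiv> Rob I"

section \<open>The unit and generalized elements of \<open>[A, A]\<close>\<close>

lemma unit_in_hom: "A \<in> Ob C \<Longrightarrow> \<guillemotleft>\<eta> A : A \<rightarrow> R\<^sub>o A\<guillemotright>"
  and unit_reflection: "A \<in> Ob C \<Longrightarrow> is_reflection C X A (\<eta> A)"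
  and Rob_in: "A \<in> Ob C \<Longrightarrow> R\<^sub>o A \<in> X"
  using reflector unfolding is_reflector_def by simp_all

lemma Rob_ob [simp]: "A \<in> Ob C \<Longrightarrow> R\<^sub>o A \<in> Ob C"
  using in_hom_ob(2)[OF unit_in_hom] .

lemma unit_arr [simp]:
  assumes "A \<in> Ob C" shows "\<eta> A \<in> Ar C" "Dom C (\<eta> A) = A" "Cod C (\<eta> A) = R\<^sub>o A"
  using unit_in_hom[OF assms] by (simp_all add: hom_def)

lemma Rar_in_hom: "\<guillemotleft>f : A \<rightarrow> B\<guillemotright> \<Longrightarrow> \<guillemotleft>Rar I f : R\<^sub>o A \<rightarrow> R\<^sub>o B\<guillemotright>"
  and unit_natural: "\<guillemotleft>f : A \<rightarrow> B\<guillemotright> \<Longrightarrow> Rar I f \<cdot> \<eta> A = \<eta> B \<cdot> f"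
  using reflector unfolding is_reflector_def hom_def by auto

lemma Rar_comp: "\<guillemotleft>f : A \<rightarrow> B\<guillemotright> \<Longrightarrow> \<guillemotleft>g : B \<rightarrow> D\<guillemotright> \<Longrightarrow> Rar I (g \<cdot> f) = Rar I g \<cdot> Rar I f"
  and Rar_ident: "A \<in> Ob C \<Longrightarrow> Rar I (idt A) = idt (R\<^sub>o A)"
  using reflector unfolding is_reflector_def hom_def by auto

lemma unit_factor:
  assumes "\<guillemotleft>g : A \<rightarrow> Y\<guillemotright>" "Y \<in> X"
  obtains h where "\<guillemotleft>h : R\<^sub>o A \<rightarrow> Y\<guillemotright>" "h \<cdot> \<eta> A = g"
proof -
  have A: "A \<in> Ob C" using in_hom_ob(1)[OF assms(1)] .
  show thesis
    using unit_reflection[OF A] that assms unit_arr(3)[OF A] unfolding is_reflection_def by metis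
qed

text \<open>By closure under subobjects the image of the unit lies in \<open>X\<close>, so the unit
  factors through it universally; this gives a section of the monic part.\<close>

lemma unit_regular_epi:
  assumes A: "A \<in> Ob C"
  shows "regular_epi C (\<eta> A)"
proof -
  obtain M e m where im: "regular_epi C e" "\<guillemotleft>e : A \<rightarrow> M\<guillemotright>" "monic C m" "\<guillemotleft>m : M \<rightarrow> R\<^sub>o A\<guillemotright>" "m \<cdot> e = \<eta> A"
    using image[OF unit_in_hom[OF A]] .
  have "Cod C m \<in> X" "Dom C m = M" using im(4) Rob_in[OF A] by (simp_all add: hom_def)
  then have "M \<in> X" using birkhoff im(3) unfolding birkhoff_subcategory_def by metis
  then obtain h where h: "\<guillemotleft>h : R\<^sub>o A \<rightarrow> M\<guillemotright>" "h \<cdot> \<eta> A = e" using unit_factor[OF im(2)] by blast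
  have "(m \<cdot> h) \<cdot> \<eta> A = idt (R\<^sub>o A) \<cdot> \<eta> A" using h im(4,5) A by (simp add: hom_def)
  moreover have "\<exists>!k. k \<in> hom C (R\<^sub>o A) (R\<^sub>o A) \<and> k \<cdot> \<eta> A = \<eta> A"
    using unit_reflection[OF A] Rob_in[OF A] unit_in_hom[OF A] unit_arr(3)[OF A]
    unfolding is_reflection_def by metis
  moreover have "\<guillemotleft>m \<cdot> h : R\<^sub>o A \<rightarrow> R\<^sub>o A\<guillemotright>" "\<guillemotleft>idt (R\<^sub>o A) : R\<^sub>o A \<rightarrow> R\<^sub>o A\<guillemotright>" "idt (R\<^sub>o A) \<cdot> \<eta> A = \<eta> A"
    using h(1) im(4) A by (simp_all add: hom_def)
  ultimately have "m \<cdot> h = idt (R\<^sub>o A)" by metis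
  then have "iso C m" using monic_split_epi_iso[OF im(3,4) h(1)] by blast
  then show ?thesis
    using regular_epi_comp[OF im(1) iso_regular_epi im(2,4)] im(4,5) by simp
qed

text \<open>The functoriality of \<open>[A, A]\<close>, expressed on elements.\<close>

lemma unit_zero_comp:
  assumes "\<guillemotleft>f : A \<rightarrow> B\<guillemotright>" "\<guillemotleft>x : Z \<rightarrow> A\<guillemotright>" "\<eta> A \<cdot> x = zmap Z (R\<^sub>o A)"
  shows "\<eta> B \<cdot> (f \<cdot> x) = zmap Z (R\<^sub>o B)"
proof -
  have "\<eta> B \<cdot> (f \<cdot> x) = Rar I f \<cdot> (\<eta> A \<cdot> x)"
    using assms(1,2) Rar_in_hom[OF assms(1)] in_hom_ob[OF assms(1)]
    by (simp add: hom_def reassoc[OF unit_natural[OF assms(1), symmetric]])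
  then show ?thesis using assms Rar_in_hom[OF assms(1)] in_hom_ob[OF assms(1)] in_hom_ob[OF assms(2)]
    by (simp add: hom_def)
qed

lemma unit_zero_to_X:
  assumes "\<guillemotleft>f : A \<rightarrow> Y\<guillemotright>" "Y \<in> X" "\<guillemotleft>x : Z \<rightarrow> A\<guillemotright>" "\<eta> A \<cdot> x = zmap Z (R\<^sub>o A)"
  shows "f \<cdot> x = zmap Z Y"
proof -
  obtain h where h: "\<guillemotleft>h : R\<^sub>o A \<rightarrow> Y\<guillemotright>" "h \<cdot> \<eta> A = f" using unit_factor[OF assms(1,2)] .
  have "h \<cdot> (\<eta> A \<cdot> x) = zmap Z Y" using assms(3,4) h(1) in_hom_ob[OF assms(3)] by (simp add: hom_def)
  then show ?thesis using h(1) assms(3) in_hom_ob[OF assms(3)] by (simp add: hom_def reassoc[OF h(2)])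
qed

lemma unit_zero_cover:
  assumes "regular_epi C z" "\<guillemotleft>z : W \<rightarrow> Z\<guillemotright>" "\<guillemotleft>x : Z \<rightarrow> A\<guillemotright>" "\<eta> A \<cdot> (x \<cdot> z) = zmap W (R\<^sub>o A)"
  shows "\<eta> A \<cdot> x = zmap Z (R\<^sub>o A)"
proof -
  have ob: "A \<in> Ob C" "Z \<in> Ob C" using in_hom_ob[OF assms(3)] by auto
  have "(\<eta> A \<cdot> x) \<cdot> z = zmap Z (R\<^sub>o A) \<cdot> z" using assms(2-4) ob by (simp add: hom_def)
  then show ?thesis
    using regular_epi_cancel[OF assms(1,2) comp_in_hom[OF assms(3) unit_in_hom[OF ob(1)]]]
      zmap_in_hom[OF ob(2) Rob_ob[OF ob(1)]] by blast
qed

text \<open>\<open>[f, f]\<close> is a regular epimorphism. The image in \<open>A \<times> A\<close> of the kernel pair of \<open>\<eta>\<^sub>B\<close> is the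
  kernel pair of a quotient of \<open>A\<close>, which lies in \<open>X\<close> because it is also a quotient of \<open>I(B)\<close>.\<close>

lemma unit_zero_lift:
  assumes f: "regular_epi C f" "\<guillemotleft>f : B \<rightarrow> A\<guillemotright>" and a: "\<guillemotleft>a : Z \<rightarrow> A\<guillemotright>" "\<eta> A \<cdot> a = zmap Z (R\<^sub>o A)"
  obtains W z b where "regular_epi C z" "\<guillemotleft>z : W \<rightarrow> Z\<guillemotright>" "\<guillemotleft>b : W \<rightarrow> B\<guillemotright>" "\<eta> B \<cdot> b = zmap W (R\<^sub>o B)" "f \<cdot> b = a \<cdot> z"
proof -
  have ob: "A \<in> Ob C" "B \<in> Ob C" "Z \<in> Ob C" using in_hom_ob f(2) a(1) by blast+
  note \<eta>B = unit_in_hom[OF ob(2)]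
  obtain E e0 e1 d where e: "kernel_pair C (\<eta> B) e0 e1" "\<guillemotleft>e0 : E \<rightarrow> B\<guillemotright>" "\<guillemotleft>e1 : E \<rightarrow> B\<guillemotright>" "\<eta> B \<cdot> e0 = \<eta> B \<cdot> e1"
    and d: "\<guillemotleft>d : B \<rightarrow> E\<guillemotright>" "e0 \<cdot> d = idt B" "e1 \<cdot> d = idt B"
    using kernel_pair_ex[OF \<eta>B] .
  obtain P p q where pr: "is_product C A A p q" and pq: "\<guillemotleft>p : P \<rightarrow> A\<guillemotright>" "\<guillemotleft>q : P \<rightarrow> A\<guillemotright>"
    using product_ex[OF ob(1,1)] .
  obtain \<phi> where \<phi>: "\<guillemotleft>\<phi> : E \<rightarrow> P\<guillemotright>" "p \<cdot> \<phi> = f \<cdot> e0" "q \<cdot> \<phi> = f \<cdot> e1"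
    using product_lift[OF pr pq(1) comp_in_hom[OF e(2) f(2)] comp_in_hom[OF e(3) f(2)]] .
  obtain S \<epsilon> \<mu> where im: "regular_epi C \<epsilon>" "\<guillemotleft>\<epsilon> : E \<rightarrow> S\<guillemotright>" "monic C \<mu>" "\<guillemotleft>\<mu> : S \<rightarrow> P\<guillemotright>" "\<mu> \<cdot> \<epsilon> = \<phi>"
    using image[OF \<phi>(1)] .
  obtain \<Delta> where \<Delta>: "\<guillemotleft>\<Delta> : A \<rightarrow> P\<guillemotright>" "p \<cdot> \<Delta> = idt A" "q \<cdot> \<Delta> = idt A"
    using product_lift[OF pr pq(1) ident_in_hom[OF ob(1)] ident_in_hom[OF ob(1)]] .
  have "\<phi> \<cdot> d = \<Delta> \<cdot> f"
    by (rule product_unique[OF pr pq])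
      (use f(2) pq \<phi>(1) \<Delta>(1) d e(2,3) in \<open>simp_all add: hom_def reassoc[OF \<phi>(2)] reassoc[OF \<phi>(3)] reassoc[OF \<Delta>(2)] reassoc[OF \<Delta>(3)]\<close>)
  \<comment> \<open>Reflexivity of \<open>S\<close>: the diagonal of \<open>B\<close> maps into
    \<open>S\<close>, and descends along the regular epimorphism \<open>f\<close>.\<close>
  then have "\<mu> \<cdot> (\<epsilon> \<cdot> d) = \<Delta> \<cdot> f" using im(2,4) d(1) by (simp add: hom_def reassoc[OF im(5)])
  then obtain r where r: "\<guillemotleft>r : A \<rightarrow> S\<guillemotright>" "\<mu> \<cdot> r = \<Delta>"
    using regular_epi_diagonal[OF f im(3,4) comp_in_hom[OF d(1) im(2)] \<Delta>(1)] by blast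
  have s: "\<guillemotleft>p \<cdot> \<mu> : S \<rightarrow> A\<guillemotright>" "\<guillemotleft>q \<cdot> \<mu> : S \<rightarrow> A\<guillemotright>" using pq im(4) by auto
  have sr: "(p \<cdot> \<mu>) \<cdot> r = idt A" "(q \<cdot> \<mu>) \<cdot> r = idt A" using pq im(4) r \<Delta> by (simp_all add: hom_def)
  have jm: "\<forall>Z x y. \<guillemotleft>x : Z \<rightarrow> S\<guillemotright> \<longrightarrow> \<guillemotleft>y : Z \<rightarrow> S\<guillemotright> \<longrightarrow> (p \<cdot> \<mu>) \<cdot> x = (p \<cdot> \<mu>) \<cdot> y \<longrightarrow> (q \<cdot> \<mu>) \<cdot> x = (q \<cdot> \<mu>) \<cdot> y \<longrightarrow> x = y"
  proof (intro allI impI)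
    fix Z x y assume xy: "\<guillemotleft>x : Z \<rightarrow> S\<guillemotright>" "\<guillemotleft>y : Z \<rightarrow> S\<guillemotright>" "(p \<cdot> \<mu>) \<cdot> x = (p \<cdot> \<mu>) \<cdot> y" "(q \<cdot> \<mu>) \<cdot> x = (q \<cdot> \<mu>) \<cdot> y"
    have "\<mu> \<cdot> x = \<mu> \<cdot> y"
      by (rule product_unique[OF pr pq comp_in_hom[OF xy(1) im(4)] comp_in_hom[OF xy(2) im(4)]])
        (use xy pq im(4) in \<open>simp_all add: hom_def\<close>)
    then show "x = y" using monic_cancel[OF im(3,4) xy(1,2)] by simp
  qed
  obtain Q g where g: "is_coequalizer C (p \<cdot> \<mu>) (q \<cdot> \<mu>) g" "kernel_pair C g (p \<cdot> \<mu>) (q \<cdot> \<mu>)" "\<guillemotleft>g : A \<rightarrow> Q\<guillemotright>"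
    using reflexive_relation_effective[OF s jm r(1) sr] .
  have gr: "regular_epi C g" using g(1) unfolding regular_epi_def by blast
  have gs: "g \<cdot> (p \<cdot> \<mu>) = g \<cdot> (q \<cdot> \<mu>)" using pullbackD(7)[OF g(2)] .
  have "(g \<cdot> f) \<cdot> e0 = g \<cdot> (p \<cdot> (\<mu> \<cdot> \<epsilon>))" using g(3) f(2) e(2) \<phi>(2) im(5) by (simp add: hom_def)
  also have "\<dots> = g \<cdot> (q \<cdot> (\<mu> \<cdot> \<epsilon>))"
    using g(3) pq im(2,4) reassoc[OF gs, of \<epsilon>] by (simp add: hom_def)
  also have "\<dots> = (g \<cdot> f) \<cdot> e1" using g(3) f(2) e(3) \<phi>(3) im(5) by (simp add: hom_def)
  finally obtain h where h: "\<guillemotleft>h : R\<^sub>o B \<rightarrow> Q\<guillemotright>" "h \<cdot> \<eta> B = g \<cdot> f"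
    using regular_epi_kernel_pair_lift[OF unit_regular_epi[OF ob(2)] \<eta>B e(1-3) comp_in_hom[OF f(2) g(3)]] by blast
  have "regular_epi C h"
    using regular_epi_comp_cancel[OF _ \<eta>B h(1)] regular_epi_comp[OF f(1) gr f(2) g(3)] h(2) by simp
  moreover have "Dom C h \<in> X" "Cod C h = Q" using h(1) Rob_in[OF ob(2)] by (simp_all add: hom_def)
  ultimately have "Q \<in> X" using birkhoff unfolding birkhoff_subcategory_def by metis
  \<comment> \<open>An arrow into \<open>X\<close> kills \<open>a\<close>, so \<open>(0, a)\<close>
    lies in the kernel pair \<open>S\<close> of \<open>g\<close>. On a cover it comes from a pair
    \<open>(b0, b1)\<close> in \<open>E\<close>.\<close>
  then have "g \<cdot> a = zmap Z Q" using unit_zero_to_X[OF g(3) _ a] by blast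
  then have "g \<cdot> zmap Z A = g \<cdot> a" using g(3) ob by (simp add: hom_def)
  then obtain \<sigma> where \<sigma>: "\<guillemotleft>\<sigma> : Z \<rightarrow> S\<guillemotright>" "(p \<cdot> \<mu>) \<cdot> \<sigma> = zmap Z A" "(q \<cdot> \<mu>) \<cdot> \<sigma> = a"
    using pullback_lift[OF g(2) s zmap_in_hom[OF ob(3,1)] a(1)] by blast
  obtain W z w where z: "regular_epi C z" "\<guillemotleft>z : W \<rightarrow> Z\<guillemotright>" "\<guillemotleft>w : W \<rightarrow> E\<guillemotright>" "\<epsilon> \<cdot> w = \<sigma> \<cdot> z"
    using cover[OF im(1,2) \<sigma>(1)] .
  have \<phi>w: "\<phi> \<cdot> w = \<mu> \<cdot> (\<sigma> \<cdot> z)"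
    using z(2,3) im(2,4) \<sigma>(1) by (simp add: hom_def im(5)[symmetric] z(4))
  have W: "W \<in> Ob C" using in_hom_ob(1)[OF z(2)] .
  have "f \<cdot> (e0 \<cdot> w) = p \<cdot> (\<phi> \<cdot> w)" "f \<cdot> (e1 \<cdot> w) = q \<cdot> (\<phi> \<cdot> w)"
    using f(2) e(2,3) z(3) pq \<phi>(1) by (simp_all add: hom_def reassoc[OF \<phi>(2)] reassoc[OF \<phi>(3)])
  moreover have "p \<cdot> (\<mu> \<cdot> (\<sigma> \<cdot> z)) = ((p \<cdot> \<mu>) \<cdot> \<sigma>) \<cdot> z" "q \<cdot> (\<mu> \<cdot> (\<sigma> \<cdot> z)) = ((q \<cdot> \<mu>) \<cdot> \<sigma>) \<cdot> z"
    using pq im(4) \<sigma>(1) z(2) by (simp_all add: hom_def)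
  ultimately have fe: "f \<cdot> (e0 \<cdot> w) = zmap W A" "f \<cdot> (e1 \<cdot> w) = a \<cdot> z"
    unfolding \<phi>w \<sigma>(2,3) using z(2) ob by (simp_all add: hom_def)
  have "\<eta> B \<cdot> (e0 \<cdot> w) = \<eta> B \<cdot> (e1 \<cdot> w)" using e(2,3) z(3) ob by (simp add: hom_def reassoc[OF e(4)])
  \<comment> \<open>Only \<open>f b0 = 0\<close> is known, not \<open>b0 = 0\<close>; the local
    difference of \<open>b1\<close> and \<open>b0\<close> lies in \<open>[B, B]\<close> and has the
    required image.\<close>
  then obtain Y z' y where y: "regular_epi C z'" "\<guillemotleft>z' : Y \<rightarrow> W\<guillemotright>" "\<guillemotleft>y : Y \<rightarrow> B\<guillemotright>" "\<eta> B \<cdot> y = zmap Y (R\<^sub>o B)"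
    "f \<cdot> y = f \<cdot> ((e1 \<cdot> w) \<cdot> z')"
    using local_difference[OF \<eta>B f(2) comp_in_hom[OF z(3) e(2)] comp_in_hom[OF z(3) e(3)] _ fe(1)] by blast
  have "f \<cdot> ((e1 \<cdot> w) \<cdot> z') = (f \<cdot> (e1 \<cdot> w)) \<cdot> z'" using f(2) e(3) z(3) y(2) by (simp add: hom_def)
  then have "f \<cdot> y = a \<cdot> (z \<cdot> z')" unfolding y(5) fe(2) using a(1) z(2) y(2) by (simp add: hom_def)
  then show thesis
    using that[OF regular_epi_comp[OF y(1) z(1) y(2) z(2)] comp_in_hom[OF y(2) z(2)] y(3,4)] by simp
qed

text \<open>For an extension \<open>f : B \<rightarrow> A\<close> this says that the kernel pair projections agree on \<open>[R, R]\<close>, where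
  \<open>R = B \<times>\<^sub>A B\<close>; equivalently, \<open>[K, B]\<close> vanishes.\<close>

definition unit_central :: "'a \<Rightarrow> bool" where
  "unit_central f \<longleftrightarrow> (\<forall>T a b Z x. \<guillemotleft>a : T \<rightarrow> Dom C f\<guillemotright> \<longrightarrow> \<guillemotleft>b : T \<rightarrow> Dom C f\<guillemotright> \<longrightarrow> f \<cdot> a = f \<cdot> b \<longrightarrow>
    \<guillemotleft>x : Z \<rightarrow> T\<guillemotright> \<longrightarrow> \<eta> T \<cdot> x = zmap Z (R\<^sub>o T) \<longrightarrow> a \<cdot> x = b \<cdot> x)"

lemma unit_centralD:
  assumes "unit_central f" "\<guillemotleft>f : B \<rightarrow> A\<guillemotright>" "\<guillemotleft>a : T \<rightarrow> B\<guillemotright>" "\<guillemotleft>b : T \<rightarrow> B\<guillemotright>" "f \<cdot> a = f \<cdot> b"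
    and "\<guillemotleft>x : Z \<rightarrow> T\<guillemotright>" "\<eta> T \<cdot> x = zmap Z (R\<^sub>o T)"
  shows "a \<cdot> x = b \<cdot> x"
proof -
  have "Dom C f = B" using assms(2) by (simp add: hom_def)
  then show ?thesis using assms unfolding unit_central_def by blast
qed

lemma unit_centralI:
  assumes "\<guillemotleft>f : B \<rightarrow> A\<guillemotright>"
    and "\<And>T a b Z x. \<guillemotleft>a : T \<rightarrow> B\<guillemotright> \<Longrightarrow> \<guillemotleft>b : T \<rightarrow> B\<guillemotright> \<Longrightarrow> f \<cdot> a = f \<cdot> b \<Longrightarrow>
      \<guillemotleft>x : Z \<rightarrow> T\<guillemotright> \<Longrightarrow> \<eta> T \<cdot> x = zmap Z (R\<^sub>o T) \<Longrightarrow> a \<cdot> x = b \<cdot> x"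
  shows "unit_central f"
proof -
  have "Dom C f = B" using assms(1) by (simp add: hom_def)
  then show ?thesis unfolding unit_central_def using assms(2) by metis
qed

text \<open>Allowing any \<open>Y\<close> inside \<open>X\<close> covers \<open>Ab C\<close> as
  well. After a cover both arrows lift to \<open>P\<close> with the same component in
  \<open>G\<close>. Their components in \<open>L\<close> cannot distinguish elements of
  \<open>[S, S]\<close>, since \<open>L\<close> lies in \<open>X\<close>, and the two components are
  jointly monic because \<open>p\<close> is trivial.\<close>

lemma central_extension_unit_central:
  assumes c: "central_extension C Y f" and Y: "Y \<subseteq> X"
  shows "unit_central f"
proof -
  obtain g p q where g: "regular_epi C g" and pb: "is_pullback C g f p q" and p: "trivial_extension C Y p"
    using c unfolding central_extension_def by blast
  obtain eB eA h where eB: "is_reflection C Y (Dom C p) eB" and pb': "is_pullback C h eA eB p"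
    using p unfolding trivial_extension_def by blast
  define B A G P where "B = Dom C f" "A = Cod C f" "G = Dom C g" "P = Dom C p"
  have ft: "\<guillemotleft>f : B \<rightarrow> A\<guillemotright>" and gt: "\<guillemotleft>g : G \<rightarrow> A\<guillemotright>" and pt: "\<guillemotleft>p : P \<rightarrow> G\<guillemotright>" and qt: "\<guillemotleft>q : P \<rightarrow> B\<guillemotright>"
    and sq: "g \<cdot> p = f \<cdot> q"
    using pullbackD[OF pb] unfolding B_A_G_P_def by (simp_all add: hom_def)
  define L where "L = Cod C eB"
  have et: "\<guillemotleft>eB : P \<rightarrow> L\<guillemotright>" and L: "L \<in> X"
    using eB Y unfolding is_reflection_def L_def B_A_G_P_def by auto
  show ?thesis
  proof (rule unit_centralI[OF ft])
    fix T a b Z x assume ab: "\<guillemotleft>a : T \<rightarrow> B\<guillemotright>" "\<guillemotleft>b : T \<rightarrow> B\<guillemotright>" "f \<cdot> a = f \<cdot> b"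
      and x: "\<guillemotleft>x : Z \<rightarrow> T\<guillemotright>" "\<eta> T \<cdot> x = zmap Z (R\<^sub>o T)"
    \<comment> \<open>\<open>S\<close> is the cover of \<open>T\<close> on which the common value
      \<open>f \<cdot> a = f \<cdot> b\<close> lifts along \<open>g\<close>.\<close>
    obtain S \<gamma> t where S: "is_pullback C g (f \<cdot> a) \<gamma> t" and \<gamma>: "\<guillemotleft>\<gamma> : S \<rightarrow> G\<guillemotright>" "\<guillemotleft>t : S \<rightarrow> T\<guillemotright>" "g \<cdot> \<gamma> = (f \<cdot> a) \<cdot> t"
      using pullback_ex[OF gt comp_in_hom[OF ab(1) ft]] .
    have tr: "regular_epi C t" using pullback_regular_epi(2)[OF S g] .
    have "g \<cdot> \<gamma> = f \<cdot> (a \<cdot> t)" "g \<cdot> \<gamma> = f \<cdot> (b \<cdot> t)"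
      unfolding \<gamma>(3) using ft ab(1,2) \<gamma>(2) by (simp_all add: hom_def reassoc[OF ab(3)])
    then obtain a' b' where a': "\<guillemotleft>a' : S \<rightarrow> P\<guillemotright>" "p \<cdot> a' = \<gamma>" "q \<cdot> a' = a \<cdot> t"
      and b': "\<guillemotleft>b' : S \<rightarrow> P\<guillemotright>" "p \<cdot> b' = \<gamma>" "q \<cdot> b' = b \<cdot> t"
      using pullback_lift[OF pb pt qt \<gamma>(1) comp_in_hom[OF \<gamma>(2) ab(1)]]
        pullback_lift[OF pb pt qt \<gamma>(1) comp_in_hom[OF \<gamma>(2) ab(2)]] by metis
    obtain W z w where z: "regular_epi C z" "\<guillemotleft>z : W \<rightarrow> Z\<guillemotright>" "\<guillemotleft>w : W \<rightarrow> S\<guillemotright>" "\<eta> S \<cdot> w = zmap W (R\<^sub>o S)" "t \<cdot> w = x \<cdot> z"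
      using unit_zero_lift[OF tr \<gamma>(2) x] .
    have "(eB \<cdot> a') \<cdot> w = (eB \<cdot> b') \<cdot> w"
      using unit_zero_to_X[OF comp_in_hom[OF a'(1) et] L z(3,4)] unit_zero_to_X[OF comp_in_hom[OF b'(1) et] L z(3,4)]
      by simp
    then have "eB \<cdot> (a' \<cdot> w) = eB \<cdot> (b' \<cdot> w)" using et a'(1) b'(1) z(3) by (simp add: hom_def)
    moreover have "p \<cdot> (a' \<cdot> w) = p \<cdot> (b' \<cdot> w)"
      using pt a'(1) b'(1) z(3) by (simp add: hom_def reassoc[OF a'(2)] reassoc[OF b'(2)])
    ultimately have "a' \<cdot> w = b' \<cdot> w"
      using pullback_unique[OF pb' et comp_in_hom[OF z(3) a'(1)] comp_in_hom[OF z(3) b'(1)]] by simp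
    then have "q \<cdot> (a' \<cdot> w) = q \<cdot> (b' \<cdot> w)" by simp
    then have "(a \<cdot> x) \<cdot> z = (b \<cdot> x) \<cdot> z"
      using qt ab(1,2) x(1) a'(1) b'(1) z(2,3) \<gamma>(2)
      by (simp add: hom_def reassoc[OF a'(3)] reassoc[OF b'(3)] z(5))
    then show "a \<cdot> x = b \<cdot> x"
      using regular_epi_cancel[OF z(1,2) comp_in_hom[OF x(1) ab(1)] comp_in_hom[OF x(1) ab(2)]] by simp
  qed
qed

text \<open>The comparison \<open>c\<close> from \<open>R\<close> to the pullback has zero kernel:
  an element of \<open>[R, R]\<close> with first coordinate 0 has second coordinate 0 by centrality.
  It is onto by the short five lemma over \<open>I(R)\<close>.\<close>

lemma unit_central_kernel_pair_trivial:
  assumes f: "\<guillemotleft>f : B \<rightarrow> A\<guillemotright>" "unit_central f"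
    and r: "kernel_pair C f r0 r1" "\<guillemotleft>r0 : R \<rightarrow> B\<guillemotright>" "\<guillemotleft>r1 : R \<rightarrow> B\<guillemotright>"
  shows "is_pullback C (Rar I r0) (\<eta> B) (\<eta> R) r0"
proof -
  have ob: "B \<in> Ob C" "R \<in> Ob C" using in_hom_ob[OF r(2)] by auto
  note \<eta>B = unit_in_hom[OF ob(1)] and \<eta>R = unit_in_hom[OF ob(2)] and Rr = Rar_in_hom[OF r(2)]
  have r3: "f \<cdot> r0 = f \<cdot> r1" using pullbackD(7)[OF r(1)] .
  obtain d where d: "\<guillemotleft>d : B \<rightarrow> R\<guillemotright>" "r0 \<cdot> d = idt B"
    using pullback_lift[OF r ident_in_hom[OF ob(1)] ident_in_hom[OF ob(1)]] by blast
  obtain W w0 w1 where W: "is_pullback C (Rar I r0) (\<eta> B) w0 w1" and w: "\<guillemotleft>w0 : W \<rightarrow> R\<^sub>o R\<guillemotright>" "\<guillemotleft>w1 : W \<rightarrow> B\<guillemotright>" "Rar I r0 \<cdot> w0 = \<eta> B \<cdot> w1"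
    using pullback_ex[OF Rr \<eta>B] .
  obtain c where c: "\<guillemotleft>c : R \<rightarrow> W\<guillemotright>" "w0 \<cdot> c = \<eta> R" "w1 \<cdot> c = r0"
    using pullback_lift[OF W w(1,2) \<eta>R r(2) unit_natural[OF r(2)]] .
  have "monic C c"
  proof (rule monic_of_zero_kernel[OF c(1)])
    fix Z x assume x: "\<guillemotleft>x : Z \<rightarrow> R\<guillemotright>" "c \<cdot> x = zmap Z W"
    have Z: "Z \<in> Ob C" using in_hom_ob(1)[OF x(1)] .
    have "w0 \<cdot> (c \<cdot> x) = zmap Z (R\<^sub>o R)" "w1 \<cdot> (c \<cdot> x) = zmap Z B" using x w Z by (simp_all add: hom_def)
    then have e: "\<eta> R \<cdot> x = zmap Z (R\<^sub>o R)" "r0 \<cdot> x = zmap Z B"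
      using x(1) c(1) w(1,2) by (simp_all add: hom_def reassoc[OF c(2)] reassoc[OF c(3)])
    have "r1 \<cdot> x = zmap Z B" using unit_centralD[OF f(2,1) r(2,3) r3 x(1) e(1)] e(2) by simp
    then show "x = zmap Z R"
      using pullback_unique[OF r(1,2) x(1) zmap_in_hom[OF Z ob(2)]] e(2) r(2,3) Z by (simp add: hom_def)
  qed
  moreover have "regular_epi C (w0 \<cdot> c)" using unit_regular_epi[OF ob(2)] c(2) by simp
  \<comment> \<open>An element of the kernel of \<open>w0\<close> amounts to an element
    \<open>b\<close> of \<open>[B, B]\<close>; the pair \<open>(b, b)\<close> lies in
    \<open>[R, R]\<close> and is its preimage.\<close>
  moreover have "\<exists>y. \<guillemotleft>y : Z \<rightarrow> R\<guillemotright> \<and> c \<cdot> y = x" if x: "\<guillemotleft>x : Z \<rightarrow> W\<guillemotright>" "w0 \<cdot> x = zmap Z (R\<^sub>o R)" for Z x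
  proof -
    have Z: "Z \<in> Ob C" using in_hom_ob(1)[OF x(1)] .
    have wx: "\<guillemotleft>w1 \<cdot> x : Z \<rightarrow> B\<guillemotright>" using x(1) w(2) by blast
    have dwx: "\<guillemotleft>d \<cdot> (w1 \<cdot> x) : Z \<rightarrow> R\<guillemotright>" using wx d(1) by blast
    have "\<eta> B \<cdot> (w1 \<cdot> x) = Rar I r0 \<cdot> (w0 \<cdot> x)"
      using x(1) w(1,2) Rr ob by (simp add: hom_def reassoc[OF w(3)])
    then have "\<eta> B \<cdot> (w1 \<cdot> x) = zmap Z (R\<^sub>o B)" using x(2) Rr Z ob by (simp add: hom_def)
    then have "\<eta> R \<cdot> (d \<cdot> (w1 \<cdot> x)) = zmap Z (R\<^sub>o R)" using unit_zero_comp[OF d(1) wx] by blast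
    then have "c \<cdot> (d \<cdot> (w1 \<cdot> x)) = x"
      by (intro pullback_unique[OF W w(1) comp_in_hom[OF dwx c(1)] x(1)])
        (use w(1,2) c(1) d x r(2) in \<open>simp_all add: hom_def reassoc[OF c(2)] reassoc[OF c(3)] reassoc[OF d(2)]\<close>)
    then show ?thesis using dwx by blast
  qed
  ultimately have "iso C c" using short_five[OF _ c(1) w(1)] by blast
  then show ?thesis using pullback_iso[OF W w(1,2) _ c(1)] c(2,3) by simp
qed

text \<open>The trivializing extension can be taken to be \<open>f\<close> itself, whose pullback
  along \<open>f\<close> is \<open>r0\<close>.\<close>

lemma unit_central_central_extension:
  assumes f: "regular_epi C f" "unit_central f"
  shows "central_extension C X f"
proof -
  have ft: "\<guillemotleft>f : Dom C f \<rightarrow> Cod C f\<guillemotright>" using regular_epi_arr[OF f(1)] by (simp add: hom_def)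
  obtain R r0 r1 d where r: "kernel_pair C f r0 r1" "\<guillemotleft>r0 : R \<rightarrow> Dom C f\<guillemotright>" "\<guillemotleft>r1 : R \<rightarrow> Dom C f\<guillemotright>"
    and d: "\<guillemotleft>d : Dom C f \<rightarrow> R\<guillemotright>" "r0 \<cdot> d = idt (Dom C f)"
    using kernel_pair_ex[OF ft] by metis
  have "is_pullback C (Rar I r0) (\<eta> (Cod C r0)) (\<eta> (Dom C r0)) r0"
    using unit_central_kernel_pair_trivial[OF ft f(2) r] r(2) by (simp add: hom_def)
  then have "trivial_extension C X r0"
    using trivial_extension_iff[OF category reflector] split_epi_regular[OF r(2) d] by blast
  then show ?thesis unfolding central_extension_def using f(1) r(1) by blast
qed

lemma central_extension_iff:
  "central_extension C X f \<longleftrightarrow> regular_epi C f \<and> unit_central f"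
  using central_extension_unit_central[of X f] unit_central_central_extension
  unfolding central_extension_def by blast

lemma unit_central_pullback:
  assumes f: "unit_central f" "\<guillemotleft>f : B \<rightarrow> A\<guillemotright>" and pb: "is_pullback C g f p q" "\<guillemotleft>p : P \<rightarrow> D\<guillemotright>" "\<guillemotleft>q : P \<rightarrow> B\<guillemotright>"
  shows "unit_central p"
proof (rule unit_centralI[OF pb(2)])
  fix T a b Z x assume ab: "\<guillemotleft>a : T \<rightarrow> P\<guillemotright>" "\<guillemotleft>b : T \<rightarrow> P\<guillemotright>" "p \<cdot> a = p \<cdot> b"
    and x: "\<guillemotleft>x : Z \<rightarrow> T\<guillemotright>" "\<eta> T \<cdot> x = zmap Z (R\<^sub>o T)"
  have g: "g \<cdot> p = f \<cdot> q" "\<guillemotleft>g : D \<rightarrow> A\<guillemotright>" using pullbackD[OF pb(1)] f(2) pb(2) by (simp_all add: hom_def)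
  have "f \<cdot> (q \<cdot> a) = g \<cdot> (p \<cdot> a)" "f \<cdot> (q \<cdot> b) = g \<cdot> (p \<cdot> b)"
    using f(2) g(2) pb(2,3) ab(1,2) by (simp_all add: hom_def reassoc[OF g(1)])
  then have "f \<cdot> (q \<cdot> a) = f \<cdot> (q \<cdot> b)" using ab(3) by simp
  then have "(q \<cdot> a) \<cdot> x = (q \<cdot> b) \<cdot> x"
    using unit_centralD[OF f comp_in_hom[OF ab(1) pb(3)] comp_in_hom[OF ab(2) pb(3)] _ x] by blast
  then show "a \<cdot> x = b \<cdot> x"
    using pullback_unique[OF pb(1,2) comp_in_hom[OF x(1) ab(1)] comp_in_hom[OF x(1) ab(2)]] ab pb(2,3) x(1)
    by (simp add: hom_def reassoc[OF ab(3)])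
qed

section \<open>Perfect objects\<close>

text \<open>The unit is epic, so if it vanishes then so does the identity of \<open>I(U)\<close>.
  Below, perfectness always appears as this equation.\<close>

lemma zero_Rob_iff:
  assumes U: "U \<in> Ob C"
  shows "zero_obj C (R\<^sub>o U) \<longleftrightarrow> \<eta> U = zmap U (R\<^sub>o U)"
proof
  show "\<eta> U = zmap U (R\<^sub>o U)" if "zero_obj C (R\<^sub>o U)" using zero_obj_zmap(1)[OF that unit_in_hom[OF U]] .
  assume "\<eta> U = zmap U (R\<^sub>o U)"
  then have "idt (R\<^sub>o U) \<cdot> \<eta> U = zmap (R\<^sub>o U) (R\<^sub>o U) \<cdot> \<eta> U" using U by simp
  then have "idt (R\<^sub>o U) = zmap (R\<^sub>o U) (R\<^sub>o U)"
    using regular_epi_cancel[OF unit_regular_epi[OF U] unit_in_hom[OF U]] ident_in_hom zmap_in_hom Rob_ob[OF U] by blast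
  then show "zero_obj C (R\<^sub>o U)" using zero_objI[OF Rob_ob[OF U]] by blast
qed

text \<open>For perfect \<open>U\<close> the element \<open>idt U\<close> itself belongs to
  \<open>[U, U]\<close>, where two lifts must agree.\<close>

lemma perfect_lift_unique:
  assumes U: "\<eta> U = zmap U (R\<^sub>o U)" and f: "unit_central f" "\<guillemotleft>f : B \<rightarrow> A\<guillemotright>"
    and h: "\<guillemotleft>h : U \<rightarrow> B\<guillemotright>" "\<guillemotleft>h' : U \<rightarrow> B\<guillemotright>" "f \<cdot> h = f \<cdot> h'"
  shows "h = h'"
proof -
  have ob: "U \<in> Ob C" using in_hom_ob(1)[OF h(1)] .
  have "\<eta> U \<cdot> idt U = zmap U (R\<^sub>o U)" using U ob by simp
  then have "h \<cdot> idt U = h' \<cdot> idt U" using unit_centralD[OF f h ident_in_hom[OF ob]] by blast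
  then show ?thesis using h by (simp add: hom_def)
qed

text \<open>That is, \<open>[V, V] = [W, W]\<close> for every subobject \<open>W\<close> of \<open>V\<close> that still covers \<open>U\<close>: the two maps from
  \<open>W \<times>\<^sub>U V\<close> to \<open>V\<close> agree on its commutator, which covers \<open>[V, V]\<close>.\<close>

lemma unit_central_restrict:
  assumes g: "unit_central g" "\<guillemotleft>g : V \<rightarrow> U\<guillemotright>" and v: "monic C v" "\<guillemotleft>v : W \<rightarrow> V\<guillemotright>" "regular_epi C (g \<cdot> v)"
    and x: "\<guillemotleft>x : Z \<rightarrow> V\<guillemotright>" "\<eta> V \<cdot> x = zmap Z (R\<^sub>o V)"
  obtains y where "\<guillemotleft>y : Z \<rightarrow> W\<guillemotright>" "v \<cdot> y = x" "\<eta> W \<cdot> y = zmap Z (R\<^sub>o W)"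
proof -
  have gv: "\<guillemotleft>g \<cdot> v : W \<rightarrow> U\<guillemotright>" using v(2) g(2) by blast
  obtain T t0 t1 where T: "is_pullback C (g \<cdot> v) g t0 t1" and t: "\<guillemotleft>t0 : T \<rightarrow> W\<guillemotright>" "\<guillemotleft>t1 : T \<rightarrow> V\<guillemotright>" "(g \<cdot> v) \<cdot> t0 = g \<cdot> t1"
    using pullback_ex[OF gv g(2)] .
  obtain Y z w where z: "regular_epi C z" "\<guillemotleft>z : Y \<rightarrow> Z\<guillemotright>" "\<guillemotleft>w : Y \<rightarrow> T\<guillemotright>" "\<eta> T \<cdot> w = zmap Y (R\<^sub>o T)" "t1 \<cdot> w = x \<cdot> z"
    using unit_zero_lift[OF pullback_regular_epi(2)[OF T v(3)] t(2) x] .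
  have "g \<cdot> (v \<cdot> t0) = g \<cdot> t1" using t g(2) v(2) by (simp add: hom_def)
  then have "(v \<cdot> t0) \<cdot> w = t1 \<cdot> w" using unit_centralD[OF g comp_in_hom[OF t(1) v(2)] t(2) _ z(3,4)] by blast
  then have "v \<cdot> (t0 \<cdot> w) = x \<cdot> z" using v(2) t(1) z(3,5) by (simp add: hom_def)
  then obtain y where y: "\<guillemotleft>y : Z \<rightarrow> W\<guillemotright>" "y \<cdot> z = t0 \<cdot> w" "v \<cdot> y = x"
    using regular_epi_diagonal[OF z(1,2) v(1,2) comp_in_hom[OF z(3) t(1)] x(1)] by blast
  have "\<eta> W \<cdot> (y \<cdot> z) = zmap Y (R\<^sub>o W)" using unit_zero_comp[OF t(1) z(3,4)] y(2) by simp
  then show thesis using that y unit_zero_cover[OF z(1,2) y(1)] by blast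
qed

text \<open>\<open>idt U\<close> is an element of \<open>[U, U]\<close>, so on a cover it lifts to
  \<open>[V, V]\<close>.\<close>

lemma perfect_regular_epi_on_kernel:
  assumes U: "\<eta> U = zmap U (R\<^sub>o U)" and g: "regular_epi C g" "\<guillemotleft>g : V \<rightarrow> U\<guillemotright>"
    and k: "is_kernel C k (\<eta> V)" "\<guillemotleft>k : W \<rightarrow> V\<guillemotright>"
  shows "regular_epi C (g \<cdot> k)"
proof -
  have ob: "U \<in> Ob C" "V \<in> Ob C" using in_hom_ob[OF g(2)] by auto
  have "\<eta> U \<cdot> idt U = zmap U (R\<^sub>o U)" using U ob by simp
  then obtain Y z b where z: "regular_epi C z" "\<guillemotleft>z : Y \<rightarrow> U\<guillemotright>" "\<guillemotleft>b : Y \<rightarrow> V\<guillemotright>" "\<eta> V \<cdot> b = zmap Y (R\<^sub>o V)" "g \<cdot> b = idt U \<cdot> z"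
    using unit_zero_lift[OF g ident_in_hom[OF ob(1)]] by blast
  obtain h where h: "\<guillemotleft>h : Y \<rightarrow> W\<guillemotright>" "k \<cdot> h = b" using kernel_lift[OF k(1) unit_in_hom[OF ob(2)] k(2) z(3,4)] .
  have "(g \<cdot> k) \<cdot> h = z" using g(2) k(2) h z(2,5) by (simp add: hom_def)
  then show ?thesis using regular_epi_comp_cancel[OF _ h(1) comp_in_hom[OF k(2) g(2)]] z(1) by simp
qed

text \<open>\<open>[V, V]\<close> covers \<open>U\<close>, so the inclusion \<open>k\<close> factors
  through \<open>[W, W]\<close>; as \<open>k\<close> is monic, this factorization is
  \<open>idt W\<close>, which therefore is an element of \<open>[W, W]\<close>.\<close>

lemma perfect_commutator:
  assumes U: "\<eta> U = zmap U (R\<^sub>o U)" and g: "regular_epi C g" "\<guillemotleft>g : V \<rightarrow> U\<guillemotright>" "unit_central g"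
    and k: "is_kernel C k (\<eta> V)" "\<guillemotleft>k : W \<rightarrow> V\<guillemotright>"
  shows "\<eta> W = zmap W (R\<^sub>o W)" "unit_central (g \<cdot> k)"
proof -
  have ob: "W \<in> Ob C" "V \<in> Ob C" using in_hom_ob[OF k(2)] by auto
  note km = kernel_monic[OF k(1)]
  have "\<eta> V \<cdot> k = zmap W (R\<^sub>o V)" using kernel_comp[OF k(1) unit_in_hom[OF ob(2)] k(2)] .
  then obtain y where y: "\<guillemotleft>y : W \<rightarrow> W\<guillemotright>" "k \<cdot> y = k" "\<eta> W \<cdot> y = zmap W (R\<^sub>o W)"
    using unit_central_restrict[OF g(3,2) km k(2) perfect_regular_epi_on_kernel[OF U g(1,2) k] k(2)] by blast
  have "k \<cdot> idt W = k" using k(2) by (simp add: hom_def)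
  then have "y = idt W" using monic_cancel[OF km k(2) y(1) ident_in_hom[OF ob(1)]] y(2) by simp
  then show "\<eta> W = zmap W (R\<^sub>o W)" using y(3) ob by simp
  show "unit_central (g \<cdot> k)"
  proof (rule unit_centralI[OF comp_in_hom[OF k(2) g(2)]])
    fix T a b Z x assume ab: "\<guillemotleft>a : T \<rightarrow> W\<guillemotright>" "\<guillemotleft>b : T \<rightarrow> W\<guillemotright>" "(g \<cdot> k) \<cdot> a = (g \<cdot> k) \<cdot> b"
      and x: "\<guillemotleft>x : Z \<rightarrow> T\<guillemotright>" "\<eta> T \<cdot> x = zmap Z (R\<^sub>o T)"
    have "g \<cdot> (k \<cdot> a) = g \<cdot> (k \<cdot> b)" using ab g(2) k(2) by (simp add: hom_def)
    then have "(k \<cdot> a) \<cdot> x = (k \<cdot> b) \<cdot> x"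
      using unit_centralD[OF g(3,2) comp_in_hom[OF ab(1) k(2)] comp_in_hom[OF ab(2) k(2)] _ x] by blast
    then have "k \<cdot> (a \<cdot> x) = k \<cdot> (b \<cdot> x)" using ab(1,2) k(2) x(1) by (simp add: hom_def)
    then show "a \<cdot> x = b \<cdot> x"
      using monic_cancel[OF km k(2) comp_in_hom[OF x(1) ab(1)] comp_in_hom[OF x(1) ab(2)]] by simp
  qed
qed

text \<open>Supplies reflection arrows into \<open>Ab C\<close>, for which no reflector is at
  hand.\<close>

lemma reflection_restrict:
  assumes "A \<in> Ob C" "Y \<subseteq> X" "R\<^sub>o A \<in> Y"
  shows "is_reflection C Y A (\<eta> A)"
proof -
  have "\<forall>Y\<in>X. \<forall>g\<in>hom C A Y. \<exists>!h. h \<in> hom C (R\<^sub>o A) Y \<and> h \<cdot> \<eta> A = g"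
    using unit_reflection[OF assms(1)] unfolding is_reflection_def unit_arr(3)[OF assms(1)] by metis
  then have "\<forall>Y\<in>Y. \<forall>g\<in>hom C A Y. \<exists>!h. h \<in> hom C (R\<^sub>o A) Y \<and> h \<cdot> \<eta> A = g"
    using assms(2) by (meson subsetD)
  then show ?thesis
    unfolding is_reflection_def unit_arr(3)[OF assms(1)] using assms(3) unit_in_hom[OF assms(1)] by simp
qed

text \<open>If \<open>B\<close> is perfect then \<open>R = B \<times>\<^sub>A B\<close> is \<open>B \<times> I(R)\<close> with diagonal \<open>(1, 0)\<close>, and the second kernel
  pair projection \<open>B \<times> I(R) \<rightarrow> B\<close> restricts to a unital multiplication on \<open>I(R)\<close>.\<close>

lemma perfect_central_extension_abelian:
  assumes B: "\<eta> B = zmap B (R\<^sub>o B)" and f: "regular_epi C f" "\<guillemotleft>f : B \<rightarrow> A\<guillemotright>" "unit_central f" and Ab: "Ab C \<subseteq> X"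
  shows "central_extension C (Ab C) f"
proof -
  obtain R r0 r1 d where r: "kernel_pair C f r0 r1" "\<guillemotleft>r0 : R \<rightarrow> B\<guillemotright>" "\<guillemotleft>r1 : R \<rightarrow> B\<guillemotright>" "f \<cdot> r0 = f \<cdot> r1"
    and d: "\<guillemotleft>d : B \<rightarrow> R\<guillemotright>" "r0 \<cdot> d = idt B" "r1 \<cdot> d = idt B"
    using kernel_pair_ex[OF f(2)] .
  have ob: "B \<in> Ob C" "R \<in> Ob C" "A \<in> Ob C" using in_hom_ob r(2) f(2) by blast+
  define K where "K = R\<^sub>o R"
  have K: "K \<in> Ob C" "K \<in> X" unfolding K_def using ob Rob_in by auto
  have \<eta>R: "\<guillemotleft>\<eta> R : R \<rightarrow> K\<guillemotright>" unfolding K_def using unit_in_hom[OF ob(2)] .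
  have zB: "zero_obj C (R\<^sub>o B)" using B zero_Rob_iff[OF ob(1)] by simp
  have pb: "is_pullback C (Rar I r0) (\<eta> B) (\<eta> R) r0" using unit_central_kernel_pair_trivial[OF f(2,3) r(1-3)] .
  have Rr: "\<guillemotleft>Rar I r0 : K \<rightarrow> R\<^sub>o B\<guillemotright>" unfolding K_def using Rar_in_hom[OF r(2)] .
  \<comment> \<open>The trivial pullback square lies over the zero object \<open>I(B)\<close>, so it
    is a product diagram for \<open>R\<close>.\<close>
  have lift: "\<exists>h. \<guillemotleft>h : Z \<rightarrow> R\<guillemotright> \<and> r0 \<cdot> h = b \<and> \<eta> R \<cdot> h = k" if "\<guillemotleft>b : Z \<rightarrow> B\<guillemotright>" "\<guillemotleft>k : Z \<rightarrow> K\<guillemotright>" for Z b k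
  proof -
    have "Rar I r0 \<cdot> k = \<eta> B \<cdot> b"
      using zero_obj_unique(1)[OF zB comp_in_hom[OF that(2) Rr] comp_in_hom[OF that(1) unit_in_hom[OF ob(1)]]] .
    then show ?thesis using pullback_lift[OF pb \<eta>R r(2) that(2,1)] by metis
  qed
  note uniq = pullback_unique[OF pb \<eta>R]
  have "\<eta> B \<cdot> idt B = zmap B (R\<^sub>o B)" using B ob by simp
  then have "(\<eta> R \<cdot> d) \<cdot> idt B = zmap B K"
    using unit_zero_to_X[OF comp_in_hom[OF d(1) \<eta>R] K(2) ident_in_hom[OF ob(1)]] by blast
  then have \<eta>d: "\<eta> R \<cdot> d = zmap B K" using d(1) \<eta>R by (simp add: hom_def)
  obtain P p q where pr: "is_product C K K p q" and pq: "\<guillemotleft>p : P \<rightarrow> K\<guillemotright>" "\<guillemotleft>q : P \<rightarrow> K\<guillemotright>"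
    using product_ex[OF K(1,1)] .
  have P: "P \<in> Ob C" using in_hom_ob(1)[OF pq(1)] .
  note idK = ident_in_hom[OF K(1)] and zK = zmap_in_hom[OF K(1,1)]
  obtain i1 where i1: "\<guillemotleft>i1 : K \<rightarrow> P\<guillemotright>" "p \<cdot> i1 = idt K" "q \<cdot> i1 = zmap K K" using product_lift[OF pr pq(1) idK zK] .
  obtain i2 where i2: "\<guillemotleft>i2 : K \<rightarrow> P\<guillemotright>" "p \<cdot> i2 = zmap K K" "q \<cdot> i2 = idt K" using product_lift[OF pr pq(1) zK idK] .
  \<comment> \<open>\<open>j\<close> sends \<open>k\<close> to \<open>(0, k)\<close>; the other
    endpoint \<open>r1 \<cdot> j\<close> embeds \<open>I(R)\<close> into the kernel of
    \<open>f\<close>.\<close>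
  obtain j where j: "\<guillemotleft>j : K \<rightarrow> R\<guillemotright>" "r0 \<cdot> j = zmap K B" "\<eta> R \<cdot> j = idt K"
    using lift[OF zmap_in_hom[OF K(1) ob(1)] idK] by blast
  have k: "\<guillemotleft>r1 \<cdot> j : K \<rightarrow> B\<guillemotright>" using j(1) r(3) by blast
  have fk: "f \<cdot> (r1 \<cdot> j) = zmap K A"
    using f(2) r(2,3) j(1) K(1) by (simp add: hom_def reassoc[OF r(4)[symmetric]] j(2))
  \<comment> \<open>Read an element of \<open>R\<close> as a step from \<open>r0\<close> to
    \<open>r1\<close> with label in \<open>I(R)\<close>. For labels \<open>x\<close> and
    \<open>y\<close>, \<open>\<theta>\<close> starts where the step \<open>x\<close> from 0 ends and
    has label \<open>y\<close>; \<open>\<psi>\<close> goes from 0 directly to the end of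
    \<open>\<theta>\<close>, and its label is the product of \<open>x\<close> and
    \<open>y\<close>.\<close>
  obtain \<theta> where \<theta>: "\<guillemotleft>\<theta> : P \<rightarrow> R\<guillemotright>" "r0 \<cdot> \<theta> = (r1 \<cdot> j) \<cdot> p" "\<eta> R \<cdot> \<theta> = q"
    using lift[OF comp_in_hom[OF pq(1) k] pq(2)] by blast
  have "f \<cdot> (r1 \<cdot> \<theta>) = f \<cdot> ((r1 \<cdot> j) \<cdot> p)"
    using f(2) r(2,3) \<theta>(1) by (simp add: hom_def reassoc[OF r(4)[symmetric]] \<theta>(2))
  also have "\<dots> = (f \<cdot> (r1 \<cdot> j)) \<cdot> p" using f(2) r(3) j(1) pq(1) by (simp add: hom_def)
  also have "\<dots> = f \<cdot> zmap P B" unfolding fk using f(2) pq(1) P ob by (simp add: hom_def)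
  finally obtain \<psi> where \<psi>: "\<guillemotleft>\<psi> : P \<rightarrow> R\<guillemotright>" "r0 \<cdot> \<psi> = zmap P B" "r1 \<cdot> \<psi> = r1 \<cdot> \<theta>"
    using pullback_lift[OF r(1-3) zmap_in_hom[OF P ob(1)] comp_in_hom[OF \<theta>(1) r(3)]] by metis
  have \<theta>1: "\<theta> \<cdot> i1 = d \<cdot> (r1 \<cdot> j)" and \<theta>2: "\<theta> \<cdot> i2 = j"
    by (rule uniq; use \<eta>R r(2,3) \<theta> i1 i2 d j pq ob K in
      \<open>simp add: hom_def reassoc[OF \<theta>(2)] reassoc[OF \<theta>(3)] reassoc[OF \<eta>d] reassoc[OF d(2)]\<close>)+
  have \<psi>1: "\<psi> \<cdot> i1 = j" and \<psi>2: "\<psi> \<cdot> i2 = j"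
    by (rule pullback_unique[OF r(1,2)]; use r(2,3) \<theta>(1) \<psi> i1 i2 d j ob K in
      \<open>simp add: hom_def reassoc[OF \<psi>(2)] reassoc[OF \<psi>(3)] \<theta>1 \<theta>2 reassoc[OF d(3)]\<close>)+
  have "K \<in> Ab C"
    by (rule unital_magma_abelian[OF pr pq i1 i2 comp_in_hom[OF \<psi>(1) \<eta>R]])
      (use \<eta>R \<psi>(1) i1(1) i2(1) j(3) in \<open>simp_all add: hom_def \<psi>1 \<psi>2\<close>)
  then have "is_reflection C (Ab C) R (\<eta> R)" using reflection_restrict[OF ob(2) Ab] unfolding K_def by blast
  moreover have "is_reflection C (Ab C) B (\<eta> B)" using reflection_restrict[OF ob(1) Ab zero_obj_abelian[OF zB]] .
  moreover have "Dom C r0 = R" "Cod C r0 = B" using r(2) by (simp_all add: hom_def)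
  moreover have "Rar I r0 \<in> hom C (Cod C (\<eta> R)) (Cod C (\<eta> B))" using Rar_in_hom[OF r(2)] ob by simp
  ultimately have "trivial_extension C (Ab C) r0"
    unfolding trivial_extension_def using pb split_epi_regular[OF r(2) d(1,2)] by metis
  then show ?thesis unfolding central_extension_def using f(1) r(1) by blast
qed


section \<open>Homology and universal central extensions\<close>

text \<open>In terms of elements, \<open>[K, B]\<close> consists of the second coordinates of those
  elements of \<open>[R, R]\<close> whose first coordinate is 0. As the projections are jointly
  monic, the second coordinate determines the element, so \<open>c\<close> is monic.\<close>

lemma relative_commutatorE:
  assumes c: "is_relative_commutator C I f c" and f: "\<guillemotleft>f : B \<rightarrow> A\<guillemotright>"
  obtains D R r0 r1 x where "kernel_pair C f r0 r1" "\<guillemotleft>r0 : R \<rightarrow> B\<guillemotright>" "\<guillemotleft>r1 : R \<rightarrow> B\<guillemotright>"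
    "\<guillemotleft>x : D \<rightarrow> R\<guillemotright>" "\<eta> R \<cdot> x = zmap D (R\<^sub>o R)" "r0 \<cdot> x = zmap D B" "r1 \<cdot> x = c" "\<guillemotleft>c : D \<rightarrow> B\<guillemotright>" "monic C c"
    "\<forall>Z y. \<guillemotleft>y : Z \<rightarrow> R\<guillemotright> \<longrightarrow> \<eta> R \<cdot> y = zmap Z (R\<^sub>o R) \<longrightarrow> r0 \<cdot> y = zmap Z B \<longrightarrow> (\<exists>h. \<guillemotleft>h : Z \<rightarrow> D\<guillemotright> \<and> c \<cdot> h = r1 \<cdot> y)"
proof -
  obtain r0 r1 \<mu>R \<mu>B \<phi>0 \<phi>1 \<kappa> where r: "kernel_pair C f r0 r1"
    and \<mu>: "is_kernel C \<mu>R (\<eta> (Dom C r0))" "is_kernel C \<mu>B (\<eta> (Dom C f))"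
    and \<phi>: "\<phi>0 \<in> hom C (Dom C \<mu>R) (Dom C \<mu>B)" "\<mu>B \<cdot> \<phi>0 = r0 \<cdot> \<mu>R"
      "\<phi>1 \<in> hom C (Dom C \<mu>R) (Dom C \<mu>B)" "\<mu>B \<cdot> \<phi>1 = r1 \<cdot> \<mu>R"
    and \<kappa>: "is_kernel C \<kappa> \<phi>0" and ceq: "c = (\<mu>B \<cdot> \<phi>1) \<cdot> \<kappa>"
    using c unfolding is_relative_commutator_def by metis
  define R M N D where "R = Dom C r0" "M = Dom C \<mu>R" "N = Dom C \<mu>B" "D = Dom C \<kappa>"
  have dB: "Dom C f = B" using f by (simp add: hom_def)
  have rt: "\<guillemotleft>r0 : R \<rightarrow> B\<guillemotright>" "\<guillemotleft>r1 : R \<rightarrow> B\<guillemotright>"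
    using pullbackD(5,6)[OF r] f unfolding R_M_N_D_def by (simp_all add: hom_def)
  have ob: "R \<in> Ob C" "B \<in> Ob C" using in_hom_ob[OF rt(1)] by auto
  have \<mu>R: "is_kernel C \<mu>R (\<eta> R)" "\<guillemotleft>\<mu>R : M \<rightarrow> R\<guillemotright>" and \<mu>B: "is_kernel C \<mu>B (\<eta> B)" "\<guillemotleft>\<mu>B : N \<rightarrow> B\<guillemotright>"
    using \<mu> kernelD(2)[OF \<mu>(1)] kernelD(2)[OF \<mu>(2)] ob dB unfolding R_M_N_D_def by simp_all
  have \<phi>t: "\<guillemotleft>\<phi>0 : M \<rightarrow> N\<guillemotright>" "\<guillemotleft>\<phi>1 : M \<rightarrow> N\<guillemotright>" using \<phi> unfolding R_M_N_D_def by simp_all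
  have \<kappa>t: "\<guillemotleft>\<kappa> : D \<rightarrow> M\<guillemotright>" using kernelD(2)[OF \<kappa>] \<phi>t(1) unfolding R_M_N_D_def by (simp add: hom_def)
  have D: "D \<in> Ob C" "N \<in> Ob C" using in_hom_ob(1)[OF \<kappa>t] in_hom_ob(1)[OF \<mu>B(2)] .
  have \<phi>\<kappa>: "\<phi>0 \<cdot> \<kappa> = zmap D N" using kernel_comp[OF \<kappa> \<phi>t(1) \<kappa>t] .
  have x: "\<guillemotleft>\<mu>R \<cdot> \<kappa> : D \<rightarrow> R\<guillemotright>" using \<kappa>t \<mu>R(2) by blast
  have ct: "r1 \<cdot> (\<mu>R \<cdot> \<kappa>) = c" "\<guillemotleft>c : D \<rightarrow> B\<guillemotright>"
    unfolding ceq \<phi>(4) using rt \<kappa>t \<mu>R(2) by (simp_all add: hom_def)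
  have x0: "r0 \<cdot> (\<mu>R \<cdot> \<kappa>) = zmap D B"
    using rt \<mu>R(2) \<mu>B(2) \<phi>t(1) \<kappa>t D ob by (simp add: hom_def reassoc[OF \<phi>(2)[symmetric]] \<phi>\<kappa>)
  have x\<eta>: "\<eta> R \<cdot> (\<mu>R \<cdot> \<kappa>) = zmap D (R\<^sub>o R)"
    using \<mu>R(2) \<kappa>t ob by (simp add: hom_def reassoc[OF kernel_comp[OF \<mu>R(1) unit_in_hom[OF ob(1)] \<mu>R(2)]])
  have "monic C c"
  proof (rule monicI[OF ct(2)])
    fix Z h h' assume h: "\<guillemotleft>h : Z \<rightarrow> D\<guillemotright>" "\<guillemotleft>h' : Z \<rightarrow> D\<guillemotright>" "c \<cdot> h = c \<cdot> h'"
    have "r0 \<cdot> ((\<mu>R \<cdot> \<kappa>) \<cdot> h) = (r0 \<cdot> (\<mu>R \<cdot> \<kappa>)) \<cdot> h" "r0 \<cdot> ((\<mu>R \<cdot> \<kappa>) \<cdot> h') = (r0 \<cdot> (\<mu>R \<cdot> \<kappa>)) \<cdot> h'"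
      "r1 \<cdot> ((\<mu>R \<cdot> \<kappa>) \<cdot> h) = (r1 \<cdot> (\<mu>R \<cdot> \<kappa>)) \<cdot> h" "r1 \<cdot> ((\<mu>R \<cdot> \<kappa>) \<cdot> h') = (r1 \<cdot> (\<mu>R \<cdot> \<kappa>)) \<cdot> h'"
      using rt \<mu>R(2) \<kappa>t h(1,2) by (simp_all add: hom_def)
    then have "r0 \<cdot> ((\<mu>R \<cdot> \<kappa>) \<cdot> h) = r0 \<cdot> ((\<mu>R \<cdot> \<kappa>) \<cdot> h')" "r1 \<cdot> ((\<mu>R \<cdot> \<kappa>) \<cdot> h) = r1 \<cdot> ((\<mu>R \<cdot> \<kappa>) \<cdot> h')"
      unfolding x0 ct(1) using h D ob by (simp_all add: hom_def)
    then have "(\<mu>R \<cdot> \<kappa>) \<cdot> h = (\<mu>R \<cdot> \<kappa>) \<cdot> h'"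
      using pullback_unique[OF r rt(1) comp_in_hom[OF h(1) x] comp_in_hom[OF h(2) x]] by simp
    then have "\<mu>R \<cdot> (\<kappa> \<cdot> h) = \<mu>R \<cdot> (\<kappa> \<cdot> h')" using \<mu>R(2) \<kappa>t h(1,2) by (simp add: hom_def)
    then have "\<kappa> \<cdot> h = \<kappa> \<cdot> h'"
      using monic_cancel[OF kernel_monic[OF \<mu>R(1)] \<mu>R(2) comp_in_hom[OF h(1) \<kappa>t] comp_in_hom[OF h(2) \<kappa>t]] by simp
    then show "h = h'" using monic_cancel[OF kernel_monic[OF \<kappa>] \<kappa>t h(1,2)] by simp
  qed
  moreover have "\<exists>h. \<guillemotleft>h : Z \<rightarrow> D\<guillemotright> \<and> c \<cdot> h = r1 \<cdot> y"
    if y: "\<guillemotleft>y : Z \<rightarrow> R\<guillemotright>" "\<eta> R \<cdot> y = zmap Z (R\<^sub>o R)" "r0 \<cdot> y = zmap Z B" for Z y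
  proof -
    have Z: "Z \<in> Ob C" using in_hom_ob(1)[OF y(1)] .
    obtain y' where y': "\<guillemotleft>y' : Z \<rightarrow> M\<guillemotright>" "\<mu>R \<cdot> y' = y"
      using kernel_lift[OF \<mu>R(1) unit_in_hom[OF ob(1)] \<mu>R(2) y(1,2)] .
    have "\<mu>B \<cdot> (\<phi>0 \<cdot> y') = \<mu>B \<cdot> zmap Z N"
      using \<mu>B(2) \<phi>t(1) y' \<mu>R(2) rt y(3) Z by (simp add: hom_def reassoc[OF \<phi>(2)])
    then have "\<phi>0 \<cdot> y' = zmap Z N"
      using monic_cancel[OF kernel_monic[OF \<mu>B(1)] \<mu>B(2) comp_in_hom[OF y'(1) \<phi>t(1)] zmap_in_hom[OF Z D(2)]] by simp
    then obtain h where h: "\<guillemotleft>h : Z \<rightarrow> D\<guillemotright>" "\<kappa> \<cdot> h = y'" using kernel_lift[OF \<kappa> \<phi>t(1) \<kappa>t y'(1)] by blast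
    have "c \<cdot> h = r1 \<cdot> y"
      unfolding ct(1)[symmetric] using rt \<mu>R(2) \<kappa>t h y'(2) by (simp add: hom_def)
    then show ?thesis using h(1) by blast
  qed
  ultimately show thesis using that[OF r rt x x\<eta> x0 ct] by blast
qed

lemma relative_commutator_ex:
  assumes f: "\<guillemotleft>f : B \<rightarrow> A\<guillemotright>"
  obtains c where "is_relative_commutator C I f c"
proof -
  obtain R r0 r1 where r: "kernel_pair C f r0 r1" "\<guillemotleft>r0 : R \<rightarrow> B\<guillemotright>" "\<guillemotleft>r1 : R \<rightarrow> B\<guillemotright>" "f \<cdot> r0 = f \<cdot> r1"
    using pullback_ex[OF f f] .
  have ob: "R \<in> Ob C" "B \<in> Ob C" using in_hom_ob[OF r(2)] by auto
  obtain M m where m: "is_kernel C m (\<eta> R)" "\<guillemotleft>m : M \<rightarrow> R\<guillemotright>" "\<eta> R \<cdot> m = zmap M (R\<^sub>o R)" using kernel_ex[OF unit_in_hom[OF ob(1)]] .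
  obtain N n where n: "is_kernel C n (\<eta> B)" "\<guillemotleft>n : N \<rightarrow> B\<guillemotright>" using kernel_ex[OF unit_in_hom[OF ob(2)]] by metis
  obtain \<phi>0 where \<phi>0: "\<guillemotleft>\<phi>0 : M \<rightarrow> N\<guillemotright>" "n \<cdot> \<phi>0 = r0 \<cdot> m"
    using kernel_lift[OF n(1) unit_in_hom[OF ob(2)] n(2) comp_in_hom[OF m(2) r(2)] unit_zero_comp[OF r(2) m(2,3)]] .
  obtain \<phi>1 where \<phi>1: "\<guillemotleft>\<phi>1 : M \<rightarrow> N\<guillemotright>" "n \<cdot> \<phi>1 = r1 \<cdot> m"
    using kernel_lift[OF n(1) unit_in_hom[OF ob(2)] n(2) comp_in_hom[OF m(2) r(3)] unit_zero_comp[OF r(3) m(2,3)]] .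
  obtain \<kappa> where \<kappa>: "is_kernel C \<kappa> \<phi>0" using kernel_ex[OF \<phi>0(1)] by metis
  have d: "Dom C r0 = R" "Dom C f = B" "Dom C m = M" "Dom C n = N" using r(2) f m(2) n(2) by (simp_all add: hom_def)
  have "is_relative_commutator C I f ((n \<cdot> \<phi>1) \<cdot> \<kappa>)"
    unfolding is_relative_commutator_def
    by (rule exI[of _ r0], rule exI[of _ r1], rule exI[of _ m], rule exI[of _ n], rule exI[of _ \<phi>0],
        rule exI[of _ \<phi>1], rule exI[of _ \<kappa>]) (simp add: d r(1) m(1) n(1) \<phi>0 \<phi>1 \<kappa>)
  then show thesis using that by blast
qed

text \<open>The quotient \<open>P/[K, P]\<close>. It is the quotient by the relation \<open>S = \<eta>\<^sub>R\<^sup>-\<^sup>1(I(\<delta>)(I(P)))\<close> on \<open>P\<close>, where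
  \<open>\<delta>\<close> is the diagonal of \<open>R = P \<times>\<^sub>U P\<close>; this makes \<open>S\<close> the join of the diagonal and \<open>[R, R]\<close>.\<close>

lemma commutator_quotient:
  assumes p: "regular_epi C p" "\<guillemotleft>p : P \<rightarrow> U\<guillemotright>" and c: "is_relative_commutator C I p c"
  obtains D Q q g where "\<guillemotleft>c : D \<rightarrow> P\<guillemotright>" "monic C c" "\<eta> P \<cdot> c = zmap D (R\<^sub>o P)" "\<guillemotleft>q : P \<rightarrow> Q\<guillemotright>" "is_kernel C c q"
    "\<guillemotleft>g : Q \<rightarrow> U\<guillemotright>" "regular_epi C g" "g \<cdot> q = p" "unit_central g"
proof -
  obtain D R r0 r1 x where r: "kernel_pair C p r0 r1" "\<guillemotleft>r0 : R \<rightarrow> P\<guillemotright>" "\<guillemotleft>r1 : R \<rightarrow> P\<guillemotright>"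
    and x: "\<guillemotleft>x : D \<rightarrow> R\<guillemotright>" "\<eta> R \<cdot> x = zmap D (R\<^sub>o R)" "r0 \<cdot> x = zmap D P" "r1 \<cdot> x = c" and ct: "\<guillemotleft>c : D \<rightarrow> P\<guillemotright>" "monic C c"
    and cl: "\<forall>Z y. \<guillemotleft>y : Z \<rightarrow> R\<guillemotright> \<longrightarrow> \<eta> R \<cdot> y = zmap Z (R\<^sub>o R) \<longrightarrow> r0 \<cdot> y = zmap Z P \<longrightarrow> (\<exists>h. \<guillemotleft>h : Z \<rightarrow> D\<guillemotright> \<and> c \<cdot> h = r1 \<cdot> y)"
    using relative_commutatorE[OF c p(2)] .
  have ob: "P \<in> Ob C" "R \<in> Ob C" "D \<in> Ob C" using r(2) ct(1) in_hom_ob by blast+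
  have pr: "p \<cdot> r0 = p \<cdot> r1" using pullbackD(7)[OF r(1)] .
  obtain d where d: "\<guillemotleft>d : P \<rightarrow> R\<guillemotright>" "r0 \<cdot> d = idt P" "r1 \<cdot> d = idt P"
    using pullback_lift[OF r ident_in_hom[OF ob(1)] ident_in_hom[OF ob(1)]] by blast
  note \<eta>R = unit_in_hom[OF ob(2)] and Rd = Rar_in_hom[OF d(1)] and Rr = Rar_in_hom[OF r(2)]
  have Rrd: "Rar I r0 \<cdot> Rar I d = idt (R\<^sub>o P)" using Rar_comp[OF d(1) r(2)] d(2) Rar_ident[OF ob(1)] by simp
  obtain S \<iota> t where S: "is_pullback C (\<eta> R) (Rar I d) \<iota> t" and \<iota>: "\<guillemotleft>\<iota> : S \<rightarrow> R\<guillemotright>" "\<guillemotleft>t : S \<rightarrow> R\<^sub>o P\<guillemotright>" "\<eta> R \<cdot> \<iota> = Rar I d \<cdot> t"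
    using pullback_ex[OF \<eta>R Rd] .
  have \<iota>m: "monic C \<iota>" using pullback_monic[OF S split_mono[OF Rd Rr Rrd]] .
  have s: "\<guillemotleft>r0 \<cdot> \<iota> : S \<rightarrow> P\<guillemotright>" "\<guillemotleft>r1 \<cdot> \<iota> : S \<rightarrow> P\<guillemotright>" using r \<iota>(1) by blast+
  have jm: "\<forall>Z x y. \<guillemotleft>x : Z \<rightarrow> S\<guillemotright> \<longrightarrow> \<guillemotleft>y : Z \<rightarrow> S\<guillemotright> \<longrightarrow> (r0 \<cdot> \<iota>) \<cdot> x = (r0 \<cdot> \<iota>) \<cdot> y \<longrightarrow> (r1 \<cdot> \<iota>) \<cdot> x = (r1 \<cdot> \<iota>) \<cdot> y \<longrightarrow> x = y"
  proof (intro allI impI)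
    fix Z x y assume xy: "\<guillemotleft>x : Z \<rightarrow> S\<guillemotright>" "\<guillemotleft>y : Z \<rightarrow> S\<guillemotright>" "(r0 \<cdot> \<iota>) \<cdot> x = (r0 \<cdot> \<iota>) \<cdot> y" "(r1 \<cdot> \<iota>) \<cdot> x = (r1 \<cdot> \<iota>) \<cdot> y"
    have "\<iota> \<cdot> x = \<iota> \<cdot> y"
      by (rule pullback_unique[OF r(1,2) comp_in_hom[OF xy(1) \<iota>(1)] comp_in_hom[OF xy(2) \<iota>(1)]])
        (use xy r(2,3) \<iota>(1) in \<open>simp_all add: hom_def\<close>)
    then show "x = y" using monic_cancel[OF \<iota>m \<iota>(1) xy(1,2)] by simp
  qed
  obtain e where e: "\<guillemotleft>e : P \<rightarrow> S\<guillemotright>" "\<iota> \<cdot> e = d"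
    using pullback_lift[OF S \<iota>(1,2) d(1) unit_in_hom[OF ob(1)] unit_natural[OF d(1), symmetric]] by blast
  have se: "(r0 \<cdot> \<iota>) \<cdot> e = idt P" "(r1 \<cdot> \<iota>) \<cdot> e = idt P" using r(2,3) \<iota>(1) e d by (simp_all add: hom_def)
  obtain Q q where q: "is_coequalizer C (r0 \<cdot> \<iota>) (r1 \<cdot> \<iota>) q" "kernel_pair C q (r0 \<cdot> \<iota>) (r1 \<cdot> \<iota>)" "\<guillemotleft>q : P \<rightarrow> Q\<guillemotright>"
    using reflexive_relation_effective[OF s jm e(1) se] .
  have qr: "regular_epi C q" using q(1) unfolding regular_epi_def by blast
  have qs: "q \<cdot> (r0 \<cdot> \<iota>) = q \<cdot> (r1 \<cdot> \<iota>)" using pullbackD(7)[OF q(2)] .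
  have "p \<cdot> (r0 \<cdot> \<iota>) = p \<cdot> (r1 \<cdot> \<iota>)" using p(2) r(2,3) \<iota>(1) by (simp add: hom_def reassoc[OF pr])
  then obtain g where g: "\<guillemotleft>g : Q \<rightarrow> U\<guillemotright>" "g \<cdot> q = p" using coequalizer_lift[OF q(1) s(1) q(3) p(2)] by blast
  have gr: "regular_epi C g" using regular_epi_comp_cancel[OF _ q(3) g(1)] g(2) p(1) by simp
  \<comment> \<open>\<open>[R, R]\<close> is contained in \<open>S\<close>: its elements have
    component 0 in \<open>I(P)\<close>.\<close>
  have identify: "q \<cdot> (r0 \<cdot> y) = q \<cdot> (r1 \<cdot> y)" if y: "\<guillemotleft>y : Z \<rightarrow> R\<guillemotright>" "\<eta> R \<cdot> y = zmap Z (R\<^sub>o R)" for Z y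
  proof -
    have Z: "Z \<in> Ob C" using in_hom_ob(1)[OF y(1)] .
    have "\<eta> R \<cdot> y = Rar I d \<cdot> zmap Z (R\<^sub>o P)" using y(2) Rd Z ob by (simp add: hom_def)
    then obtain h where h: "\<guillemotleft>h : Z \<rightarrow> S\<guillemotright>" "\<iota> \<cdot> h = y"
      using pullback_lift[OF S \<iota>(1,2) y(1) zmap_in_hom[OF Z Rob_ob[OF ob(1)]]] by blast
    have "(q \<cdot> (r0 \<cdot> \<iota>)) \<cdot> h = (q \<cdot> (r1 \<cdot> \<iota>)) \<cdot> h" using qs by simp
    then show ?thesis using q(3) r(2,3) \<iota>(1) h by (simp add: hom_def)
  qed
  have gc: "unit_central g"
  proof (rule unit_centralI[OF g(1)])
    fix T a b Z v assume ab: "\<guillemotleft>a : T \<rightarrow> Q\<guillemotright>" "\<guillemotleft>b : T \<rightarrow> Q\<guillemotright>" "g \<cdot> a = g \<cdot> b"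
      and v: "\<guillemotleft>v : Z \<rightarrow> T\<guillemotright>" "\<eta> T \<cdot> v = zmap Z (R\<^sub>o T)"
    \<comment> \<open>On successive covers \<open>a\<close> and \<open>b\<close> lift to
      \<open>P\<close>. The lifts have the same image in \<open>U\<close> and so form an element of
      \<open>R\<close>, to which \<open>identify\<close> applies.\<close>
    obtain T1 z1 a1 where z1: "regular_epi C z1" "\<guillemotleft>z1 : T1 \<rightarrow> T\<guillemotright>" "\<guillemotleft>a1 : T1 \<rightarrow> P\<guillemotright>" "q \<cdot> a1 = a \<cdot> z1"
      using cover[OF qr q(3) ab(1)] .
    obtain T2 z2 b2 where z2: "regular_epi C z2" "\<guillemotleft>z2 : T2 \<rightarrow> T1\<guillemotright>" "\<guillemotleft>b2 : T2 \<rightarrow> P\<guillemotright>" "q \<cdot> b2 = (b \<cdot> z1) \<cdot> z2"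
      using cover[OF qr q(3) comp_in_hom[OF z1(2) ab(2)]] .
    have zt: "\<guillemotleft>z1 \<cdot> z2 : T2 \<rightarrow> T\<guillemotright>" "regular_epi C (z1 \<cdot> z2)"
      using comp_in_hom[OF z2(2) z1(2)] regular_epi_comp[OF z2(1) z1(1) z2(2) z1(2)] .
    have a2t: "\<guillemotleft>a1 \<cdot> z2 : T2 \<rightarrow> P\<guillemotright>" using z2(2) z1(3) by blast
    have qa: "q \<cdot> (a1 \<cdot> z2) = a \<cdot> (z1 \<cdot> z2)" and qb: "q \<cdot> b2 = b \<cdot> (z1 \<cdot> z2)"
      using q(3) z1(2,3) z2(2) ab(1,2) by (simp_all add: hom_def reassoc[OF z1(4)] z2(4))
    have "p \<cdot> (a1 \<cdot> z2) = g \<cdot> (q \<cdot> (a1 \<cdot> z2))" "p \<cdot> b2 = g \<cdot> (q \<cdot> b2)"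
      using g(1) q(3) z1(3) z2(2,3) by (simp_all add: hom_def reassoc[OF g(2)])
    then have "p \<cdot> (a1 \<cdot> z2) = p \<cdot> b2"
      unfolding qa qb using g(1) ab(1,2) z1(2) z2(2) by (simp add: hom_def reassoc[OF ab(3)])
    then obtain h where h: "\<guillemotleft>h : T2 \<rightarrow> R\<guillemotright>" "r0 \<cdot> h = a1 \<cdot> z2" "r1 \<cdot> h = b2"
      using pullback_lift[OF r a2t z2(3)] by blast
    obtain W z w where z: "regular_epi C z" "\<guillemotleft>z : W \<rightarrow> Z\<guillemotright>" "\<guillemotleft>w : W \<rightarrow> T2\<guillemotright>" "\<eta> T2 \<cdot> w = zmap W (R\<^sub>o T2)" "(z1 \<cdot> z2) \<cdot> w = v \<cdot> z"
      using unit_zero_lift[OF zt(2,1) v] .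
    have "q \<cdot> (r0 \<cdot> (h \<cdot> w)) = q \<cdot> (r1 \<cdot> (h \<cdot> w))"
      using identify[OF comp_in_hom[OF z(3) h(1)] unit_zero_comp[OF h(1) z(3,4)]] .
    moreover have "q \<cdot> (r0 \<cdot> (h \<cdot> w)) = (q \<cdot> (a1 \<cdot> z2)) \<cdot> w" "q \<cdot> (r1 \<cdot> (h \<cdot> w)) = (q \<cdot> b2) \<cdot> w"
      using q(3) r(2,3) h z(3) z1(3) z2(2,3) by (simp_all add: hom_def reassoc[OF h(2)] reassoc[OF h(3)])
    ultimately have "(a \<cdot> (z1 \<cdot> z2)) \<cdot> w = (b \<cdot> (z1 \<cdot> z2)) \<cdot> w" unfolding qa qb by simp
    moreover have "(a \<cdot> (z1 \<cdot> z2)) \<cdot> w = a \<cdot> ((z1 \<cdot> z2) \<cdot> w)" "(b \<cdot> (z1 \<cdot> z2)) \<cdot> w = b \<cdot> ((z1 \<cdot> z2) \<cdot> w)"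
      using ab(1,2) zt(1) z(3) z1(2) z2(2) by (simp_all add: hom_def)
    ultimately have "(a \<cdot> v) \<cdot> z = (b \<cdot> v) \<cdot> z" unfolding z(5) using ab(1,2) v(1) z(2) by (simp add: hom_def)
    then show "a \<cdot> v = b \<cdot> v"
      using regular_epi_cancel[OF z(1,2) comp_in_hom[OF v(1) ab(1)] comp_in_hom[OF v(1) ab(2)]] by simp
  qed
  have Q: "Q \<in> Ob C" using in_hom_ob(2)[OF q(3)] .
  have "q \<cdot> c = zmap D Q"
    using identify[OF x(1,2)] x(3,4) q(3) ob(3) by (simp add: hom_def)
  moreover have "\<exists>h. \<guillemotleft>h : Z \<rightarrow> D\<guillemotright> \<and> c \<cdot> h = y" if y: "\<guillemotleft>y : Z \<rightarrow> P\<guillemotright>" "q \<cdot> y = zmap Z Q" for Z y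
  proof -
    have Z: "Z \<in> Ob C" using in_hom_ob(1)[OF y(1)] .
    have "q \<cdot> zmap Z P = q \<cdot> y" using y(2) q(3) Z by (simp add: hom_def)
    then obtain h where h: "\<guillemotleft>h : Z \<rightarrow> S\<guillemotright>" "(r0 \<cdot> \<iota>) \<cdot> h = zmap Z P" "(r1 \<cdot> \<iota>) \<cdot> h = y"
      using pullback_lift[OF q(2) s zmap_in_hom[OF Z ob(1)] y(1)] by blast
    have h': "r0 \<cdot> (\<iota> \<cdot> h) = zmap Z P" "r1 \<cdot> (\<iota> \<cdot> h) = y" using h r(2,3) \<iota>(1) by (simp_all add: hom_def)
    \<comment> \<open>\<open>I(r0)\<close> is a retraction of \<open>I(\<delta>)\<close>, so the
      component in \<open>I(P)\<close> is the unit applied to the first coordinate, which is 0.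
      Hence \<open>\<iota> \<cdot> h\<close> lies in \<open>[R, R]\<close> and its second coordinate
      in \<open>[K, P]\<close>.\<close>
    have "t \<cdot> h = Rar I r0 \<cdot> (\<eta> R \<cdot> (\<iota> \<cdot> h))"
      using \<iota>(1,2) h(1) Rr Rd ob by (simp add: hom_def reassoc[OF \<iota>(3)] reassoc[OF Rrd])
    also have "\<dots> = \<eta> P \<cdot> (r0 \<cdot> (\<iota> \<cdot> h))"
      using r(2) \<iota>(1) h(1) Rr ob by (simp add: hom_def reassoc[OF unit_natural[OF r(2)]])
    also have "\<dots> = zmap Z (R\<^sub>o P)" unfolding h'(1) using Z ob by simp
    finally have "\<eta> R \<cdot> (\<iota> \<cdot> h) = zmap Z (R\<^sub>o R)"
      using \<iota>(1,2) h(1) Rd Z ob by (simp add: hom_def reassoc[OF \<iota>(3)])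
    then show ?thesis using cl comp_in_hom[OF h(1) \<iota>(1)] h' by metis
  qed
  ultimately have "is_kernel C c q" using kernelI[OF q(3) ct(1) _ ct(2)] by blast
  moreover have "\<eta> P \<cdot> c = zmap D (R\<^sub>o P)" using unit_zero_comp[OF r(3) x(1,2)] x(4) by simp
  ultimately show thesis using that[OF ct _ q(3) _ g(1) gr g(2) gc] by blast
qed

section \<open>The second homology object and splittings\<close>

text \<open>The quotient is realized as the image \<open>E\<close> of the intersection of
  \<open>K\<close> and \<open>[P, P]\<close> in \<open>P/[K, P]\<close>.\<close>

lemma is_H2_ex:
  assumes ep: "enough_projectives C" and U: "U \<in> Ob C"
  obtains H where "is_H2 C I U H"
proof -
  obtain p where pp: "projective_presentation C U p" using ep U unfolding enough_projectives_def by blast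
  define P where "P = Dom C p"
  have p: "regular_epi C p" "\<guillemotleft>p : P \<rightarrow> U\<guillemotright>"
    using pp regular_epi_arr[of p] unfolding projective_presentation_def P_def by (simp_all add: hom_def)
  have P: "P \<in> Ob C" using in_hom_ob(1)[OF p(2)] .
  obtain c where c: "is_relative_commutator C I p c" using relative_commutator_ex[OF p(2)] .
  obtain D Q q g where D: "\<guillemotleft>c : D \<rightarrow> P\<guillemotright>" "monic C c" "\<eta> P \<cdot> c = zmap D (R\<^sub>o P)" and q: "\<guillemotleft>q : P \<rightarrow> Q\<guillemotright>" "is_kernel C c q"
    and g: "\<guillemotleft>g : Q \<rightarrow> U\<guillemotright>" "regular_epi C g" "g \<cdot> q = p" "unit_central g"
    using commutator_quotient[OF p c] .
  have ob: "D \<in> Ob C" "Q \<in> Ob C" using D(1) q(1) in_hom_ob by blast+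
  have qc: "q \<cdot> c = zmap D Q" using kernel_comp[OF q(2,1) D(1)] .
  obtain K k where k: "is_kernel C k p" "\<guillemotleft>k : K \<rightarrow> P\<guillemotright>" "p \<cdot> k = zmap K U" using kernel_ex[OF p(2)] .
  obtain M \<mu> where \<mu>: "is_kernel C \<mu> (\<eta> P)" "\<guillemotleft>\<mu> : M \<rightarrow> P\<guillemotright>" using kernel_ex[OF unit_in_hom[OF P]] by metis
  obtain N a b where N: "is_pullback C k \<mu> a b" and ab: "\<guillemotleft>a : N \<rightarrow> K\<guillemotright>" "\<guillemotleft>b : N \<rightarrow> M\<guillemotright>" "k \<cdot> a = \<mu> \<cdot> b"
    using pullback_ex[OF k(2) \<mu>(2)] .
  have "p \<cdot> c = zmap D U" using D(1) q(1) g(1) ob by (simp add: hom_def g(3)[symmetric] qc)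
  then obtain c1 where c1: "\<guillemotleft>c1 : D \<rightarrow> K\<guillemotright>" "k \<cdot> c1 = c" using kernel_lift[OF k(1) p(2) k(2) D(1)] by blast
  obtain c2 where c2: "\<guillemotleft>c2 : D \<rightarrow> M\<guillemotright>" "\<mu> \<cdot> c2 = c" using kernel_lift[OF \<mu>(1) unit_in_hom[OF P] \<mu>(2) D(1,3)] .
  obtain j where j: "\<guillemotleft>j : D \<rightarrow> N\<guillemotright>" "a \<cdot> j = c1"
    using pullback_lift[OF N ab(1,2) c1(1) c2(1)] c1(2) c2(2) by metis
  define n where "n = k \<cdot> a"
  have n: "\<guillemotleft>n : N \<rightarrow> P\<guillemotright>" unfolding n_def using ab(1) k(2) by blast
  have nj: "n \<cdot> j = c" unfolding n_def using k(2) ab(1) j c1(2) by (simp add: hom_def)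
  have nm: "monic C n"
  proof (rule monicI[OF n])
    fix Z x y assume xy: "\<guillemotleft>x : Z \<rightarrow> N\<guillemotright>" "\<guillemotleft>y : Z \<rightarrow> N\<guillemotright>" "n \<cdot> x = n \<cdot> y"
    have "k \<cdot> (a \<cdot> x) = k \<cdot> (a \<cdot> y)" using xy k(2) ab(1) unfolding n_def by (simp add: hom_def)
    then have "a \<cdot> x = a \<cdot> y"
      using monic_cancel[OF kernel_monic[OF k(1)] k(2) comp_in_hom[OF xy(1) ab(1)] comp_in_hom[OF xy(2) ab(1)]] by simp
    then show "x = y" using monic_cancel[OF pullback_monic[OF N kernel_monic[OF \<mu>(1)]] ab(1) xy(1,2)] by simp
  qed
  obtain E e m where im: "regular_epi C e" "\<guillemotleft>e : N \<rightarrow> E\<guillemotright>" "monic C m" "\<guillemotleft>m : E \<rightarrow> Q\<guillemotright>" "m \<cdot> e = q \<cdot> n"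
    using image[OF comp_in_hom[OF n q(1)]] .
  have E: "E \<in> Ob C" using in_hom_ob(2)[OF im(2)] .
  have "m \<cdot> (e \<cdot> j) = m \<cdot> zmap D E"
    using im(2,4) j(1) n q(1) ob qc by (simp add: hom_def reassoc[OF im(5)] nj)
  then have ej: "e \<cdot> j = zmap D E"
    using monic_cancel[OF im(3,4) comp_in_hom[OF j(1) im(2)] zmap_in_hom[OF ob(1) E]] by simp
  \<comment> \<open>\<open>m\<close> is monic, so the kernel of \<open>e\<close> is what
    \<open>q\<close> kills, namely \<open>[K, P]\<close>; a regular epimorphism is the cokernel of
    its kernel.\<close>
  have jk: "is_kernel C j e"
  proof (rule kernelI[OF im(2) j(1) ej])
    show "monic C j" using monic_comp_cancel[OF _ j(1) n] nj D(2) by simp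
    fix Z y assume y: "\<guillemotleft>y : Z \<rightarrow> N\<guillemotright>" "e \<cdot> y = zmap Z E"
    have Z: "Z \<in> Ob C" using in_hom_ob(1)[OF y(1)] .
    have "q \<cdot> (n \<cdot> y) = m \<cdot> (e \<cdot> y)"
      using y(1) im(2,4) n q(1) by (simp add: hom_def reassoc[OF im(5)])
    then have "q \<cdot> (n \<cdot> y) = zmap Z Q" using y(2) im(4) Z by (simp add: hom_def)
    then obtain h where h: "\<guillemotleft>h : Z \<rightarrow> D\<guillemotright>" "c \<cdot> h = n \<cdot> y"
      using kernel_lift[OF q(2,1) D(1) comp_in_hom[OF y(1) n]] by blast
    have "n \<cdot> (j \<cdot> h) = n \<cdot> y" using n j(1) h by (simp add: hom_def reassoc[OF nj])
    then show "\<exists>h. \<guillemotleft>h : Z \<rightarrow> D\<guillemotright> \<and> j \<cdot> h = y"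
      using monic_cancel[OF nm n comp_in_hom[OF h(1) j(1)] y(1)] h(1) by blast
  qed
  have "\<exists>!h. h \<in> hom C E Z \<and> h \<cdot> e = x" if x: "\<guillemotleft>x : N \<rightarrow> Z\<guillemotright>" "zero_arr C (x \<cdot> j)" for Z x
  proof -
    have "x \<cdot> j = zmap D Z" using zero_arr_iff[OF comp_in_hom[OF j(1) x(1)]] x(2) by simp
    then obtain y where "\<guillemotleft>y : E \<rightarrow> Z\<guillemotright>" "y \<cdot> e = x" using regular_epi_kernel_lift[OF im(1,2) jk j(1) x(1)] by blast
    then show ?thesis using regular_epi_cancel[OF im(1,2)] by metis
  qed
  moreover have "Cod C j = N" "Cod C e = E" "j \<in> Ar C" using j(1) im(2) by (simp_all add: hom_def)
  moreover have "zero_arr C (e \<cdot> j)" using zero_arr_iff[OF comp_in_hom[OF j(1) im(2)]] ej by simp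
  ultimately have ck: "is_cokernel C e j" unfolding is_cokernel_def using im(2) by simp
  have "(k \<cdot> a) \<cdot> j = c" "j \<in> hom C (Dom C c) (Dom C a)"
    using nj j(1) D(1) ab(1) unfolding n_def by (simp_all add: hom_def)
  then have "is_H2 C I U (Cod C e)"
    unfolding is_H2_def using pp k(1) \<mu>(1) c N ck P_def by metis
  then show thesis using that by blast
qed

lemma is_H2E:
  assumes H: "is_H2 C I U H"
  obtains P K M N D p k \<mu> c a b j q where "regular_epi C p" "\<guillemotleft>p : P \<rightarrow> U\<guillemotright>" "projective C P"
    "is_kernel C k p" "\<guillemotleft>k : K \<rightarrow> P\<guillemotright>" "is_kernel C \<mu> (\<eta> P)" "\<guillemotleft>\<mu> : M \<rightarrow> P\<guillemotright>" "is_relative_commutator C I p c"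
    "\<guillemotleft>c : D \<rightarrow> P\<guillemotright>" "is_pullback C k \<mu> a b" "\<guillemotleft>a : N \<rightarrow> K\<guillemotright>" "\<guillemotleft>b : N \<rightarrow> M\<guillemotright>" "k \<cdot> a = \<mu> \<cdot> b"
    "\<guillemotleft>j : D \<rightarrow> N\<guillemotright>" "k \<cdot> (a \<cdot> j) = c" "is_cokernel C q j" "\<guillemotleft>q : N \<rightarrow> H\<guillemotright>"
proof -
  obtain p k \<mu> c a b j q where pp: "projective_presentation C U p" and k: "is_kernel C k p"
    and \<mu>: "is_kernel C \<mu> (\<eta> (Dom C p))" and c: "is_relative_commutator C I p c" and pb: "is_pullback C k \<mu> a b"
    and j: "j \<in> hom C (Dom C c) (Dom C a)" "(k \<cdot> a) \<cdot> j = c" and q: "is_cokernel C q j" and Hq: "H = Cod C q"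
    using H unfolding is_H2_def by metis
  have p: "regular_epi C p" "\<guillemotleft>p : Dom C p \<rightarrow> U\<guillemotright>" "projective C (Dom C p)"
    using pp regular_epi_arr[of p] unfolding projective_presentation_def by (simp_all add: hom_def)
  have P: "Dom C p \<in> Ob C" using in_hom_ob(1)[OF p(2)] .
  have kt: "\<guillemotleft>k : Dom C k \<rightarrow> Dom C p\<guillemotright>" "\<guillemotleft>\<mu> : Dom C \<mu> \<rightarrow> Dom C p\<guillemotright>"
    using kernelD(2)[OF k] kernelD(2)[OF \<mu>] P by simp_all
  have ab: "\<guillemotleft>a : Dom C a \<rightarrow> Dom C k\<guillemotright>" "\<guillemotleft>b : Dom C a \<rightarrow> Dom C \<mu>\<guillemotright>" "k \<cdot> a = \<mu> \<cdot> b"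
    using pullbackD(5-7)[OF pb] .
  have kaj: "k \<cdot> (a \<cdot> j) = c" using j kt(1) ab(1) by (simp add: hom_def)
  have ct: "\<guillemotleft>c : Dom C c \<rightarrow> Dom C p\<guillemotright>"
    using comp_in_hom[OF comp_in_hom[OF j(1) ab(1)] kt(1)] kaj by simp
  have "q \<in> hom C (Cod C j) (Cod C q)" using q unfolding is_cokernel_def by blast
  then have "\<guillemotleft>q : Dom C a \<rightarrow> H\<guillemotright>" using j(1) Hq by (simp add: hom_def)
  then show thesis using that[OF p k kt(1) \<mu> kt(2) c ct pb ab j(1) kaj q] by blast
qed

text \<open>A splitting \<open>s\<close> of \<open>Q = P/[K, P] -> U\<close> forces
  \<open>[Q, Q]\<close> into the image of \<open>s\<close>. The image of the intersection of
  \<open>K\<close> and \<open>[P, P]\<close> lies in \<open>[Q, Q]\<close> and in the kernel of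
  \<open>g\<close>, and these meet only in 0.\<close>

lemma split_central_extensions_H2_zero:
  assumes U: "\<eta> U = zmap U (R\<^sub>o U)" and H: "is_H2 C I U H"
    and split: "\<And>V g. regular_epi C g \<Longrightarrow> \<guillemotleft>g : V \<rightarrow> U\<guillemotright> \<Longrightarrow> unit_central g \<Longrightarrow> \<exists>s. \<guillemotleft>s : U \<rightarrow> V\<guillemotright> \<and> g \<cdot> s = idt U"
  shows "zero_obj C H"
proof -
  obtain P K M N D p k \<mu> c a b j q where p: "regular_epi C p" "\<guillemotleft>p : P \<rightarrow> U\<guillemotright>" "projective C P"
    and k: "is_kernel C k p" "\<guillemotleft>k : K \<rightarrow> P\<guillemotright>" and \<mu>: "is_kernel C \<mu> (\<eta> P)" "\<guillemotleft>\<mu> : M \<rightarrow> P\<guillemotright>"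
    and c: "is_relative_commutator C I p c" "\<guillemotleft>c : D \<rightarrow> P\<guillemotright>"
    and N: "is_pullback C k \<mu> a b" "\<guillemotleft>a : N \<rightarrow> K\<guillemotright>" "\<guillemotleft>b : N \<rightarrow> M\<guillemotright>" "k \<cdot> a = \<mu> \<cdot> b"
    and j: "\<guillemotleft>j : D \<rightarrow> N\<guillemotright>" "k \<cdot> (a \<cdot> j) = c" and q: "is_cokernel C q j" "\<guillemotleft>q : N \<rightarrow> H\<guillemotright>"
    using is_H2E[OF H] .
  obtain D' Q r g where "\<guillemotleft>c : D' \<rightarrow> P\<guillemotright>" "monic C c" "\<eta> P \<cdot> c = zmap D' (R\<^sub>o P)" and r: "\<guillemotleft>r : P \<rightarrow> Q\<guillemotright>" "is_kernel C c r"
    and g: "\<guillemotleft>g : Q \<rightarrow> U\<guillemotright>" "regular_epi C g" "g \<cdot> r = p" "unit_central g"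
    using commutator_quotient[OF p(1,2) c(1)] .
  have ob: "P \<in> Ob C" "N \<in> Ob C" "U \<in> Ob C" "H \<in> Ob C" "D \<in> Ob C" "M \<in> Ob C"
    using p(2) q(2) j(1) \<mu>(2) in_hom_ob by blast+
  obtain s where s: "\<guillemotleft>s : U \<rightarrow> Q\<guillemotright>" "g \<cdot> s = idt U" using split[OF g(2,1,4)] by blast
  define n where "n = k \<cdot> a"
  have n: "\<guillemotleft>n : N \<rightarrow> P\<guillemotright>" unfolding n_def using N(2) k(2) by blast
  have "\<eta> P \<cdot> n = zmap N (R\<^sub>o P)"
    unfolding n_def N(4) using N(3) \<mu>(2) ob
    by (simp add: hom_def reassoc[OF kernel_comp[OF \<mu>(1) unit_in_hom[OF ob(1)] \<mu>(2)]])
  then have rn: "\<guillemotleft>r \<cdot> n : N \<rightarrow> Q\<guillemotright>" "\<eta> Q \<cdot> (r \<cdot> n) = zmap N (R\<^sub>o Q)" using unit_zero_comp[OF r(1) n] n r(1) by auto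
  have gs: "regular_epi C (g \<cdot> s)" using s(2) iso_regular_epi[OF iso_ident ident_in_hom] ob by simp
  obtain y where y: "\<guillemotleft>y : N \<rightarrow> U\<guillemotright>" "s \<cdot> y = r \<cdot> n"
    using unit_central_restrict[OF g(4,1) split_mono[OF s(1) g(1) s(2)] s(1) gs rn] by blast
  have "y = g \<cdot> (s \<cdot> y)" using g(1) s(1) y(1) by (simp add: hom_def reassoc[OF s(2)])
  also have "\<dots> = p \<cdot> n" unfolding y(2) using g(1) r(1) n by (simp add: hom_def reassoc[OF g(3)])
  also have "\<dots> = zmap N U"
    unfolding n_def using k(2) N(2) p(2) ob by (simp add: hom_def reassoc[OF kernel_comp[OF k(1) p(2) k(2)]])
  finally have "r \<cdot> n = zmap N Q" using y(2) s(1) ob by (simp add: hom_def)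
  then obtain h where h: "\<guillemotleft>h : N \<rightarrow> D\<guillemotright>" "c \<cdot> h = n" using kernel_lift[OF r(2,1) c(2) n] by blast
  have am: "monic C a" using pullback_monic[OF N(1) kernel_monic[OF \<mu>(1)]] .
  \<comment> \<open>\<open>h\<close> is a right inverse of \<open>j\<close>, so
    \<open>q = q \<cdot> j \<cdot> h\<close> vanishes together with
    \<open>q \<cdot> j\<close>.\<close>
  have "k \<cdot> (a \<cdot> (j \<cdot> h)) = k \<cdot> (a \<cdot> idt N)"
    using k(2) N(2) j(1) h ob by (simp add: hom_def j(2)[symmetric] n_def)
  then have "a \<cdot> (j \<cdot> h) = a \<cdot> idt N"
    using monic_cancel[OF kernel_monic[OF k(1)] k(2)] comp_in_hom[OF comp_in_hom[OF h(1) j(1)] N(2)]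
      comp_in_hom[OF ident_in_hom[OF ob(2)] N(2)] by blast
  then have jh: "j \<cdot> h = idt N"
    using monic_cancel[OF am N(2) comp_in_hom[OF h(1) j(1)] ident_in_hom[OF ob(2)]] by simp
  have "zero_arr C (q \<cdot> j)" using q(1) unfolding is_cokernel_def by blast
  then have qj: "q \<cdot> j = zmap D H" using zero_arr_iff[OF comp_in_hom[OF j(1) q(2)]] by simp
  have "q = q \<cdot> (j \<cdot> h)" unfolding jh using q(2) by (simp add: hom_def)
  also have "\<dots> = zmap N H" using q(2) j(1) h(1) ob by (simp add: hom_def reassoc[OF qj])
  finally have q0: "q = zmap N H" .
  \<comment> \<open>Since the cokernel \<open>q\<close> is zero, \<open>idt H\<close> and
    \<open>zmap H H\<close> have the same composite with it and coincide.\<close>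
  have "\<exists>!l. l \<in> hom C H H \<and> l \<cdot> q = q"
  proof -
    have "Cod C j = N" "Cod C q = H" using j(1) q(2) by (simp_all add: hom_def)
    then show ?thesis using q(1,2) \<open>zero_arr C (q \<cdot> j)\<close> unfolding is_cokernel_def by metis
  qed
  moreover have "idt H \<cdot> q = q" "zmap H H \<cdot> q = q" using q(2) q0 ob by (simp_all add: hom_def)
  ultimately have "idt H = zmap H H" using ident_in_hom[OF ob(4)] zmap_in_hom[OF ob(4,4)] by metis
  then show ?thesis using zero_objI[OF ob(4)] by blast
qed

lemma H2_zero_split_central_extension:
  assumes U: "\<eta> U = zmap U (R\<^sub>o U)" and H: "is_H2 C I U H" "zero_obj C H"
    and g: "regular_epi C g" "\<guillemotleft>g : V \<rightarrow> U\<guillemotright>" "unit_central g"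
  obtains s where "\<guillemotleft>s : U \<rightarrow> V\<guillemotright>" "g \<cdot> s = idt U"
proof -
  obtain P K M N D p k \<mu> c a b j q where p: "regular_epi C p" "\<guillemotleft>p : P \<rightarrow> U\<guillemotright>" "projective C P"
    and k: "is_kernel C k p" "\<guillemotleft>k : K \<rightarrow> P\<guillemotright>" and \<mu>: "is_kernel C \<mu> (\<eta> P)" "\<guillemotleft>\<mu> : M \<rightarrow> P\<guillemotright>"
    and c: "is_relative_commutator C I p c" "\<guillemotleft>c : D \<rightarrow> P\<guillemotright>"
    and N: "is_pullback C k \<mu> a b" "\<guillemotleft>a : N \<rightarrow> K\<guillemotright>" "\<guillemotleft>b : N \<rightarrow> M\<guillemotright>" "k \<cdot> a = \<mu> \<cdot> b"
    and j: "\<guillemotleft>j : D \<rightarrow> N\<guillemotright>" "k \<cdot> (a \<cdot> j) = c" and q: "is_cokernel C q j" "\<guillemotleft>q : N \<rightarrow> H\<guillemotright>"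
    using is_H2E[OF H(1)] .
  have ob: "P \<in> Ob C" "N \<in> Ob C" "U \<in> Ob C" "V \<in> Ob C" "D \<in> Ob C" "M \<in> Ob C" "H \<in> Ob C"
    using p(2) q(2) j(1) \<mu>(2) g(2) in_hom_ob by blast+
  have "p \<in> hom C P (Cod C g)" "Dom C g = V" using p(2) g(2) by (simp_all add: hom_def)
  then obtain t where t: "\<guillemotleft>t : P \<rightarrow> V\<guillemotright>" "g \<cdot> t = p" using p(3) g(1) unfolding projective_def by metis
  \<comment> \<open>The arrows \<open>t \<cdot> r0\<close> and \<open>t \<cdot> r1\<close> agree
    over \<open>U\<close>, hence on \<open>[R, R]\<close> by centrality; where \<open>r0\<close>
    vanishes, so does \<open>t \<cdot> r1\<close>.\<close>
  have tc: "t \<cdot> c = zmap D V"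
  proof -
    obtain D' R r0 r1 x where r: "kernel_pair C p r0 r1" "\<guillemotleft>r0 : R \<rightarrow> P\<guillemotright>" "\<guillemotleft>r1 : R \<rightarrow> P\<guillemotright>"
      and x: "\<guillemotleft>x : D' \<rightarrow> R\<guillemotright>" "\<eta> R \<cdot> x = zmap D' (R\<^sub>o R)" "r0 \<cdot> x = zmap D' P" "r1 \<cdot> x = c" and c': "\<guillemotleft>c : D' \<rightarrow> P\<guillemotright>"
      using relative_commutatorE[OF c(1) p(2)] by metis
    have D: "D' = D" using c(2) c' by (simp add: hom_def)
    have "g \<cdot> (t \<cdot> r0) = g \<cdot> (t \<cdot> r1)"
      using pullbackD(7)[OF r(1)] g(2) t(1) r(2,3) by (simp add: hom_def reassoc[OF t(2)])
    then have "(t \<cdot> r0) \<cdot> x = (t \<cdot> r1) \<cdot> x"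
      using unit_centralD[OF g(3,2) comp_in_hom[OF r(2) t(1)] comp_in_hom[OF r(3) t(1)] _ x(1,2)] by blast
    then have "t \<cdot> zmap D P = t \<cdot> c" using t(1) r(2,3) x(1,3,4) D by (simp add: hom_def)
    then show ?thesis using t(1) ob by (simp add: hom_def)
  qed
  define n where "n = k \<cdot> a"
  have n: "\<guillemotleft>n : N \<rightarrow> P\<guillemotright>" unfolding n_def using N(2) k(2) by blast
  have tn: "\<guillemotleft>t \<cdot> n : N \<rightarrow> V\<guillemotright>" using n t(1) by blast
  have "(t \<cdot> n) \<cdot> j = zmap D V" using t(1) n j k(2) N(2) tc unfolding n_def by (simp add: hom_def)
  then have "zero_arr C ((t \<cdot> n) \<cdot> j)" using zero_arr_iff[OF comp_in_hom[OF j(1) tn]] by simp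
  moreover have "Cod C j = N" "Cod C q = H" using j(1) q(2) by (simp_all add: hom_def)
  ultimately obtain y where y: "\<guillemotleft>y : H \<rightarrow> V\<guillemotright>" "y \<cdot> q = t \<cdot> n"
    using q(1) tn unfolding is_cokernel_def by metis
  \<comment> \<open>As \<open>t\<close> kills \<open>[K, P]\<close>, its restriction to the
    intersection factors through \<open>H = 0\<close>, so \<open>t\<close> vanishes on the whole
    intersection.\<close>
  have "y = zmap H V" using zero_obj_zmap(2)[OF H(2) y(1)] .
  then have tn0: "t \<cdot> n = zmap N V" using y(2) q(2) ob by (simp add: hom_def)
  have p\<mu>: "\<guillemotleft>p \<cdot> \<mu> : M \<rightarrow> U\<guillemotright>" "\<guillemotleft>t \<cdot> \<mu> : M \<rightarrow> V\<guillemotright>" using p(2) \<mu>(2) t(1) by blast+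
  have p\<mu>r: "regular_epi C (p \<cdot> \<mu>)" using perfect_regular_epi_on_kernel[OF U p(1,2) \<mu>] .
  \<comment> \<open>\<open>U\<close> is the quotient of \<open>[P, P]\<close> by this kernel, so
    \<open>t\<close> restricted to \<open>[P, P]\<close> descends to \<open>U\<close>.\<close>
  have "is_kernel C b (p \<cdot> \<mu>)"
  proof (rule kernelI[OF p\<mu>(1) N(3)])
    have "(p \<cdot> \<mu>) \<cdot> b = p \<cdot> (k \<cdot> a)" using p(2) \<mu>(2) N(3,4) by (simp add: hom_def)
    then show "(p \<cdot> \<mu>) \<cdot> b = zmap N U"
      using k(2) N(2) p(2) ob by (simp add: hom_def reassoc[OF kernel_comp[OF k(1) p(2) k(2)]])
    show "monic C b" using pullback_monic[OF pullback_swap[OF N(1)] kernel_monic[OF k(1)]] .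
    fix Z x assume x: "\<guillemotleft>x : Z \<rightarrow> M\<guillemotright>" "(p \<cdot> \<mu>) \<cdot> x = zmap Z U"
    have "p \<cdot> (\<mu> \<cdot> x) = zmap Z U" using x p(2) \<mu>(2) by (simp add: hom_def)
    then obtain z where z: "\<guillemotleft>z : Z \<rightarrow> K\<guillemotright>" "k \<cdot> z = \<mu> \<cdot> x"
      using kernel_lift[OF k(1) p(2) k(2) comp_in_hom[OF x(1) \<mu>(2)]] by blast
    then show "\<exists>h. \<guillemotleft>h : Z \<rightarrow> N\<guillemotright> \<and> b \<cdot> h = x"
      using pullback_lift[OF N(1-3) z(1) x(1) z(2)] by metis
  qed
  moreover have "(t \<cdot> \<mu>) \<cdot> b = zmap N V" using tn0 t(1) \<mu>(2) N(3,4) unfolding n_def by (simp add: hom_def)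
  ultimately obtain s where s: "\<guillemotleft>s : U \<rightarrow> V\<guillemotright>" "s \<cdot> (p \<cdot> \<mu>) = t \<cdot> \<mu>"
    using regular_epi_kernel_lift[OF p\<mu>r p\<mu>(1) _ N(3) p\<mu>(2)] by blast
  have "(g \<cdot> s) \<cdot> (p \<cdot> \<mu>) = g \<cdot> (t \<cdot> \<mu>)" using g(2) s p\<mu>(1) p(2) \<mu>(2) by (simp add: hom_def)
  also have "\<dots> = idt U \<cdot> (p \<cdot> \<mu>)" using g(2) t(1) \<mu>(2) p\<mu>(1) p(2) by (simp add: hom_def reassoc[OF t(2)])
  finally have "g \<cdot> s = idt U"
    using regular_epi_cancel[OF p\<mu>r p\<mu>(1) comp_in_hom[OF s(1) g(2)] ident_in_hom[OF ob(3)]] by simp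
  then show thesis using that s(1) by blast
qed

section \<open>Universal central extensions\<close>

lemma universal_central_extension_perfect:
  assumes u: "universal_central_extension C X A u" "\<guillemotleft>u : U \<rightarrow> A\<guillemotright>"
  shows "\<eta> U = zmap U (R\<^sub>o U)"
proof -
  have ob: "U \<in> Ob C" "A \<in> Ob C" using in_hom_ob[OF u(2)] by auto
  note RU = Rob_ob[OF ob(1)] and \<eta>U = unit_in_hom[OF ob(1)]
  obtain P p q where pr: "is_product C A (R\<^sub>o U) p q" and pq: "\<guillemotleft>p : P \<rightarrow> A\<guillemotright>" "\<guillemotleft>q : P \<rightarrow> R\<^sub>o U\<guillemotright>"
    using product_ex[OF ob(2) RU] .
  obtain i where i: "\<guillemotleft>i : A \<rightarrow> P\<guillemotright>" "p \<cdot> i = idt A"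
    using product_lift[OF pr pq(1) ident_in_hom[OF ob(2)] zmap_in_hom[OF ob(2) RU]] by blast
  \<comment> \<open>Two elements with equal image in \<open>A\<close> differ only in
    \<open>I(U)\<close>, and arrows into \<open>X\<close> kill commutators.\<close>
  have "unit_central p"
  proof (rule unit_centralI[OF pq(1)])
    fix T a b Z x assume ab: "\<guillemotleft>a : T \<rightarrow> P\<guillemotright>" "\<guillemotleft>b : T \<rightarrow> P\<guillemotright>" "p \<cdot> a = p \<cdot> b"
      and x: "\<guillemotleft>x : Z \<rightarrow> T\<guillemotright>" "\<eta> T \<cdot> x = zmap Z (R\<^sub>o T)"
    have "(q \<cdot> a) \<cdot> x = (q \<cdot> b) \<cdot> x"
      using unit_zero_to_X[OF comp_in_hom[OF ab(1) pq(2)] Rob_in[OF ob(1)] x]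
        unit_zero_to_X[OF comp_in_hom[OF ab(2) pq(2)] Rob_in[OF ob(1)] x] by simp
    then show "a \<cdot> x = b \<cdot> x"
      using product_unique[OF pr pq comp_in_hom[OF x(1) ab(1)] comp_in_hom[OF x(1) ab(2)]] ab pq x(1)
      by (simp add: hom_def reassoc[OF ab(3)])
  qed
  then have pc: "central_extension C X p"
    using unit_central_central_extension split_epi_regular[OF pq(1) i] by blast
  have d: "Cod C p = A" "Dom C p = P" "Dom C u = U" using pq(1) u(2) by (simp_all add: hom_def)
  then have "\<exists>!h. h \<in> hom C U P \<and> p \<cdot> h = u"
    using u(1) pc unfolding universal_central_extension_def by blast
  moreover obtain h where "\<guillemotleft>h : U \<rightarrow> P\<guillemotright>" "p \<cdot> h = u" "q \<cdot> h = \<eta> U" using product_lift[OF pr pq(1) u(2) \<eta>U] .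
  moreover obtain h' where "\<guillemotleft>h' : U \<rightarrow> P\<guillemotright>" "p \<cdot> h' = u" "q \<cdot> h' = zmap U (R\<^sub>o U)"
    using product_lift[OF pr pq(1) u(2) zmap_in_hom[OF ob(1) RU]] .
  ultimately show ?thesis by metis
qed

text \<open>The hypothesis on composites asks for \<open>Ab C\<close>-perfectness. The zero object
  lies in \<open>Ab C\<close>, so the zero reflection into \<open>X\<close> is also one into
  \<open>Ab C\<close>.\<close>

lemma perfect_Ab:
  assumes U: "U \<in> Ob C" "\<eta> U = zmap U (R\<^sub>o U)" and Ab: "Ab C \<subseteq> X"
  shows "perfect C (Ab C) U"
proof -
  have z: "zero_obj C (R\<^sub>o U)" using zero_Rob_iff[OF U(1)] U(2) by simp
  then have "is_reflection C (Ab C) U (\<eta> U)" using reflection_restrict[OF U(1) Ab zero_obj_abelian] by blast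
  then show ?thesis unfolding perfect_def using U(1) z unit_arr(3)[OF U(1)] by metis
qed

text \<open>\<open>W = [V, V]\<close> is perfect and still maps onto \<open>U\<close>, so \<open>W \<rightarrow> U\<close> is \<open>Ab\<close>-central and can be composed
  with \<open>u\<close>; universality of \<open>u\<close> then splits it.\<close>

lemma universal_splits_central_extension:
  assumes composition: "\<And>P f g. perfect C (Ab C) P \<Longrightarrow> central_extension C (Ab C) f \<Longrightarrow> Dom C f = P \<Longrightarrow>
        central_extension C (Ab C) g \<Longrightarrow> Cod C g = P \<Longrightarrow> central_extension C (Ab C) (f \<cdot> g)"
    and Ab: "Ab C \<subseteq> X" and u: "universal_central_extension C X A u" "\<guillemotleft>u : U \<rightarrow> A\<guillemotright>"
    and g: "regular_epi C g" "\<guillemotleft>g : V \<rightarrow> U\<guillemotright>" "unit_central g"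
  obtains s where "\<guillemotleft>s : U \<rightarrow> V\<guillemotright>" "g \<cdot> s = idt U"
proof -
  have ob: "U \<in> Ob C" "V \<in> Ob C" using u(2) g(2) in_hom_ob by blast+
  have U: "\<eta> U = zmap U (R\<^sub>o U)" using universal_central_extension_perfect[OF u] .
  have uc: "regular_epi C u" "unit_central u"
    using u(1) central_extension_iff unfolding universal_central_extension_def by blast+
  obtain W k where k: "is_kernel C k (\<eta> V)" "\<guillemotleft>k : W \<rightarrow> V\<guillemotright>" using kernel_ex[OF unit_in_hom[OF ob(2)]] by metis
  note W = perfect_commutator[OF U g k] and gkr = perfect_regular_epi_on_kernel[OF U g(1,2) k]
  have gk: "\<guillemotleft>g \<cdot> k : W \<rightarrow> U\<guillemotright>" using k(2) g(2) by blast
  have "central_extension C (Ab C) (u \<cdot> (g \<cdot> k))"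
  proof (rule composition[OF perfect_Ab[OF ob(1) U Ab]])
    show "central_extension C (Ab C) u" using perfect_central_extension_abelian[OF U uc(1) u(2) uc(2) Ab] .
    show "central_extension C (Ab C) (g \<cdot> k)" using perfect_central_extension_abelian[OF W(1) gkr gk W(2) Ab] .
    show "Dom C u = U" "Cod C (g \<cdot> k) = U" using u(2) gk by (simp_all add: hom_def)
  qed
  \<comment> \<open>Return from \<open>Ab C\<close> to \<open>X\<close>, the subcategory for which
    \<open>u\<close> is universal.\<close>
  then have "unit_central (u \<cdot> (g \<cdot> k))" "regular_epi C (u \<cdot> (g \<cdot> k))"
    using central_extension_unit_central[OF _ Ab] unfolding central_extension_def by blast+
  then have cc: "central_extension C X (u \<cdot> (g \<cdot> k))" using unit_central_central_extension by blast
  have univ: "\<exists>!h. h \<in> hom C U (Dom C f) \<and> f \<cdot> h = u" if "central_extension C X f" "Cod C f = A" for f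
  proof -
    have "Dom C u = U" using u(2) by (simp add: hom_def)
    then show ?thesis using u(1) that unfolding universal_central_extension_def by blast
  qed
  have d: "Cod C (u \<cdot> (g \<cdot> k)) = A" "Dom C (u \<cdot> (g \<cdot> k)) = W" "Cod C u = A" "Dom C u = U"
    using u(2) gk by (simp_all add: hom_def)
  obtain h where h: "\<guillemotleft>h : U \<rightarrow> W\<guillemotright>" "(u \<cdot> (g \<cdot> k)) \<cdot> h = u" using univ[OF cc d(1)] d(2) by auto
  have kh: "\<guillemotleft>k \<cdot> h : U \<rightarrow> V\<guillemotright>" using h(1) k(2) by blast
  have "u \<cdot> (g \<cdot> (k \<cdot> h)) = u" using h u(2) g(2) k(2) by (simp add: hom_def)
  moreover have "u \<cdot> idt U = u" using u(2) by (simp add: hom_def)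
  moreover have "central_extension C X u" using u(1) unfolding universal_central_extension_def by blast
  \<comment> \<open>Both arrows are endomorphisms of \<open>u\<close> over \<open>A\<close>, which
    universality allows only once.\<close>
  ultimately have "g \<cdot> (k \<cdot> h) = idt U"
    using univ[of u] d(3,4) comp_in_hom[OF kh g(2)] ident_in_hom[OF ob(1)] by metis
  then show thesis using that kh by blast
qed

text \<open>A section of the pullback of \<open>f\<close> along \<open>u\<close> is the same as an
  arrow \<open>u -> f\<close> over \<open>A\<close>; uniqueness comes from perfectness of
  \<open>U\<close>.\<close>

lemma split_central_extensions_universal:
  assumes U: "\<eta> U = zmap U (R\<^sub>o U)" and u: "\<guillemotleft>u : U \<rightarrow> A\<guillemotright>" "central_extension C X u"
    and split: "\<And>V g. regular_epi C g \<Longrightarrow> \<guillemotleft>g : V \<rightarrow> U\<guillemotright> \<Longrightarrow> unit_central g \<Longrightarrow> \<exists>s. \<guillemotleft>s : U \<rightarrow> V\<guillemotright> \<and> g \<cdot> s = idt U"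
  shows "universal_central_extension C X A u"
proof -
  have d: "Dom C u = U" "Cod C u = A" using u(1) by (simp_all add: hom_def)
  have "\<exists>!h. h \<in> hom C U (Dom C f) \<and> f \<cdot> h = u" if f: "central_extension C X f" "Cod C f = A" for f
  proof -
    have fc: "regular_epi C f" "unit_central f" using f(1) central_extension_iff by blast+
    have ft: "\<guillemotleft>f : Dom C f \<rightarrow> A\<guillemotright>" using regular_epi_arr[OF fc(1)] f(2) by (simp add: hom_def)
    obtain V p q where V: "is_pullback C u f p q" "\<guillemotleft>p : V \<rightarrow> U\<guillemotright>" "\<guillemotleft>q : V \<rightarrow> Dom C f\<guillemotright>" "u \<cdot> p = f \<cdot> q"
      using pullback_ex[OF u(1) ft] .
    obtain s where s: "\<guillemotleft>s : U \<rightarrow> V\<guillemotright>" "p \<cdot> s = idt U"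
      using split[OF pullback_regular_epi(1)[OF V(1) fc(1)] V(2) unit_central_pullback[OF fc(2) ft V(1-3)]] by blast
    have "f \<cdot> (q \<cdot> s) = u" using ft u(1) V(2,3) s by (simp add: hom_def reassoc[OF V(4)[symmetric]])
    then show ?thesis using comp_in_hom[OF s(1) V(3)] perfect_lift_unique[OF U fc(2) ft] by metis
  qed
  then show ?thesis unfolding universal_central_extension_def using u(2) d by simp
qed

end

theorem theorem4p4:
  fixes C :: "('o, 'a) cat"
    and X :: "'o set"
    and I :: "('o, 'a) reflector"
    and A U :: 'o
    and u :: 'a
  assumes "semi_abelian C"
    and "enough_projectives C"
    and composition:
      "\<And>P f g. perfect C (Ab C) P \<Longrightarrow>
        central_extension C (Ab C) f \<Longrightarrow> Dom C f = P \<Longrightarrow>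
        central_extension C (Ab C) g \<Longrightarrow> Cod C g = P \<Longrightarrow>
        central_extension C (Ab C) (f \<cdot>\<^bsub>C\<^esub> g)"
    and "birkhoff_subcategory C X"
    and "Ab C \<subseteq> X"
    and "is_reflector C X I"
    and "u \<in> hom C U A"
    and "central_extension C X u"
  shows "universal_central_extension C X A u \<longleftrightarrow>
    zero_obj C (H1 I U) \<and> zero_obj C (H2 C I U)"
proof -
  interpret birkhoff_reflector C X I
    using assms(1,4,6)
    by unfold_locales (simp_all add: semi_abelian_def barr_exact_def)
  have U: "U \<in> Ob C" using in_hom_ob(1)[OF assms(7)] .
  \<comment> \<open>\<open>H2\<close> is a \<open>SOME\<close>, so an object satisfying
    \<open>is_H2\<close> must exist first; both implications then work with whichever presentation
    the choice provides.\<close>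
  have H2: "is_H2 C I U (H2 C I U)"
    using is_H2_ex[OF assms(2) U] unfolding H2_def by (metis someI)
  have H1: "zero_obj C (H1 I U) \<longleftrightarrow> \<eta> U = zmap U (R\<^sub>o U)" using zero_Rob_iff[OF U] by (simp add: H1_def)
  show ?thesis
  proof
    assume univ: "universal_central_extension C X A u"
    have perf: "\<eta> U = zmap U (R\<^sub>o U)" using universal_central_extension_perfect[OF univ assms(7)] .
    moreover have "zero_obj C (H2 C I U)"
    proof (rule split_central_extensions_H2_zero[OF perf H2])
      fix V g assume "regular_epi C g" "\<guillemotleft>g : V \<rightarrow> U\<guillemotright>" "unit_central g"
      then obtain s where "\<guillemotleft>s : U \<rightarrow> V\<guillemotright>" "g \<cdot>\<^bsub>C\<^esub> s = idt U"
        using universal_splits_central_extension[OF _ assms(5) univ assms(7)] composition by blast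
      then show "\<exists>s. \<guillemotleft>s : U \<rightarrow> V\<guillemotright> \<and> g \<cdot>\<^bsub>C\<^esub> s = idt U" by blast
    qed
    ultimately show "zero_obj C (H1 I U) \<and> zero_obj C (H2 C I U)" using H1 by simp
  next
    assume "zero_obj C (H1 I U) \<and> zero_obj C (H2 C I U)"
    then have perf: "\<eta> U = zmap U (R\<^sub>o U)" and H: "zero_obj C (H2 C I U)" using H1 by auto
    show "universal_central_extension C X A u"
      using split_central_extensions_universal[OF perf assms(7,8)]
        H2_zero_split_central_extension[OF perf H2 H] by metis
  qed
qed

end
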